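(* Let $n\ge2$, let $1\le k\le n$ be integers, and let $\Omega\subset\mathbb{R}^n$ be open. Let $T$ be a normal $k$-current on $\Omega$, with representations $T=\tau\mu$ and $\partial T=\tau'\mu'$, where $\mu,\mu'$ are finite positive Borel measures on $\Omega$ and $\tau:\Omega\to\wedge_k(\mathbb{R}^n)$, $\tau':\Omega\to\wedge_{k-1}(\mathbb{R}^n)$ are Borel maps with $\tau\in L^1(\mu)$, $\tau'\in L^1(\mu')$. Let $\mathcal{D}$ be a $k$-distribution of class $C^1$ on $\Omega$, and let $\Upsilon$ denote the set of all points $x\in\Omega$ such that: (i) $\tau(x)\neq0$; (ii) there exists $s(x)\in[0,+\infty)$ such that $\Theta_*^{s(x)}(\mu,x)=\Theta^{*s(x)}(\mu,x)\in(0,+\infty)$; (iii) $x\in\Gamma(\tau,\mathcal{D})^{|\tau\mu|,1}$; (iv) $|\tau'\mu'|\big(B_r(x)\setminus\Gamma(\tau',\mathcal{D})\big)=o(r^{s(x)})$ as $r\to0+$. Let $N\subset\Omega$ be a set with $\mu(N)=0$ such that, for all $x\in\Omega\setminus N$, $\mu(B_r(x))>0$ for all $r>0$ and $$\lim_{r\to0+}\frac{\int_{B_r(x)}\tau\,d\mu}{\mu(B_r(x))}=\tau(x),\qquad \lim_{r\to0+}\frac{\int_{B_r(x)}|\tau|\,d\mu}{\mu(B_r(x))}=|\tau(x)|.$$ If $x\in\Upsilon\setminus N$, then: (1) the $k$-vector $\tau(x)$ is simple and $\mathrm{span}(\tau(x))=\mathcal{D}(x)$; (2) the distribution $\mathcal{D}$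 is involutive at $x$.
   Context: $B_r(x)$ is the open ball of radius $r$ centered at $x$. $\wedge_h(\mathbb{R}^n)$ and $\wedge^h(\mathbb{R}^n)$ are the spaces of $h$-vectors and $h$-covectors, with the standard duality $\langle\cdot;\cdot\rangle$ (standard bases $e_{\mathbf i}$ and $dx_{\mathbf i}$ dual to each other). Interior multiplication and span: for $v\in\wedge_h(\mathbb{R}^n)$ and $\alpha\in\wedge^p(\mathbb{R}^n)$ with $p\le h$, $v\llcorner\alpha\in\wedge_{h-p}(\mathbb{R}^n)$ is defined by $\langle v\llcorner\alpha;\beta\rangle=\langle v;\alpha\wedge\beta\rangle$ for all $\beta\in\wedge^{h-p}(\mathbb{R}^n)$. For $h\ge1$, $\mathrm{span}(v):=\{v\llcorner\alpha\mid\alpha\in\wedge^{h-1}(\mathbb{R}^n)\}\subset\mathbb{R}^n$. The span of a $0$-vector is $\{0\}$. Currents: an $h$-current on $\Omega$ is a continuous linear functional on the space $\mathcal{E}_h$ of smooth compactly supported differential $h$-forms on $\Omega$. Its boundary is given by $\langle\partial T;\omega\rangle=\langle T;d\omega\rangle$ for $\omega\in\mathcal{E}_{h-1}$, and its mass is $\mathbb{M}(T)=\sup\{\langle T;\omega\rangle\mid\omega\in\mathcal{E}_h,\ |\omega(x)|\le1\ \forall x\in\Omega\}$. $T$ is normal if $\mathbb{M}(T)$ and $\mathbb{M}(\partial T)$ are finite. $T=\tau\mu$ means $\langle T;\omega\rangle=\int_\Omega\langle\tau;\omega\rangle\,d\mu$ for all $\omega\in\mathcal{E}_h$; a current has finite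 mass iff it admits such a representation with $\mu$ a finite positive Borel measure and $\tau\in L^1(\mu)$ Borel. $|\tau\mu|$ denotes the total variation, and $|\tau\mu|=|\tau|\mu$ (similarly $|\tau'\mu'|=|\tau'|\mu'$). Densities: $\Theta^s_*(\mu,x)=\liminf_{r\to0+}\frac{\mu(B_r(x))}{(2r)^s}$ and $\Theta^{*s}(\mu,x)=\limsup_{r\to0+}\frac{\mu(B_r(x))}{(2r)^s}$. Superdensity: for a Borel set $E\subset\Omega$, a Borel measure $\lambda$ on $\Omega$ and $m\in[0,+\infty)$, $E^{\lambda,m}$ is the set of all $x\in\Omega$ with $\lambda(B_r(x)\setminus E)=\lambda(B_r(x))\,o(r^m)$ as $r\to0+$. Distributions: a $k$-distribution $\mathcal{D}$ on $\Omega$ assigns to each $x\in\Omega$ a $k$-dimensional linear subspace $\mathcal{D}(x)\subset\mathbb{R}^n$. It is of class $C^p$ if every $x\in\Omega$ has a neighborhood $U\subset\Omega$ with $C^p$ differential $1$-forms $\omega^{(1)},\dots,\omega^{(n-k)}$ on $U$ (called defining forms) such that $\mathcal{D}(y)=\bigcap_{j=1}^{n-k}\ker\omega^{(j)}_y$ for all $y\in U$. A $k$-distribution $\mathcal{D}$ of class $C^1$ is involutive at $x$ if there is a family of ($C^1$) defining forms in a neighborhood of $x$ with $(d\omega^{(j)})_x|_{\mathcal{D}(x)\times\mathcal{D}(x)}=0$ for all $j=1,\dots,n-k$ (this does not depend on the choice of defining forms). Tangency set: for an $h$-vectorfield $\tau$ on $\Omega$ with $h\le k$, $\Gamma(\tau,\mathcal{D}):=\{x\in\Omega\mid\mathrm{span}(\tau(x))\subset\mathcal{D}(x)\}$.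 *)

theory Defs
  imports "HOL-Analysis.Analysis" "HOL-Library.Landau_Symbols"
begin

section \<open>Multivectors and multicovectors\<close>

text \<open>
  The exterior algebra of \<open>real^'n\<close> has a basis indexed by the subsets of \<open>'n\<close>: the set
  \<open>I = {i\<^sub>1 < \<dots> < i\<^sub>h}\<close> stands for \<open>e\<^sub>i\<^sub>1 \<and> \<dots> \<and> e\<^sub>i\<^sub>h\<close> (or for \<open>dx\<^sub>i\<^sub>1 \<and> \<dots> \<and> dx\<^sub>i\<^sub>h\<close>). Vectors and covectors
  are both given by their coordinates in these bases. As the two bases are dual to each other, the
  duality pairing is the inner product of \<open>real^('n set)\<close>, and the norm of this type is the
  Euclidean norm that makes the standard basis orthonormal.
\<close>

type_synonym 'n euc = "real^'n"
type_synonym 'n mvec = "real^('n set)"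
type_synonym 'n form = "'n euc \<Rightarrow> 'n mvec"

definition grade :: "nat \<Rightarrow> 'n::finite mvec set"
  where "grade h = {v. \<forall>I. card I \<noteq> h \<longrightarrow> v $ I = 0}"

text \<open>\<open>shuffle_sign I J\<close> is the sign of the permutation that sorts \<open>I\<close> followed by \<open>J\<close>.\<close>

definition shuffle_sign :: "'n::{finite,linorder} set \<Rightarrow> 'n set \<Rightarrow> real"
  where "shuffle_sign I J = (- 1) ^ card {(i, j). i \<in> I \<and> j \<in> J \<and> j < i}"

definition wedge :: "'n::{finite,linorder} mvec \<Rightarrow> 'n mvec \<Rightarrow> 'n mvec"
  where "wedge \<alpha> \<beta> = (\<chi> K. \<Sum>I\<in>Pow K. shuffle_sign I (K - I) * \<alpha> $ I * \<beta> $ (K - I))"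

definition of_vec :: "'n euc \<Rightarrow> 'n::finite mvec"
  where "of_vec v = (\<Sum>i\<in>UNIV. v $ i *\<^sub>R axis {i} 1)"

definition to_vec :: "'n::finite mvec \<Rightarrow> 'n euc"
  where "to_vec w = (\<chi> i. w $ {i})"

definition simple_mvec :: "nat \<Rightarrow> 'n::{finite,linorder} mvec \<Rightarrow> bool"
  where "simple_mvec h v \<longleftrightarrow>
    (\<exists>us. length us = h \<and> v = foldr (\<lambda>u w. wedge (of_vec u) w) us (axis {} 1))"

text \<open>Interior multiplication of an \<open>h\<close>-vector by a \<open>p\<close>-covector, for \<open>p \<le> h\<close>.\<close>

definition interior_mult :: "nat \<Rightarrow> nat \<Rightarrow> 'n::{finite,linorder} mvec \<Rightarrow> 'n mvec \<Rightarrow> 'n mvec"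
  where "interior_mult h p v \<alpha> =
    (THE w. w \<in> grade (h - p) \<and> (\<forall>\<beta>\<in>grade (h - p). w \<bullet> \<beta> = v \<bullet> wedge \<alpha> \<beta>))"

definition mvec_span :: "nat \<Rightarrow> 'n::{finite,linorder} mvec \<Rightarrow> 'n euc set"
  where "mvec_span h v =
    (if h = 0 then {0} else {to_vec (interior_mult h (h - 1) v \<alpha>) | \<alpha>. \<alpha> \<in> grade (h - 1)})"

lemma wedge_linear_right: "linear (wedge \<alpha>)"
  by (rule linearI)
     (simp_all add: wedge_def vec_eq_iff algebra_simps sum.distrib sum_distrib_left)

lemma interior_mult_unique_existence:
  fixes v \<alpha> :: "'n::{finite,linorder} mvec"
  shows "\<exists>!w. w \<in> grade q \<and> (\<forall>\<beta>\<in>grade q. w \<bullet> \<beta> = v \<bullet> wedge \<alpha> \<beta>)"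
proof
  let ?w = "(\<chi> J. if card J = q then v \<bullet> wedge \<alpha> (axis J 1) else 0) :: 'n mvec"
  have "?w \<bullet> \<beta> = v \<bullet> wedge \<alpha> \<beta>" if \<beta>: "\<beta> \<in> grade q" for \<beta>
  proof -
    have "\<beta> = (\<Sum>J\<in>UNIV. \<beta> $ J *\<^sub>R axis J 1)"
      using basis_expansion[of \<beta>] by (simp add: scalar_mult_eq_scaleR)
    then have "wedge \<alpha> \<beta> = (\<Sum>J\<in>UNIV. \<beta> $ J *\<^sub>R wedge \<alpha> (axis J 1))"
      using linear_sum[OF wedge_linear_right, of \<alpha> "\<lambda>J. \<beta> $ J *\<^sub>R axis J 1" UNIV]
      by (simp add: linear_cmul[OF wedge_linear_right])
    then have "v \<bullet> wedge \<alpha> \<beta> = (\<Sum>J\<in>UNIV. \<beta> $ J * (v \<bullet> wedge \<alpha> (axis J 1)))"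
      by (simp add: inner_sum_right)
    also have "\<dots> = ?w \<bullet> \<beta>"
      using \<beta> unfolding inner_vec_def by (intro sum.cong) (auto simp: grade_def)
    finally show ?thesis by simp
  qed
  then show "?w \<in> grade q \<and> (\<forall>\<beta>\<in>grade q. ?w \<bullet> \<beta> = v \<bullet> wedge \<alpha> \<beta>)"
    by (simp add: grade_def)
next
  fix w
  assume w: "w \<in> grade q \<and> (\<forall>\<beta>\<in>grade q. w \<bullet> \<beta> = v \<bullet> wedge \<alpha> \<beta>)"
  show "w = (\<chi> J. if card J = q then v \<bullet> wedge \<alpha> (axis J 1) else 0)"
  proof (subst vec_eq_iff, intro allI)
    fix J :: "'n set"
    have "axis J 1 \<in> grade q" if "card J = q"
      using that by (auto simp: grade_def axis_def)
    then have "w $ J = v \<bullet> wedge \<alpha> (axis J 1)" if "card J = q"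
      using w that by (metis inner_axis inner_real_def mult.right_neutral)
    then show "w $ J = (\<chi> J. if card J = q then v \<bullet> wedge \<alpha> (axis J 1) else 0) $ J"
      using w by (auto simp: grade_def)
  qed
qed

lemma interior_mult_char:
  assumes "\<beta> \<in> grade (h - p)"
  shows "interior_mult h p v \<alpha> \<in> grade (h - p)"
    and "interior_mult h p v \<alpha> \<bullet> \<beta> = v \<bullet> wedge \<alpha> \<beta>"
  using theI'[OF interior_mult_unique_existence[of "h - p" v \<alpha>]] assms
  unfolding interior_mult_def by blast+


section \<open>Differential forms\<close>

text \<open>\<open>C^p\<close> regularity on an open set.\<close>

fun Ck_on :: "nat \<Rightarrow> ('a::real_normed_vector \<Rightarrow> 'b::real_normed_vector) \<Rightarrow> 'a set \<Rightarrow> bool" where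
  "Ck_on 0 f U \<longleftrightarrow> continuous_on U f"
| "Ck_on (Suc p) f U \<longleftrightarrow>
    (\<forall>x\<in>U. f differentiable (at x)) \<and> (\<forall>v. Ck_on p (\<lambda>x. frechet_derivative f (at x) v) U)"

definition partial_deriv :: "'n \<Rightarrow> ('n::finite euc \<Rightarrow> 'b::real_normed_vector) \<Rightarrow> 'n euc \<Rightarrow> 'b"
  where "partial_deriv i f x = frechet_derivative f (at x) (axis i 1)"

definition ext_deriv :: "'n::{finite,linorder} form \<Rightarrow> 'n form"
  where "ext_deriv \<omega> x = (\<Sum>i\<in>UNIV. wedge (axis {i} 1) (partial_deriv i \<omega> x))"

text \<open>
  Smooth \<open>h\<close>-forms with support in \<open>K\<close>, and smooth \<open>h\<close>-forms with compact support in \<open>\<Omega>\<close>. A form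
  on \<open>\<Omega>\<close> with compact support is identified with its extension by zero to the whole space.
\<close>

definition forms_supported :: "nat \<Rightarrow> 'n euc set \<Rightarrow> 'n::{finite,linorder} form set"
  where "forms_supported h K =
    {\<omega>. (\<forall>x. \<omega> x \<in> grade h) \<and> (\<forall>p. Ck_on p \<omega> UNIV) \<and> (\<forall>x. x \<notin> K \<longrightarrow> \<omega> x = 0)}"

definition test_forms :: "nat \<Rightarrow> 'n euc set \<Rightarrow> 'n::{finite,linorder} form set"
  where "test_forms h \<Omega> = (\<Union>K\<in>{K. compact K \<and> K \<subseteq> \<Omega>}. forms_supported h K)"


section \<open>Currents\<close>

text \<open>
  Test forms carry the usual inductive limit topology, so a linear functional is continuous if and
  only if its restriction to \<open>forms_supported h K\<close> is continuous for each compact \<open>K \<subseteq> \<Omega>\<close>, where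
  \<open>forms_supported h K\<close> has the topology of uniform convergence of all partial derivatives. Only
  the values of a current on \<open>test_forms h \<Omega>\<close> are relevant.
\<close>

definition current :: "nat \<Rightarrow> 'n euc set \<Rightarrow> ('n::{finite,linorder} form \<Rightarrow> real) \<Rightarrow> bool"
  where "current h \<Omega> T \<longleftrightarrow>
    (\<forall>\<omega>\<in>test_forms h \<Omega>. \<forall>\<eta>\<in>test_forms h \<Omega>. T (\<lambda>x. \<omega> x + \<eta> x) = T \<omega> + T \<eta>) \<and>
    (\<forall>c. \<forall>\<omega>\<in>test_forms h \<Omega>. T (\<lambda>x. c *\<^sub>R \<omega> x) = c * T \<omega>) \<and>
    (\<forall>K. compact K \<and> K \<subseteq> \<Omega> \<longrightarrow>
      (\<forall>\<omega>\<in>forms_supported h K. \<forall>\<epsilon>>0. \<exists>m. \<exists>\<delta>>0. \<forall>\<eta>\<in>forms_supported h K.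
        (\<forall>is x. length is \<le> m \<longrightarrow> norm (foldr partial_deriv is (\<lambda>y. \<eta> y - \<omega> y) x) < \<delta>)
        \<longrightarrow> \<bar>T \<eta> - T \<omega>\<bar> < \<epsilon>))"

definition boundary :: "('n::{finite,linorder} form \<Rightarrow> real) \<Rightarrow> 'n form \<Rightarrow> real"
  where "boundary T \<omega> = T (ext_deriv \<omega>)"

definition mass :: "nat \<Rightarrow> 'n euc set \<Rightarrow> ('n::{finite,linorder} form \<Rightarrow> real) \<Rightarrow> ereal"
  where "mass h \<Omega> T = (SUP \<omega>\<in>{\<omega>\<in>test_forms h \<Omega>. \<forall>x\<in>\<Omega>. norm (\<omega> x) \<le> 1}. ereal (T \<omega>))"

text \<open>Normal currents of positive dimension \<open>h\<close>.\<close>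

definition normal_current ::
    "nat \<Rightarrow> 'n euc set \<Rightarrow> ('n::{finite,linorder} form \<Rightarrow> real) \<Rightarrow> bool"
  where "normal_current h \<Omega> T \<longleftrightarrow>
    current h \<Omega> T \<and> mass h \<Omega> T < \<infinity> \<and> mass (h - 1) \<Omega> (boundary T) < \<infinity>"

text \<open>A Borel measure on \<open>\<Omega>\<close> lives on the subspace \<open>\<Omega>\<close>, so that its space is \<open>\<Omega>\<close> itself.\<close>

definition finite_borel_measure_on :: "'a::topological_space set \<Rightarrow> 'a measure \<Rightarrow> bool"
  where "finite_borel_measure_on \<Omega> \<mu> \<longleftrightarrow> finite_measure \<mu> \<and> sets \<mu> = sets (restrict_space borel \<Omega>)"

text \<open>\<open>T = \<tau>\<mu>\<close> as an \<open>h\<close>-current, with \<open>\<mu>\<close> finite and \<open>\<tau>\<close> Borel and integrable.\<close>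

definition represented_by :: "nat \<Rightarrow> 'n euc set \<Rightarrow> ('n::{finite,linorder} form \<Rightarrow> real) \<Rightarrow>
    'n form \<Rightarrow> 'n euc measure \<Rightarrow> bool"
  where "represented_by h \<Omega> T \<tau> \<mu> \<longleftrightarrow>
    finite_borel_measure_on \<Omega> \<mu> \<and>
    (\<forall>x\<in>\<Omega>. \<tau> x \<in> grade h) \<and> \<tau> \<in> borel_measurable (restrict_space borel \<Omega>) \<and> integrable \<mu> \<tau> \<and>
    (\<forall>\<omega>\<in>test_forms h \<Omega>. T \<omega> = (\<integral>x. \<tau> x \<bullet> \<omega> x \<partial>\<mu>))"

text \<open>The total variation \<open>|\<tau>\<mu>| = |\<tau>|\<mu>\<close>.\<close>

definition total_variation :: "('a \<Rightarrow> 'b::real_normed_vector) \<Rightarrow> 'a measure \<Rightarrow> 'a measure"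
  where "total_variation \<tau> \<mu> = density \<mu> (\<lambda>x. ennreal (norm (\<tau> x)))"


section \<open>Densities\<close>

text \<open>
  Measures are evaluated on \<open>ball x r \<inter> space \<mu>\<close>, as the ball need not be contained in \<open>\<Omega>\<close> when
  \<open>r\<close> is large. The definitions below are meant for finite measures, because \<open>measure\<close> is \<open>0\<close> on sets of infinite
  measure.
\<close>

definition lower_density :: "real \<Rightarrow> 'a::metric_space measure \<Rightarrow> 'a \<Rightarrow> ereal"
  where "lower_density s \<mu> x =
    Liminf (at_right 0) (\<lambda>r. ereal (measure \<mu> (ball x r \<inter> space \<mu>) / (2 * r) powr s))"

definition upper_density :: "real \<Rightarrow> 'a::metric_space measure \<Rightarrow> 'a \<Rightarrow> ereal"
  where "upper_density s \<mu> x =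
    Limsup (at_right 0) (\<lambda>r. ereal (measure \<mu> (ball x r \<inter> space \<mu>) / (2 * r) powr s))"

definition superdensity_set :: "'a::metric_space measure \<Rightarrow> real \<Rightarrow> 'a set \<Rightarrow> 'a set"
  where "superdensity_set \<nu> m E = {x \<in> space \<nu>.
    \<exists>g \<in> o[at_right 0](\<lambda>r. r powr m). \<forall>\<^sub>F r in at_right 0.
      measure \<nu> (ball x r \<inter> space \<nu> - E) = measure \<nu> (ball x r \<inter> space \<nu>) * g r}"


section \<open>Distributions of planes\<close>

definition distribution_on :: "nat \<Rightarrow> 'n euc set \<Rightarrow> ('n::finite euc \<Rightarrow> 'n euc set) \<Rightarrow> bool"
  where "distribution_on k \<Omega> D \<longleftrightarrow> (\<forall>x\<in>\<Omega>. subspace (D x) \<and> dim (D x) = k)"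

text \<open>
  \<open>\<omega> 0, \<dots>, \<omega> (n - k - 1)\<close> are \<open>C^p\<close> defining forms for \<open>D\<close> on the open set \<open>U\<close>. For \<open>k = n\<close> the family
  is empty and the intersection of the kernels is the whole space.
\<close>

definition defining_forms :: "nat \<Rightarrow> nat \<Rightarrow> ('n::finite euc \<Rightarrow> 'n euc set) \<Rightarrow> 'n euc set \<Rightarrow>
    (nat \<Rightarrow> 'n form) \<Rightarrow> bool"
  where "defining_forms p k D U \<omega> \<longleftrightarrow>
    open U \<and>
    (\<forall>j<CARD('n) - k. Ck_on p (\<omega> j) U \<and> (\<forall>y\<in>U. \<omega> j y \<in> grade 1)) \<and>
    (\<forall>y\<in>U. D y = (\<Inter>j<CARD('n) - k. {v. of_vec v \<bullet> \<omega> j y = 0}))"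

definition Cp_distribution ::
    "nat \<Rightarrow> nat \<Rightarrow> 'n euc set \<Rightarrow> ('n::finite euc \<Rightarrow> 'n euc set) \<Rightarrow> bool"
  where "Cp_distribution p k \<Omega> D \<longleftrightarrow>
    distribution_on k \<Omega> D \<and> (\<forall>x\<in>\<Omega>. \<exists>U \<omega>. x \<in> U \<and> U \<subseteq> \<Omega> \<and> defining_forms p k D U \<omega>)"

definition involutive_at ::
    "nat \<Rightarrow> 'n euc set \<Rightarrow> ('n::{finite,linorder} euc \<Rightarrow> 'n euc set) \<Rightarrow> 'n euc \<Rightarrow> bool"
  where "involutive_at k \<Omega> D x \<longleftrightarrow>
    (\<exists>U \<omega>. x \<in> U \<and> U \<subseteq> \<Omega> \<and> defining_forms 1 k D U \<omega> \<and>
      (\<forall>j<CARD('n) - k. \<forall>u\<in>D x. \<forall>v\<in>D x.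
        wedge (of_vec u) (of_vec v) \<bullet> ext_deriv (\<omega> j) x = 0))"

definition tangency_set :: "nat \<Rightarrow> 'n euc set \<Rightarrow> 'n::{finite,linorder} form \<Rightarrow>
    ('n euc \<Rightarrow> 'n euc set) \<Rightarrow> 'n euc set"
  where "tangency_set h \<Omega> \<tau> D = {x\<in>\<Omega>. mvec_span h (\<tau> x) \<subseteq> D x}"

end

theory Submission
  imports Defs
begin

text \<open>
  Write \<open>e\<^sub>a\<close> for the exterior multiplication by a vector \<open>a\<close> from the left and \<open>i\<^sub>a\<close> for its adjoint, the
  contraction. Locally \<open>D\<close> is the common kernel of one-forms \<open>\<omega>\<^sub>j\<close>, and \<open>\<tau>(y)\<close> is tangent to \<open>D(y)\<close> if and
  only if it is annihilated by the contractions with all the \<open>\<omega>\<^sub>j(y)\<close>, that is, orthogonal to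
  \<open>\<omega>\<^sub>j(y) \<and> \<beta>\<close> for all \<open>\<beta>\<close>.

  Linear algebra reduces both claims to orthogonality relations at the single point \<open>x\<close>. A nonzero
  \<open>k\<close>-vector that is tangent to a \<open>k\<close>-dimensional space \<open>S\<close> is simple with span \<open>S\<close>
  (\<open>simple_if_carried_by\<close>, \<open>mvec_span_eq_if_subset\<close>), because a multivector of degree \<open>h\<close> tangent to a
  space of dimension less than \<open>h\<close> vanishes. So the first claim says that \<open>\<tau>(x)\<close> is orthogonal to all
  \<open>\<omega>\<^sub>j(x) \<and> \<beta>\<close>. The second one follows if \<open>\<tau>(x)\<close> is orthogonal to all \<open>d\<omega>\<^sub>j(x) \<and> \<beta>\<close>: for \<open>u, v \<in> D(x)\<close> and
  \<open>\<beta> = i\<^sub>v i\<^sub>u \<tau>(x)\<close> this inner product is \<open>|\<tau>(x)|\<^sup>2\<close> times \<open>\<langle>u \<and> v; d\<omega>\<^sub>j(x)\<rangle>\<close>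
  (\<open>inner_wedge_wedge_contract_contract\<close>). For \<open>k = 1\<close> there is no such \<open>\<beta>\<close>, but then \<open>u \<and> v = 0\<close>.

  Each relation has the form \<open>\<tau>(x) \<bullet> f(x) = 0\<close> with a continuous \<open>f\<close>, and \<open>tangent_average_eq_0\<close> obtains it
  by blow-up: if \<open>\<phi>\<^sub>r\<close> is a bump function on \<open>B\<^sub>r(x)\<close>, the integral of \<open>\<phi>\<^sub>r \<tau> \<bullet> f\<close> is the integral of
  \<open>\<phi>\<^sub>r |\<tau>|\<close>, which is comparable to \<open>r\<^sup>s\<close> by the density assumption, times \<open>\<tau>(x) \<bullet> f(x) / |\<tau>(x)|\<close>, up to
  \<open>o(r\<^sup>s)\<close>. It remains to see that the integral of \<open>\<phi>\<^sub>r \<tau> \<bullet> f\<close> is \<open>o(r\<^sup>s)\<close>. For \<open>f = \<omega>\<^sub>j \<and> \<beta>\<close> the integrand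
  vanishes on the tangency set of \<open>\<tau>\<close>, whose complement has small measure. For \<open>f = d\<omega>\<^sub>j \<and> \<beta>\<close> one tests
  \<open>\<partial>T\<close> with \<open>\<phi>\<^sub>r \<omega>\<^sub>j \<and> \<beta>\<close> (\<open>localized_stokes\<close>). The result is \<open>o(r\<^sup>s)\<close>, since \<open>\<tau>'\<close> is tangent up to a set of
  that measure, and it equals the integral wanted plus that of \<open>\<tau> \<bullet> (d\<phi>\<^sub>r \<and> \<omega>\<^sub>j \<and> \<beta>)\<close>. The latter integrand
  again vanishes on the tangency set of \<open>\<tau>\<close>, and the factor \<open>1/r\<close> lost in \<open>d\<phi>\<^sub>r\<close> is what superdensity of
  order one compensates.

  The forms \<open>\<phi>\<^sub>r \<omega>\<^sub>j \<and> \<beta>\<close> are only \<open>C\<^sup>1\<close>. They cannot be replaced by forms with the Taylor polynomials of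
  \<open>\<omega>\<^sub>j\<close> at \<open>x\<close>: those fail to annihilate \<open>\<tau>'\<close> on its tangency set, where nothing bounds the growth of
  \<open>|\<tau>'\<mu>'|\<close>. Instead \<open>stokes_C1\<close> extends the relation between \<open>T\<close> and \<open>\<partial>T\<close> to \<open>C\<^sup>1\<close> forms by mollification.
\<close>

section \<open>Wedge products with a vector and their adjoints\<close>

text \<open>
  The sign \<open>shuffle_sign {i} (K - {i})\<close> of moving \<open>i\<close> to its place among the elements of \<open>K\<close>, written so
  that it is the same for \<open>K\<close>, \<open>K - {i}\<close> and \<open>insert i K\<close>.
\<close>

definition pos_sign :: "'n::{finite,linorder} \<Rightarrow> 'n set \<Rightarrow> real"
  where "pos_sign i K = (- 1) ^ card {j \<in> K. j < i}"

text \<open>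
  The interior product with a one-covector, in coordinates. It is the adjoint of left exterior
  multiplication (\<open>contract_adjoint\<close>). Unlike \<open>interior_mult\<close> it does not depend on a degree.
\<close>

definition contract :: "'n euc \<Rightarrow> 'n::{finite,linorder} mvec \<Rightarrow> 'n mvec"
  where "contract a v = (\<chi> J. \<Sum>i\<in>- J. pos_sign i J * a $ i * v $ insert i J)"

lemma bounded_bilinear_wedge: "bounded_bilinear (wedge :: 'n::{finite,linorder} mvec \<Rightarrow> _)"
proof -
  have "linear (\<lambda>\<alpha>::'n mvec. wedge \<alpha> \<beta>)" for \<beta>
    by (rule linearI)
       (simp_all add: wedge_def vec_eq_iff algebra_simps sum.distrib sum_distrib_left)
  then show ?thesis
    by (simp add: bilinear_conv_bounded_bilinear [symmetric] bilinear_def wedge_linear_right)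
qed

interpretation wedge: bounded_bilinear "wedge :: 'n::{finite,linorder} mvec \<Rightarrow> _"
  by (rule bounded_bilinear_wedge)

lemma bounded_bilinear_contract:
  "bounded_bilinear (contract :: 'n euc \<Rightarrow> 'n::{finite,linorder} mvec \<Rightarrow> _)"
proof -
  have "linear (\<lambda>a::'n euc. contract a v)" for v
    by (rule linearI)
       (simp_all add: contract_def vec_eq_iff algebra_simps sum.distrib sum_distrib_left)
  moreover have "linear (contract a)" for a :: "'n euc"
    by (rule linearI)
       (simp_all add: contract_def vec_eq_iff algebra_simps sum.distrib sum_distrib_left)
  ultimately show ?thesis
    by (simp add: bilinear_conv_bounded_bilinear [symmetric] bilinear_def)
qed

interpretation contract: bounded_bilinear "contract :: 'n euc \<Rightarrow> 'n::{finite,linorder} mvec \<Rightarrow> _"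
  by (rule bounded_bilinear_contract)

lemma of_vec_nth: "of_vec a $ K = (\<Sum>i\<in>UNIV. if K = {i} then a $ i else 0)"
  unfolding of_vec_def sum_component by (rule sum.cong) (auto simp: axis_def)

lemma of_vec_singleton [simp]: "of_vec a $ {i} = a $ i"
  by (simp add: of_vec_nth)

lemma of_vec_not_singleton: "card K \<noteq> 1 \<Longrightarrow> of_vec a $ K = 0"
  by (auto simp: of_vec_nth intro!: sum.neutral)

lemma linear_of_vec: "linear (of_vec :: 'n::finite euc \<Rightarrow> _)"
  by (rule linearI) (auto simp: of_vec_def algebra_simps sum.distrib scaleR_sum_right)

lemma of_vec_axis [simp]: "of_vec (axis i 1) = axis {i} 1"
proof -
  have "of_vec (axis i 1) = (\<Sum>j\<in>UNIV. if j = i then axis {i} 1 else 0)"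
    unfolding of_vec_def by (rule sum.cong) (auto simp: axis_def)
  then show ?thesis by simp
qed

lemma of_vec_to_vec: "w \<in> grade 1 \<Longrightarrow> of_vec (to_vec w) = w"
proof -
  assume w: "w \<in> grade 1"
  have "of_vec (to_vec w) $ K = w $ K" for K
  proof (cases "card K = 1")
    case True
    then obtain i where "K = {i}" by (auto simp: card_1_singleton_iff)
    then show ?thesis by (simp add: to_vec_def)
  qed (use w in \<open>simp add: of_vec_not_singleton grade_def\<close>)
  then show ?thesis by (simp add: vec_eq_iff)
qed

lemma of_vec_inner: "of_vec a \<bullet> w = a \<bullet> to_vec w"
proof -
  have "of_vec a \<bullet> w = (\<Sum>i\<in>UNIV. a $ i * w $ {i})"
    by (simp add: of_vec_def inner_sum_left inner_axis')
  then show ?thesis by (simp add: to_vec_def inner_vec_def)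
qed

lemma inner_of_vec_of_vec: "of_vec a \<bullet> of_vec b = a \<bullet> b"
proof -
  have "to_vec (of_vec b) = b" by (simp add: to_vec_def)
  then show ?thesis by (simp only: of_vec_inner)
qed

lemma norm_of_vec: "norm (of_vec a) = norm a"
  by (simp add: norm_eq_sqrt_inner inner_of_vec_of_vec)

lemma wedge_of_vec_nth:
  fixes a :: "'n::{finite,linorder} euc"
  shows
  "wedge (of_vec a) v $ K = (\<Sum>i\<in>K. pos_sign i K * a $ i * v $ (K - {i}))"
proof -
  have sgn: "shuffle_sign {i} (K - {i}) = pos_sign i K" for i :: 'n
  proof -
    have "{(i', j). i' \<in> {i} \<and> j \<in> K - {i} \<and> j < i'} = Pair i ` {j \<in> K. j < i}"
      by auto
    then show ?thesis
      by (simp add: shuffle_sign_def pos_sign_def card_image inj_on_def)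
  qed
  have "wedge (of_vec a) v $ K
      = (\<Sum>I\<in>Pow K. shuffle_sign I (K - I) * of_vec a $ I * v $ (K - I))"
    by (simp add: wedge_def)
  also have "\<dots> = (\<Sum>I\<in>(\<lambda>i. {i}) ` K. shuffle_sign I (K - I) * of_vec a $ I * v $ (K - I))"
    by (rule sum.mono_neutral_right)
       (auto simp: of_vec_nth intro!: sum.neutral)
  also have "\<dots> = (\<Sum>i\<in>K. pos_sign i K * a $ i * v $ (K - {i}))"
    by (subst sum.reindex) (auto simp: sgn inj_on_def)
  finally show ?thesis .
qed

lemma wedge_axis_nth:
  "wedge (axis {i} 1) v $ K = (if i \<in> K then pos_sign i K * v $ (K - {i}) else 0)"
proof -
  have "wedge (axis {i} 1) v $ K
      = (\<Sum>i'\<in>K. if i' = i then pos_sign i K * v $ (K - {i}) else 0)"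
    unfolding of_vec_axis [symmetric] wedge_of_vec_nth by (rule sum.cong) (auto simp: axis_def)
  then show ?thesis by simp
qed

lemma contract_axis_nth:
  "contract (axis i 1) v $ J = (if i \<in> J then 0 else pos_sign i J * v $ insert i J)"
proof -
  have "contract (axis i 1) v $ J
      = (\<Sum>i'\<in>- J. if i' = i then pos_sign i J * v $ insert i J else 0)"
    unfolding contract_def vec_lambda_beta by (rule sum.cong) (auto simp: axis_def)
  then show ?thesis by simp
qed

lemma pos_sign_square [simp]: "pos_sign i K * pos_sign i K = 1" 
  by (simp add: pos_sign_def power_add [symmetric] mult_2 [symmetric])

lemma pos_sign_square' [simp]: "pos_sign i K * (pos_sign i K * c) = c" 
  by (simp add: mult.assoc [symmetric])

lemma pos_sign_empty [simp]: "pos_sign i {} = 1"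
  by (simp add: pos_sign_def)

lemma pos_sign_insert:
  "j \<notin> K \<Longrightarrow> pos_sign i (insert j K) = (if j < i then - pos_sign i K else pos_sign i K)"
proof -
  assume "j \<notin> K"
  moreover have "{l \<in> insert j K. l < i} = (if j < i then insert j {l \<in> K. l < i} else {l \<in> K. l < i})"
    by auto
  ultimately show ?thesis by (simp add: pos_sign_def)
qed

lemma pos_sign_insert_self [simp]: "pos_sign i (insert i K) = pos_sign i K"
  unfolding pos_sign_def by (rule arg_cong [where f = "\<lambda>A. (- 1) ^ card A"]) auto

lemma pos_sign_remove_self [simp]: "pos_sign i (K - {i}) = pos_sign i K"
  unfolding pos_sign_def by (rule arg_cong [where f = "\<lambda>A. (- 1) ^ card A"]) auto

lemma pos_sign_remove:
  assumes "j \<in> K"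
  shows "pos_sign i (K - {j}) = (if j < i then - pos_sign i K else pos_sign i K)"
  using pos_sign_insert [of j "K - {j}" i] assms by (auto simp: insert_absorb split: if_splits)

text \<open>
  Exterior multiplication and contraction by basis vectors permute the basis up to sign, so their
  commutation relations come down to the following fact: removing or inserting \<open>j\<close> flips the sign of \<open>i\<close>
  exactly if \<open>j < i\<close>, and for \<open>i \<noteq> j\<close> exactly one of \<open>i < j\<close> and \<open>j < i\<close> holds.
\<close>

lemma wedge_axis_axis:
  "wedge (axis {i} 1) (wedge (axis {j} 1) v) + wedge (axis {j} 1) (wedge (axis {i} 1) v) = 0"
  (is "?s = 0")
proof -
  have "?s $ K = 0" for K
  proof -
    have eq: "K - {i} - {j} = K - {j} - {i}" by auto
    have "i = j \<or> i < j \<or> j < i" by auto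
    then show ?thesis
      by (elim disjE) (auto simp add: wedge_axis_nth pos_sign_remove eq)
  qed
  then show ?thesis by (simp add: vec_eq_iff)
qed

lemma contract_wedge_axis:
  "contract (axis i 1) (wedge (axis {j} 1) v) + wedge (axis {j} 1) (contract (axis i 1) v)
    = (if i = j then v else 0)"
proof (cases "i = j")
  case True
  then show ?thesis
    by (auto simp: vec_eq_iff wedge_axis_nth contract_axis_nth insert_absorb)
next
  case False
  then have "i < j \<or> j < i" by auto
  then show ?thesis
    by (elim disjE)
       (auto simp: vec_eq_iff wedge_axis_nth contract_axis_nth pos_sign_remove pos_sign_insert
         insert_Diff_if)
qed

lemma vec_axis_expansion: "(a :: 'n::finite euc) = (\<Sum>i\<in>UNIV. a $ i *\<^sub>R axis i 1)"
  using basis_expansion [of a] by (simp add: scalar_mult_eq_scaleR)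

lemma wedge_of_vec_expansion:
  "wedge (of_vec a) v = (\<Sum>i\<in>UNIV. a $ i *\<^sub>R wedge (axis {i} 1) v)"
  by (simp add: of_vec_def wedge.sum_left wedge.scaleR_left)

lemma contract_expansion:
  "contract a v = (\<Sum>i\<in>UNIV. a $ i *\<^sub>R contract (axis i 1) v)"
  by (subst vec_axis_expansion) (simp only: contract.sum_left contract.scaleR_left)

lemma wedge_anticommute:
  "wedge (of_vec a) (wedge (of_vec b) v) = - wedge (of_vec b) (wedge (of_vec a) v)"
proof -
  have "wedge (of_vec a) (wedge (of_vec b) v) + wedge (of_vec b) (wedge (of_vec a) v)
      = (\<Sum>i\<in>UNIV. \<Sum>j\<in>UNIV. (a $ i * b $ j) *\<^sub>R
          (wedge (axis {i} 1) (wedge (axis {j} 1) v) + wedge (axis {j} 1) (wedge (axis {i} 1) v)))"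
    unfolding wedge_of_vec_expansion [of b] wedge_of_vec_expansion [of a]
    by (simp add: wedge.sum_right wedge.scaleR_right scaleR_sum_right algebra_simps sum.distrib)
       (rule sum.swap)
  then show ?thesis
    by (simp add: wedge_axis_axis eq_neg_iff_add_eq_0)
qed

text \<open>
  The Clifford relation. With the two anticommutation rules it replaces all further computations with
  signs.
\<close>

lemma contract_wedge:
  "contract a (wedge (of_vec b) v) = (a \<bullet> b) *\<^sub>R v - wedge (of_vec b) (contract a v)"
proof -
  have "contract a (wedge (of_vec b) v) + wedge (of_vec b) (contract a v)
      = (\<Sum>i\<in>UNIV. \<Sum>j\<in>UNIV. (a $ i * b $ j) *\<^sub>R
          (contract (axis i 1) (wedge (axis {j} 1) v) + wedge (axis {j} 1) (contract (axis i 1) v)))"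
    unfolding wedge_of_vec_expansion [of b] contract_expansion [of a]
    by (simp add: wedge.sum_right wedge.scaleR_right contract.sum_right contract.scaleR_right 
       scaleR_sum_right algebra_simps sum.distrib)
       (rule sum.swap)
  also have "\<dots> = (\<Sum>i\<in>UNIV. (a $ i * b $ i) *\<^sub>R v)"
    by (simp add: contract_wedge_axis if_distrib [of "\<lambda>x. _ *\<^sub>R x"] cong: if_cong)
  also have "\<dots> = (a \<bullet> b) *\<^sub>R v"
    by (simp add: inner_vec_def scaleR_sum_left)
  finally show ?thesis by (simp add: algebra_simps)
qed

lemma contract_adjoint: "contract a v \<bullet> w = v \<bullet> wedge (of_vec a) w"
proof -
  have "contract (axis i 1) v \<bullet> w = v \<bullet> wedge (axis {i} 1) w" for i
  proof -
    have "contract (axis i 1) v \<bullet> w = (\<Sum>J\<in>{J. i \<notin> J}. pos_sign i J * v $ insert i J * w $ J)"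
      unfolding inner_vec_def by (rule sum.mono_neutral_cong_right) (auto simp: contract_axis_nth)
    also have "\<dots> = (\<Sum>K\<in>{K. i \<in> K}. v $ K * (pos_sign i K * w $ (K - {i})))"
      by (rule sum.reindex_bij_witness [where j = "insert i" and i = "\<lambda>K. K - {i}"])
         (auto simp: insert_absorb)
    also have "\<dots> = v \<bullet> wedge (axis {i} 1) w"
      unfolding inner_vec_def by (rule sum.mono_neutral_cong_left) (auto simp: wedge_axis_nth)
    finally show ?thesis .
  qed
  then show ?thesis
    by (simp add: contract_expansion [of a] wedge_of_vec_expansion [of a] inner_sum_left inner_sum_right)
qed

lemma contract_anticommute: "contract a (contract b v) = - contract b (contract a v)"
proof -
  have "contract a (contract b v) \<bullet> w = - contract b (contract a v) \<bullet> w" for w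
    by (simp add: contract_adjoint wedge_anticommute [of a])
  then show ?thesis using vector_eq_rdot by blast
qed

lemma contract_self [simp]: "contract a (contract a v) = 0"
proof -
  have "2 *\<^sub>R contract a (contract a v) = 0"
    using contract_anticommute [of a a v] by (simp add: scaleR_2 eq_neg_iff_add_eq_0)
  then show ?thesis by (simp only: scaleR_eq_0_iff) simp
qed

lemma wedge_in_grade: "v \<in> grade h \<Longrightarrow> wedge (of_vec a) v \<in> grade (Suc h)"
proof -
  assume v: "v \<in> grade h"
  have "v $ (I - {i}) = 0" if "card I \<noteq> Suc h" "i \<in> I" for i I
  proof -
    have "card (I - {i}) \<noteq> h"
      using that by (metis card_Suc_Diff1 finite)
    then show ?thesis using v by (simp add: grade_def)
  qed
  then show ?thesis
    by (auto simp: grade_def wedge_of_vec_nth intro!: sum.neutral)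
qed

lemma contract_in_grade: "v \<in> grade (Suc h) \<Longrightarrow> contract a v \<in> grade h"
  by (auto simp: grade_def contract_def intro!: sum.neutral)

lemma subspace_grade: "subspace (grade h)"
  by (auto simp: grade_def subspace_def)

lemma axis_in_grade: "axis I c \<in> grade (card I)"
  by (auto simp: grade_def axis_def)

lemma contract_one [simp]: "contract a (axis {} 1) = 0"
  by (auto simp: vec_eq_iff contract_def axis_def intro!: sum.neutral)

lemma wedge_one: "wedge (of_vec a) (axis {} 1) = of_vec a"
proof -
  have "wedge (of_vec a) (axis {} 1) $ K = of_vec a $ K" for K
  proof (cases "card K = 1")
    case True
    then obtain i where "K = {i}" by (auto simp: card_1_singleton_iff)
    then show ?thesis by (simp add: wedge_of_vec_nth axis_def)
  next
    case False
    then have "K - {i} \<noteq> {}" if "i \<in> K" for i using that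
      by (metis card.empty card_Suc_Diff1 finite One_nat_def)
    then show ?thesis using False
      by (auto simp: of_vec_not_singleton wedge_of_vec_nth axis_def intro!: sum.neutral)
  qed
  then show ?thesis by (simp add: vec_eq_iff)
qed

text \<open>
  Moving a vector past a multivector of degree \<open>h\<close> costs the sign \<open>(-1)^h\<close>. It is needed because the
  interior product that defines spans places the free covector on the left.
\<close>

lemma wedge_of_vec_right:
  assumes "v \<in> grade h"
  shows "wedge v (of_vec a) = (- 1) ^ h *\<^sub>R wedge (of_vec a) v"
proof -
  have "wedge v (of_vec a) $ K = (- 1) ^ h * wedge (of_vec a) v $ K" for K
  proof -
    have sgn: "shuffle_sign (K - {i}) {i} * v $ (K - {i}) = (- 1) ^ h * pos_sign i K * v $ (K - {i})"
      if i: "i \<in> K" for i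
    proof (cases "card (K - {i}) = h")
      case True
      have eq: "{(i', j). i' \<in> K - {i} \<and> j \<in> {i} \<and> j < i'} = (\<lambda>j. (j, i)) ` {j \<in> K. i < j}"
        by auto
      have "K - {i} = {j \<in> K. i < j} \<union> {j \<in> K. j < i}"
        by auto
      then have "card (K - {i}) = card ({j \<in> K. i < j} \<union> {j \<in> K. j < i})"
        by (rule arg_cong)
      also have "\<dots> = card {j \<in> K. i < j} + card {j \<in> K. j < i}"
        by (rule card_Un_disjoint) auto
      finally have h: "h = card {j \<in> K. i < j} + card {j \<in> K. j < i}"
        by (simp only: True)
      have "shuffle_sign (K - {i}) {i} = (- 1) ^ card {j \<in> K. i < j}"
        unfolding shuffle_sign_def eq by (simp add: card_image inj_on_def)
      also have "\<dots> = (- 1) ^ h * pos_sign i K"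
        unfolding h by (simp add: pos_sign_def power_add)
      finally show ?thesis by simp
    qed (use assms in \<open>simp add: grade_def\<close>)
    have "wedge v (of_vec a) $ K
        = (\<Sum>I\<in>Pow K. shuffle_sign I (K - I) * v $ I * of_vec a $ (K - I))"
      by (simp add: wedge_def)
    also have "\<dots> = (\<Sum>I\<in>(\<lambda>i. K - {i}) ` K. shuffle_sign I (K - I) * v $ I * of_vec a $ (K - I))"
    proof (rule sum.mono_neutral_right)
      show "\<forall>I\<in>Pow K - (\<lambda>i. K - {i}) ` K. shuffle_sign I (K - I) * v $ I * of_vec a $ (K - I) = 0"
      proof
        fix I assume I: "I \<in> Pow K - (\<lambda>i. K - {i}) ` K"
        have "K - I \<noteq> {i}" for i
        proof
          assume "K - I = {i}"
          then have "i \<in> K" by blast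
          moreover have "I = K - {i}" using \<open>K - I = {i}\<close> I by (metis DiffD1 Pow_iff double_diff order_refl)
          ultimately show False using I by simp
        qed
        then show "shuffle_sign I (K - I) * v $ I * of_vec a $ (K - I) = 0"
          by (simp add: of_vec_nth)
      qed
    qed auto
    also have "\<dots> = (\<Sum>i\<in>K. shuffle_sign (K - {i}) {i} * v $ (K - {i}) * a $ i)"
    proof (subst sum.reindex)
      show "inj_on (\<lambda>i. K - {i}) K"
        by (rule inj_onI) (metis Diff_iff insertI1 singletonD)
      have "K - (K - {i}) = {i}" if "i \<in> K" for i using that by blast
      then show "(\<Sum>i\<in>K. ((\<lambda>I. shuffle_sign I (K - I) * v $ I * of_vec a $ (K - I)) \<circ> (\<lambda>i. K - {i})) i)
          = (\<Sum>i\<in>K. shuffle_sign (K - {i}) {i} * v $ (K - {i}) * a $ i)"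
        by (intro sum.cong) simp_all
    qed
    also have "\<dots> = (- 1) ^ h * (\<Sum>i\<in>K. pos_sign i K * a $ i * v $ (K - {i}))"
      unfolding sum_distrib_left by (rule sum.cong) (use sgn in \<open>simp_all add: algebra_simps\<close>)
    finally show ?thesis by (simp add: wedge_of_vec_nth)
  qed
  then show ?thesis by (simp add: vec_eq_iff)
qed

section \<open>Multivectors carried by a subspace\<close>

text \<open>
  Tangency of \<open>v\<close> to \<open>S\<close>, expressed by the contractions that annihilate \<open>v\<close>; for a subspace \<open>S\<close> it says
  that \<open>v\<close> lies in the exterior algebra of \<open>S\<close>. This form passes easily to \<open>wedge\<close> and \<open>contract\<close>.
\<close>

definition carried_by :: "'n euc set \<Rightarrow> 'n::{finite,linorder} mvec \<Rightarrow> bool"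
  where "carried_by S v \<longleftrightarrow> (\<forall>a. (\<forall>s\<in>S. a \<bullet> s = 0) \<longrightarrow> contract a v = 0)"

lemma grade_eq_0_if_contract_eq_0:
  assumes "v \<in> grade (Suc h)" and "\<And>a. contract a v = 0"
  shows "v = 0"
proof -
  have "v $ I = 0" for I
  proof (cases "card I = Suc h")
    case True
    then obtain i where i: "i \<in> I" by fastforce
    have "contract (axis i 1) v $ (I - {i}) = 0"
      using assms(2) by simp
    then show ?thesis
      using i by (auto simp: contract_axis_nth insert_absorb pos_sign_def)
  qed (use assms(1) in \<open>simp add: grade_def\<close>)
  then show ?thesis by (simp add: vec_eq_iff)
qed

lemma subspace_orthogonal_slice: "subspace S \<Longrightarrow> subspace {s \<in> S. s \<bullet> u = 0}"
  by (auto simp: subspace_def inner_add_left)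

lemma orthogonal_slice_decomposition:
  fixes u :: "'n::finite euc"
  assumes "subspace S" and "u \<in> S" and "u \<noteq> 0" and "s \<in> S"
  shows "s - (s \<bullet> u / (u \<bullet> u)) *\<^sub>R u \<in> {s \<in> S. s \<bullet> u = 0}"
  using assms by (auto simp: inner_diff_left intro: subspace_diff subspace_scale)

lemma dim_orthogonal_slice:
  fixes u :: "'n::finite euc"
  assumes S: "subspace S" and u: "u \<in> S" "u \<noteq> 0"
  shows "dim S = Suc (dim {s \<in> S. s \<bullet> u = 0})"
proof -
  let ?S = "{s \<in> S. s \<bullet> u = 0}"
  have span: "span ?S = ?S"
    using subspace_orthogonal_slice [OF S] by (rule span_eq_iff [THEN iffD2])
  have "span (insert u ?S) = S"
  proof
    show "span (insert u ?S) \<subseteq> S"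
      using S u by (intro span_minimal) auto
    show "S \<subseteq> span (insert u ?S)"
    proof
      fix s assume "s \<in> S"
      then have "s - (s \<bullet> u / (u \<bullet> u)) *\<^sub>R u \<in> span ?S"
        unfolding span by (rule orthogonal_slice_decomposition [OF S u])
      then show "s \<in> span (insert u ?S)"
        unfolding span_insert by blast
    qed
  qed
  then have "dim S = dim (insert u ?S)"
    by (metis dim_span)
  moreover have "u \<notin> span ?S"
    unfolding span using u by simp
  ultimately show ?thesis by (simp add: dim_insert)
qed

text \<open>
  A space \<open>S\<close> splits into the line of \<open>u\<close> and the slice orthogonal to \<open>u\<close>. Hence a vector orthogonal to
  the slice is orthogonal to \<open>S\<close> up to its component along \<open>u\<close>. Inductions on the dimension of \<open>S\<close> pass to
  this slice.
\<close>

lemma orthogonal_if_orthogonal_slice: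
  fixes u :: "'n::finite euc"
  assumes "subspace S" and "u \<in> S" and "u \<noteq> 0"
    and "\<forall>s\<in>{s \<in> S. s \<bullet> u = 0}. a \<bullet> s = 0"
  shows "\<forall>s\<in>S. (a - (a \<bullet> u / (u \<bullet> u)) *\<^sub>R u) \<bullet> s = 0"
proof
  fix s assume "s \<in> S"
  then have "a \<bullet> (s - (s \<bullet> u / (u \<bullet> u)) *\<^sub>R u) = 0"
    using assms orthogonal_slice_decomposition by blast
  then show "(a - (a \<bullet> u / (u \<bullet> u)) *\<^sub>R u) \<bullet> s = 0"
    by (simp add: inner_diff_left inner_diff_right inner_commute mult.commute)
qed

text \<open>
  Contractions anticommute, so \<open>contract u v\<close> inherits the annihilators of \<open>v\<close>, and \<open>u\<close> is a new one.
\<close>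

lemma carried_by_contract:
  assumes S: "subspace S" and u: "u \<in> S" "u \<noteq> 0" and v: "carried_by S v"
  shows "carried_by {s \<in> S. s \<bullet> u = 0} (contract u v)"
  unfolding carried_by_def
proof (intro allI impI)
  fix a assume a: "\<forall>s\<in>{s \<in> S. s \<bullet> u = 0}. a \<bullet> s = 0"
  define b where "b = a - (a \<bullet> u / (u \<bullet> u)) *\<^sub>R u"
  have "contract b v = 0"
    using v orthogonal_if_orthogonal_slice [OF S u a] by (simp add: carried_by_def b_def)
  then have "contract b (contract u v) = 0"
    using contract_anticommute [of b u v] by (simp add: contract.zero_right)
  then show "contract a (contract u v) = 0"
    by (simp add: b_def contract.diff_left contract.scaleR_left)
qed

lemma carried_by_wedge:
  assumes "u \<in> S" and "carried_by S v"
  shows "carried_by S (wedge (of_vec u) v)"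
  using assms by (simp add: carried_by_def contract_wedge wedge.zero_right)

lemma carried_by_slice:
  assumes S: "subspace S" and u: "u \<in> S" "u \<noteq> 0" and v: "carried_by S v" "contract u v = 0"
  shows "carried_by {s \<in> S. s \<bullet> u = 0} v"
  unfolding carried_by_def
proof (intro allI impI)
  fix a assume a: "\<forall>s\<in>{s \<in> S. s \<bullet> u = 0}. a \<bullet> s = 0"
  define b where "b = a - (a \<bullet> u / (u \<bullet> u)) *\<^sub>R u"
  have "contract b v = 0"
    using v orthogonal_if_orthogonal_slice [OF S u a] by (simp add: carried_by_def b_def)
  then show "contract a v = 0"
    using v by (simp add: b_def contract.diff_left contract.scaleR_left)
qed

text \<open>
  By induction on the dimension, \<open>contract u v = 0\<close> for \<open>u\<close> in \<open>S\<close>, as it has one degree less and is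
  carried by the slice orthogonal to \<open>u\<close>. But then \<open>v\<close> itself is carried by that slice.
\<close>

lemma carried_by_low_dim_eq_0:
  assumes "subspace S" and "v \<in> grade h" and "carried_by S v" and "dim S < h"
  shows "v = 0"
  using assms
proof (induction "dim S" arbitrary: S v h)
  case 0
  then have S: "S = {0}"
    by (metis dim_eq_0 subspace_0 subset_singletonD empty_iff)
  obtain h' where "h = Suc h'" using 0 by (cases h) auto
  then show ?case
    using 0 S grade_eq_0_if_contract_eq_0 [of v h'] by (simp add: carried_by_def)
next
  case (Suc d)
  obtain h' where h: "h = Suc h'" using Suc by (cases h) auto
  obtain u where u: "u \<in> S" "u \<noteq> 0"
    using Suc.hyps(2) by (metis dim_eq_0 nat.distinct(1) singletonI subsetI)
  let ?S = "{s \<in> S. s \<bullet> u = 0}"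
  have d: "d = dim ?S"
    using dim_orthogonal_slice [OF Suc.prems(1) u] Suc.hyps(2) by simp
  have S: "subspace ?S"
    using Suc.prems(1) by (rule subspace_orthogonal_slice)
  have "contract u v = 0"
  proof (rule Suc.hyps(1) [OF d S])
    show "contract u v \<in> grade h'"
      using Suc.prems(2) h by (simp add: contract_in_grade)
    show "carried_by ?S (contract u v)"
      by (rule carried_by_contract) (use Suc.prems u in auto)
    show "dim ?S < h'"
      using d h Suc.prems(4) Suc.hyps(2) by simp
  qed
  then have "carried_by ?S v"
    using Suc.prems u by (intro carried_by_slice)
  then show ?case
    using Suc.hyps(1) [OF d S Suc.prems(2)] d Suc.hyps(2) Suc.prems(4) by simp
qed

text \<open>
  The product is still carried by \<open>S\<close>, and its degree exceeds the dimension of \<open>S\<close>.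
\<close>

lemma wedge_eq_0_if_carried_by:
  assumes "subspace S" and "v \<in> grade (dim S)" and "carried_by S v" and "u \<in> S"
  shows "wedge (of_vec u) v = 0"
  by (rule carried_by_low_dim_eq_0 [OF assms(1) wedge_in_grade [OF assms(2)]])
     (auto intro: carried_by_wedge assms)

text \<open>
  Since \<open>wedge (of_vec u) v = 0\<close> for \<open>u\<close> in \<open>S\<close>, the Clifford relation gives
  \<open>(u \<bullet> u) *\<^sub>R v = wedge (of_vec u) (contract u v)\<close>, which splits off one factor. The scalar \<open>c\<close> is there for
  degree \<open>0\<close>, where no vector can absorb it.
\<close>

lemma decomposable_if_carried_by:
  assumes "subspace S" and "v \<in> grade (dim S)" and "carried_by S v"
  shows "\<exists>us c. length us = dim S \<and>
    v = c *\<^sub>R foldr (\<lambda>u w. wedge (of_vec u) w) us (axis {} 1)"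
  using assms
proof (induction "dim S" arbitrary: S v)
  case 0
  have "v $ I = ((v $ {}) *\<^sub>R axis {} 1) $ I" for I
  proof -
    have "v \<in> grade 0" using 0 by metis
    then show ?thesis by (cases "I = {}") (auto simp: grade_def axis_def)
  qed
  then have "v = (v $ {}) *\<^sub>R axis {} 1"
    unfolding vec_eq_iff by blast
  then show ?case using 0 by (intro exI [of _ "[]"]) auto
next
  case (Suc d)
  obtain u where u: "u \<in> S" "u \<noteq> 0"
    using Suc.hyps(2) by (metis dim_eq_0 nat.distinct(1) singletonI subsetI)
  let ?S = "{s \<in> S. s \<bullet> u = 0}"
  have d: "d = dim ?S"
    using dim_orthogonal_slice [OF Suc.prems(1) u] Suc.hyps(2) by simp
  have "contract u v \<in> grade (dim ?S)"
    using Suc.prems(2) Suc.hyps(2) d by (metis contract_in_grade)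
  then obtain us c where us: "length us = dim ?S"
    "contract u v = c *\<^sub>R foldr (\<lambda>u w. wedge (of_vec u) w) us (axis {} 1)"
    using Suc.hyps(1) [OF d subspace_orthogonal_slice [OF Suc.prems(1)]]
      carried_by_contract [OF Suc.prems(1) u Suc.prems(3)] by blast
  have "contract u (wedge (of_vec u) v) = 0"
    using wedge_eq_0_if_carried_by [OF Suc.prems u(1)] by (simp add: contract.zero_right)
  then have "(u \<bullet> u) *\<^sub>R v = wedge (of_vec u) (contract u v)"
    by (simp add: contract_wedge)
  also have "\<dots> = c *\<^sub>R foldr (\<lambda>u w. wedge (of_vec u) w) (u # us) (axis {} 1)"
    by (simp add: us(2) wedge.scaleR_right)
  finally have "(1 / (u \<bullet> u)) *\<^sub>R (u \<bullet> u) *\<^sub>R v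
      = (1 / (u \<bullet> u)) *\<^sub>R c *\<^sub>R foldr (\<lambda>u w. wedge (of_vec u) w) (u # us) (axis {} 1)"
    by (rule arg_cong)
  then have "v = (c / (u \<bullet> u)) *\<^sub>R foldr (\<lambda>u w. wedge (of_vec u) w) (u # us) (axis {} 1)"
    using u by simp
  moreover have "length (u # us) = dim S"
    using us(1) d Suc.hyps(2) by simp
  ultimately show ?case by blast
qed

lemma simple_if_carried_by:
  assumes "subspace S" and "v \<in> grade (dim S)" and "carried_by S v" and "dim S \<noteq> 0"
  shows "simple_mvec (dim S) v"
proof -
  obtain us c where us: "length us = dim S"
    "v = c *\<^sub>R foldr (\<lambda>u w. wedge (of_vec u) w) us (axis {} 1)"
    using decomposable_if_carried_by [OF assms(1-3)] by blast
  then obtain u us' where "us = u # us'"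
    using assms(4) by (cases us) auto
  then have "length ((c *\<^sub>R u) # us') = dim S"
    "v = foldr (\<lambda>u w. wedge (of_vec u) w) ((c *\<^sub>R u) # us') (axis {} 1)"
    using us by (auto simp: linear_cmul [OF linear_of_vec] wedge.scaleR_left)
  then show ?thesis unfolding simple_mvec_def by blast
qed

lemma mvec_span_eq:
  fixes v :: "'n::{finite,linorder} mvec"
  assumes "h \<noteq> 0"
  shows "mvec_span h v = (\<lambda>\<alpha>. \<chi> i. v \<bullet> wedge \<alpha> (axis {i} 1)) ` grade (h - 1)"
proof -
  have "axis {i} 1 \<in> (grade (h - (h - 1)) :: 'n mvec set)" for i
    using axis_in_grade [of "{i}" 1] assms by simp
  from interior_mult_char(2) [OF this]
  have "interior_mult h (h - 1) v \<alpha> $ {i} = v \<bullet> wedge \<alpha> (axis {i} 1)" for \<alpha> i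
    by (simp only: inner_axis inner_real_def mult_1_right)
  then have "to_vec (interior_mult h (h - 1) v \<alpha>) = (\<chi> i. v \<bullet> wedge \<alpha> (axis {i} 1))" for \<alpha>
    by (simp add: to_vec_def)
  then show ?thesis using assms by (auto simp: mvec_span_def)
qed

lemma inner_mvec_span_element:
  "a \<bullet> (\<chi> i. v \<bullet> wedge \<alpha> (axis {i} 1)) = v \<bullet> wedge \<alpha> (of_vec a)"
  by (simp add: of_vec_def wedge.sum_right wedge.scaleR_right inner_sum_right inner_vec_def [of a])

lemma subspace_mvec_span: "subspace (mvec_span h v)"
proof (cases "h = 0")
  case False
  have "linear (\<lambda>\<alpha>. (\<chi> i. v \<bullet> wedge \<alpha> (axis {i} 1)) :: 'a euc)"
    by (rule linearI) (simp_all add: vec_eq_iff wedge.add_left wedge.scaleR_left inner_add_right)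
  then show ?thesis
    unfolding mvec_span_eq [OF False] by (rule linear_subspace_image) (rule subspace_grade)
qed (simp add: mvec_span_def subspace_single_0)

text \<open>
  The pairing of \<open>a\<close> with the elements of the span is, up to sign, the pairing of \<open>contract a v\<close> with all
  multivectors of its degree.
\<close>

lemma orthogonal_mvec_span_iff:
  assumes "h \<noteq> 0" and v: "v \<in> grade h"
  shows "(\<forall>s\<in>mvec_span h v. a \<bullet> s = 0) \<longleftrightarrow> contract a v = 0"
proof -
  have eq: "v \<bullet> wedge \<alpha> (of_vec a) = (- 1) ^ (h - 1) * (contract a v \<bullet> \<alpha>)" if "\<alpha> \<in> grade (h - 1)" for \<alpha>
    using wedge_of_vec_right [OF that, of a] by (simp add: contract_adjoint)
  have "contract a v \<in> grade (h - 1)"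
    using assms by (intro contract_in_grade) simp
  then have "contract a v = 0 \<longleftrightarrow> (\<forall>\<alpha>\<in>grade (h - 1). contract a v \<bullet> \<alpha> = 0)"
    by (metis inner_eq_zero_iff inner_zero_left)
  then show ?thesis
    by (simp add: mvec_span_eq [OF assms(1)] inner_mvec_span_element eq)
qed

lemma carried_by_mvec_span:
  assumes "h \<noteq> 0" and "v \<in> grade h"
  shows "carried_by (mvec_span h v) v"
  using orthogonal_mvec_span_iff [OF assms] by (simp add: carried_by_def)

text \<open>
  A multivector is carried by its span, so the span of a nonzero \<open>h\<close>-vector has dimension at least \<open>h\<close>.
\<close>

lemma mvec_span_eq_if_subset:
  assumes "h \<noteq> 0" and "v \<in> grade h" and "v \<noteq> 0"
    and "subspace S" and "dim S = h" and "mvec_span h v \<subseteq> S"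
  shows "mvec_span h v = S"
proof (rule subspace_dim_equal [OF subspace_mvec_span assms(4) assms(6)])
  show "dim S \<le> dim (mvec_span h v)"
    using carried_by_low_dim_eq_0 [OF subspace_mvec_span assms(2) carried_by_mvec_span] assms
    by (meson linorder_not_less)
qed

lemma inner_wedge_of_vec_of_vec:
  "wedge (of_vec u) (of_vec v) \<bullet> wedge (of_vec a) (of_vec b)
    = (a \<bullet> u) * (b \<bullet> v) - (a \<bullet> v) * (b \<bullet> u)"
proof -
  have "contract a (wedge (of_vec u) (of_vec v)) = (a \<bullet> u) *\<^sub>R of_vec v - (a \<bullet> v) *\<^sub>R of_vec u"
  proof -
    have "contract a (of_vec v) = (a \<bullet> v) *\<^sub>R axis {} 1"
      using contract_wedge [of a v "axis {} 1"] by (simp add: wedge_one wedge.zero_right)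
    then show ?thesis
      by (simp add: contract_wedge wedge.scaleR_right wedge_one)
  qed
  moreover have "wedge (of_vec u) (of_vec v) \<bullet> wedge (of_vec a) (of_vec b)
      = contract a (wedge (of_vec u) (of_vec v)) \<bullet> of_vec b"
    by (rule contract_adjoint [symmetric])
  ultimately show ?thesis
    by (simp add: inner_diff_left inner_of_vec_of_vec) (simp add: inner_commute)
qed

text \<open>
  If \<open>t\<close> is a multiple of \<open>u\<^sub>1 \<and> \<dots> \<and> u\<^sub>k\<close> with orthonormal \<open>u\<^sub>i\<close>, and \<open>u = u\<^sub>1\<close>, \<open>v = u\<^sub>2\<close>, then
  \<open>contract v (contract u t)\<close> is what remains of \<open>t\<close> after removal of the factor
  \<open>u \<and> v\<close>, so wedging it with a two-form and pairing with \<open>t\<close> evaluates the two-form on \<open>u \<and> v\<close>. The Clifford relation proves this without a basis: all terms in which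
  \<open>u\<close> or \<open>v\<close> is wedged with \<open>t\<close> drop out.
\<close>

lemma inner_wedge_wedge_contract_contract:
  assumes u: "wedge (of_vec u) t = 0" and v: "wedge (of_vec v) t = 0"
  shows "t \<bullet> wedge (of_vec a) (wedge (of_vec b) (contract v (contract u t)))
    = (t \<bullet> t) * (wedge (of_vec u) (of_vec v) \<bullet> wedge (of_vec a) (of_vec b))"
proof -
  have wc: "wedge (of_vec b) (contract a w) = (a \<bullet> b) *\<^sub>R w - contract a (wedge (of_vec b) w)" for a b w
    by (simp add: contract_wedge)
  have 1: "t \<bullet> wedge (of_vec a) (contract u t) = (a \<bullet> u) * (t \<bullet> t)" 
    if "wedge (of_vec u) t = 0" for u
  proof -
    have "t \<bullet> contract u (wedge (of_vec a) t) = 0"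
      using that contract_adjoint [of u "wedge (of_vec a) t" t] by (simp add: inner_commute)
    then show ?thesis by (simp add: wc inner_diff_right inner_commute)
  qed
  have 2: "t \<bullet> wedge (of_vec a) (contract v (contract u w)) = 0" for w
  proof -
    have "wedge (of_vec v) (contract a t) = (a \<bullet> v) *\<^sub>R t"
      using v by (simp add: wc contract.zero_right)
    then have "wedge (of_vec u) (wedge (of_vec v) (contract a t)) = 0"
      using u by (simp add: wedge.scaleR_right)
    moreover have "t \<bullet> wedge (of_vec a) (contract v (contract u w))
        = w \<bullet> wedge (of_vec u) (wedge (of_vec v) (contract a t))"
      by (metis contract_adjoint inner_commute)
    ultimately show ?thesis by simp
  qed
  have "wedge (of_vec b) (contract v (contract u t))
      = (b \<bullet> v) *\<^sub>R contract u t - (b \<bullet> u) *\<^sub>R contract v t + contract v (contract u (wedge (of_vec b) t))"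
    by (simp add: wc contract.diff_right contract.scaleR_right inner_commute)
  then show ?thesis
    by (simp add: wedge.add_right wedge.diff_right wedge.scaleR_right inner_add_right inner_diff_right
      1 [OF u] 1 [OF v] 2 inner_wedge_of_vec_of_vec) (simp add: algebra_simps)
qed

section \<open>Smooth functions and mollification\<close>

lemma Ck_on_1_has_derivative:
  "Ck_on 1 f U \<Longrightarrow> x \<in> U \<Longrightarrow> (f has_derivative frechet_derivative f (at x)) (at x)"
  by (simp add: frechet_derivative_works)

lemma Ck_on_1_continuous: "Ck_on 1 f U \<Longrightarrow> continuous_on U f"
  by (intro differentiable_imp_continuous_on)
    (auto simp: differentiable_on_def intro: differentiable_at_withinI)

lemma Ck_on_Suc_imp_Ck_on: "Ck_on (Suc p) f U \<Longrightarrow> Ck_on p f U"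
proof (induction p arbitrary: f)
  case 0
  then show ?case using Ck_on_1_continuous [of f U] by simp
qed auto

lemma Ck_on_Suc_UNIV_I:
  assumes "\<And>x. (f has_derivative f' x) (at x)" and "\<And>v. Ck_on p (\<lambda>x. f' x v) UNIV"
  shows "Ck_on (Suc p) f UNIV"
proof -
  have "frechet_derivative f (at x) = f' x" for x
    using frechet_derivative_at [OF assms(1)] by simp
  then show ?thesis using assms by (auto simp: differentiable_def)
qed

lemma Ck_on_const: "Ck_on p (\<lambda>x. c) UNIV"
proof (induction p arbitrary: c)
  case (Suc p)
  show ?case by (rule Ck_on_Suc_UNIV_I [where f' = "\<lambda>_ _. 0"]) (auto simp: Suc)
qed simp

lemma Ck_on_bounded_linear:
  assumes "bounded_linear L" shows "Ck_on p L UNIV"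
proof (cases p)
  case 0
  then show ?thesis by (simp add: linear_continuous_on assms)
next
  case (Suc q)
  then show ?thesis
    using Ck_on_Suc_UNIV_I [of L "\<lambda>_. L" q] bounded_linear_imp_has_derivative [OF assms]
    by (simp add: Ck_on_const)
qed

lemma Ck_on_add:
  "Ck_on p f UNIV \<Longrightarrow> Ck_on p g UNIV \<Longrightarrow> Ck_on p (\<lambda>x. f x + g x) UNIV"
proof (induction p arbitrary: f g)
  case (Suc p)
  show ?case
    by (rule Ck_on_Suc_UNIV_I
        [where f' = "\<lambda>x v. frechet_derivative f (at x) v + frechet_derivative g (at x) v"])
       (use Suc in \<open>auto intro!: has_derivative_add simp: frechet_derivative_works [symmetric]\<close>)
qed (auto intro: continuous_intros)

lemma Ck_on_bilinear:
  assumes "bounded_bilinear b"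
  shows "Ck_on p f UNIV \<Longrightarrow> Ck_on p g UNIV \<Longrightarrow> Ck_on p (\<lambda>x. b (f x) (g x)) UNIV"
proof (induction p arbitrary: f g)
  case 0
  then show ?case by (auto intro: bounded_bilinear.continuous_on [OF assms])
next
  case (Suc p)
  show ?case
  proof (rule Ck_on_Suc_UNIV_I)
    show "((\<lambda>x. b (f x) (g x)) has_derivative
        (\<lambda>v. b (f x) (frechet_derivative g (at x) v) + b (frechet_derivative f (at x) v) (g x))) (at x)" for x
      using Suc.prems
      by (intro bounded_bilinear.FDERIV [OF assms]) (auto simp: frechet_derivative_works [symmetric])
    show "Ck_on p (\<lambda>x. b (f x) (frechet_derivative g (at x) v) + b (frechet_derivative f (at x) v) (g x)) UNIV" for v
      using Suc.prems by (intro Ck_on_add Suc.IH) (auto intro: Ck_on_Suc_imp_Ck_on)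
  qed
qed

lemma Ck_on_sum:
  "(\<And>i. i \<in> I \<Longrightarrow> Ck_on p (f i) UNIV) \<Longrightarrow> Ck_on p (\<lambda>x. \<Sum>i\<in>I. f i x) UNIV"
  by (induction I rule: infinite_finite_induct) (auto intro: Ck_on_add Ck_on_const)

text \<open>
  For \<open>m = 0\<close> this is the standard smooth function that is flat at \<open>0\<close>. The powers in the denominator make
  the family closed under differentiation up to linear combinations.
\<close>

definition flat_exp :: "nat \<Rightarrow> real \<Rightarrow> real"
  where "flat_exp m t = (if t > 0 then exp (- 1 / t) / t ^ m else 0)"

lemma tendsto_flat_exp_0: "(flat_exp m \<longlongrightarrow> 0) (at 0)"
proof -
  have "((\<lambda>t. inverse t ^ m / exp (inverse t)) \<longlongrightarrow> (0 :: real)) (at_right 0)"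
    by (rule filterlim_compose [OF tendsto_power_div_exp_0 filterlim_inverse_at_top_right])
  moreover have "\<forall>\<^sub>F t in at_right 0. inverse t ^ m / exp (inverse t) = flat_exp m t"
    using eventually_at_right_less [of 0]
    by eventually_elim (auto simp: flat_exp_def exp_minus field_simps)
  ultimately have "(flat_exp m \<longlongrightarrow> 0) (at_right 0)"
    by (rule Lim_transform_eventually)
  moreover have "(flat_exp m \<longlongrightarrow> 0) (at_left 0)"
    by (rule tendsto_eventually) (auto simp: flat_exp_def eventually_at_filter)
  ultimately show ?thesis by (simp add: filterlim_split_at)
qed

lemma has_real_derivative_flat_exp:
  "(flat_exp m has_real_derivative flat_exp (m + 2) t - m * flat_exp (m + 1) t) (at t)"
proof -
  consider "t > 0" | "t < 0" | "t = 0" by linarith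
  then show ?thesis
  proof cases
    case 1
    have "((\<lambda>t. exp (- 1 / t) / t ^ m) has_real_derivative
        flat_exp (m + 2) t - m * flat_exp (m + 1) t) (at t)"
      using 1 by (auto intro!: derivative_eq_intros simp: flat_exp_def field_simps power2_eq_square)
         (cases m; simp add: field_simps power2_eq_square)
    then show ?thesis
      by (rule has_field_derivative_transform_within_open [where S = "{0<..}"])
        (use 1 in \<open>auto simp: flat_exp_def\<close>)
  next
    case 2
    have "((\<lambda>t. 0) has_real_derivative flat_exp (m + 2) t - m * flat_exp (m + 1) t) (at t)"
      using 2 by (auto simp: flat_exp_def)
    then show ?thesis
      by (rule has_field_derivative_transform_within_open [where S = "{..<0}"])
        (use 2 in \<open>auto simp: flat_exp_def\<close>)
  next
    case 3
    have "((\<lambda>h. (flat_exp m (0 + h) - flat_exp m 0) / h) \<longlongrightarrow> 0) (at 0)"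
      by (rule Lim_transform_eventually [OF tendsto_flat_exp_0 [of "m + 1"]])
         (auto simp: flat_exp_def eventually_at_filter)
    then show ?thesis using 3 by (simp add: DERIV_def flat_exp_def)
  qed
qed

lemma Ck_on_flat_exp_bump:
  fixes c :: real
  shows "Ck_on p (\<lambda>z :: 'a::real_inner. flat_exp m (c - z \<bullet> z)) UNIV"
proof (induction p arbitrary: m)
  case 0
  have "isCont (flat_exp m) t" for t
    using has_real_derivative_flat_exp by (rule DERIV_isCont)
  then have "continuous_on UNIV (flat_exp m)"
    by (simp add: continuous_at_imp_continuous_on)
  then show ?case
    by (auto intro!: continuous_intros continuous_on_compose2 [of UNIV "flat_exp m"])
next
  case (Suc p)
  show ?case
  proof (rule Ck_on_Suc_UNIV_I)
    fix x :: 'a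
    have "((\<lambda>z. c - z \<bullet> z) has_derivative (\<lambda>v. - 2 * (v \<bullet> x))) (at x)"
      by (auto intro!: derivative_eq_intros simp: inner_commute)
    from has_derivative_compose [where g = "flat_exp m", OF this
        has_real_derivative_flat_exp [of m "c - x \<bullet> x", unfolded has_field_derivative_def]]
    show "((\<lambda>z. flat_exp m (c - z \<bullet> z)) has_derivative
        (\<lambda>v. (flat_exp (m + 2) (c - x \<bullet> x) + (- real m) *\<^sub>R flat_exp (m + 1) (c - x \<bullet> x)) * (- 2 * (v \<bullet> x)))) (at x)"
      by simp
  next
    fix v :: 'a
    have lin: "Ck_on p (\<lambda>x. - 2 * (v \<bullet> x)) UNIV"
      by (rule Ck_on_bounded_linear) (intro bounded_linear_intros)
    have "Ck_on p (\<lambda>x :: 'a. (- real m) *\<^sub>R flat_exp (m + 1) (c - x \<bullet> x)) UNIV"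
      by (rule Ck_on_bilinear [OF bounded_bilinear_scaleR Ck_on_const Suc])
    then show "Ck_on p (\<lambda>x :: 'a. (flat_exp (m + 2) (c - x \<bullet> x)
        + (- real m) *\<^sub>R flat_exp (m + 1) (c - x \<bullet> x)) * (- 2 * (v \<bullet> x))) UNIV"
      by (rule Ck_on_bilinear [OF bounded_bilinear_mult Ck_on_add [OF Suc] lin])
  qed
qed

lemma smooth_mollifier_exists:
  assumes "\<epsilon> > 0"
  obtains \<rho> :: "'a::euclidean_space \<Rightarrow> real"
  where "\<And>p. Ck_on p \<rho> UNIV" and "\<And>z. 0 \<le> \<rho> z" and "\<And>z. \<epsilon> \<le> norm z \<Longrightarrow> \<rho> z = 0"
    and "(\<rho> has_integral 1) UNIV"
proof -
  define \<sigma> :: "'a \<Rightarrow> real" where "\<sigma> z = flat_exp 0 (\<epsilon>\<^sup>2 - z \<bullet> z)" for z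
  have smooth: "Ck_on p \<sigma> UNIV" for p
    unfolding \<sigma>_def by (rule Ck_on_flat_exp_bump)
  then have cont: "continuous_on A \<sigma>" for A
    using Ck_on_1_continuous continuous_on_subset by blast
  have nonneg: "0 \<le> \<sigma> z" for z
    by (simp add: \<sigma>_def flat_exp_def)
  have zero: "\<sigma> z = 0" if "\<epsilon> \<le> norm z" for z
  proof -
    have "\<epsilon>\<^sup>2 \<le> z \<bullet> z"
      using power_mono [OF that, of 2] assms by (simp add: power2_norm_eq_inner)
    then show ?thesis by (simp add: \<sigma>_def flat_exp_def)
  qed
  let ?C = "cbox (- (\<epsilon> *\<^sub>R One)) (\<epsilon> *\<^sub>R One) :: 'a set"
  have ball: "z \<in> ?C" if "\<sigma> z \<noteq> 0" for z
  proof -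
    have "norm z < \<epsilon>" using zero that by force
    then have "- \<epsilon> \<le> z \<bullet> i \<and> z \<bullet> i \<le> \<epsilon>" if "i \<in> Basis" for i
      using Basis_le_norm [OF that, of z] by linarith
    then show ?thesis by (simp add: mem_box)
  qed
  define I where "I = integral ?C \<sigma>"
  have "\<sigma> integrable_on ?C"
    by (intro integrable_continuous cont)
  then have I: "(\<sigma> has_integral I) ?C"
    unfolding I_def by (rule integrable_integral)
  then have "(\<sigma> has_integral I) UNIV"
    by (rule has_integral_on_superset) (use ball in auto)
  moreover have "I \<noteq> 0"
  proof
    assume "I = 0"
    have "\<sigma> 0 = 0"
    proof (rule has_integral_0_cbox_imp_0 [OF cont nonneg])
      show "(\<sigma> has_integral 0) ?C" using I \<open>I = 0\<close> by simp
    qed (use assms in \<open>auto simp: box_ne_empty mem_box\<close>)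
    then show False using assms by (simp add: \<sigma>_def flat_exp_def)
  qed
  moreover have "I \<ge> 0"
    using I nonneg by (rule has_integral_nonneg)
  ultimately show ?thesis
  proof (intro that [of "\<lambda>z. (1 / I) *\<^sub>R \<sigma> z"])
    show "Ck_on p (\<lambda>z. (1 / I) *\<^sub>R \<sigma> z) UNIV" for p
      by (rule Ck_on_bilinear [OF bounded_bilinear_scaleR Ck_on_const smooth])
    assume "(\<sigma> has_integral I) UNIV" "I \<noteq> 0"
    then show "((\<lambda>z. (1 / I) *\<^sub>R \<sigma> z) has_integral 1) UNIV"
      using has_integral_cmul [of \<sigma> I UNIV "1 / I"] by simp
  qed (use nonneg zero in auto)
qed

lemma has_derivative_convolution:
  fixes f :: "'a::euclidean_space \<Rightarrow> 'b::euclidean_space" and h :: "'a \<Rightarrow> 'c::euclidean_space"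
    and b :: "'b \<Rightarrow> 'c \<Rightarrow> 'd::euclidean_space"
  assumes b: "bounded_bilinear b" and f: "Ck_on 1 f UNIV" and h: "continuous_on UNIV h"
  shows "((\<lambda>x. integral (cbox l u) (\<lambda>y. b (f (x - y)) (h y))) has_derivative
    (\<lambda>v. integral (cbox l u) (\<lambda>y. b (frechet_derivative f (at (x - y)) v) (h y)))) (at x)"
proof -
  note [continuous_intros] = bounded_bilinear.continuous_on [OF b]
  define F where "F x y = Blinfun (\<lambda>v. b (frechet_derivative f (at (x - y)) v) (h y))" for x y
  have der: "(f has_derivative frechet_derivative f (at z)) (at z)" for z
    using f by (auto intro: Ck_on_1_has_derivative)
  have F: "blinfun_apply (F x y) = (\<lambda>v. b (frechet_derivative f (at (x - y)) v) (h y))" for x y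
    unfolding F_def
    by (intro bounded_linear_Blinfun_apply bounded_linear_compose
      [OF bounded_bilinear.bounded_linear_left [OF b]] has_derivative_bounded_linear [OF der])
  have contf: "continuous_on A f" for A
    using Ck_on_1_continuous [OF f] continuous_on_subset by blast
  have contf': "continuous_on A (\<lambda>z. frechet_derivative f (at z) v)" for A v
    using f continuous_on_subset [of UNIV] by auto
  have conth: "continuous_on A h" for A
    using h continuous_on_subset by blast
  have contF: "continuous_on A (\<lambda>(x, y). F x y)" for A
    unfolding split_beta
    by (intro continuous_on_blinfun_componentwise)
       (auto simp: F intro!: continuous_intros continuous_on_compose2 [OF contf' [of UNIV]]
          continuous_on_compose2 [OF conth [of UNIV]])
  have "((\<lambda>x. integral (cbox l u) (\<lambda>y. b (f (x - y)) (h y))) has_derivative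
      blinfun_apply (integral (cbox l u) (F x))) (at x within UNIV)"
  proof (rule leibniz_rule [where fx = F])
    fix x y
    show "((\<lambda>x. b (f (x - y)) (h y)) has_derivative blinfun_apply (F x y)) (at x within UNIV)"
      unfolding F
    proof (rule bounded_linear.has_derivative [OF bounded_bilinear.bounded_linear_left [OF b]])
      have "((\<lambda>x. x - y) has_derivative (\<lambda>v. v)) (at x)"
        by (auto intro!: derivative_eq_intros)
      from has_derivative_compose [OF this der]
      show "((\<lambda>x. f (x - y)) has_derivative frechet_derivative f (at (x - y))) (at x)" by simp
    qed
    show "(\<lambda>y. b (f (x - y)) (h y)) integrable_on cbox l u"
      by (intro integrable_continuous continuous_intros continuous_on_compose2 [OF contf [of UNIV]] conth) auto
  qed (auto intro: contF)
  moreover have "F x integrable_on cbox l u"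
    using contF [of "{x} \<times> cbox l u"] 
    by (intro integrable_continuous) (auto intro!: continuous_on_compose2 [of _ "\<lambda>(x, y). F x y" _ "Pair x", simplified] continuous_intros)
  then have "blinfun_apply (integral (cbox l u) (F x))
      = (\<lambda>v. integral (cbox l u) (\<lambda>y. b (frechet_derivative f (at (x - y)) v) (h y)))"
    by (simp add: fun_eq_iff blinfun_apply_integral F)
  ultimately show ?thesis by simp
qed

lemma integral_UNIV_eq_if_supported:
  fixes h :: "'a::euclidean_space \<Rightarrow> 'b::euclidean_space"
  assumes "\<And>y. y \<notin> S \<Longrightarrow> h y = 0"
  shows "integral UNIV h = integral S h"
  unfolding integral_restrict_UNIV [of S h, symmetric] by (rule integral_cong) (use assms in auto)

lemma integrable_on_UNIV_if_supported:
  fixes h :: "'a::euclidean_space \<Rightarrow> 'b::euclidean_space"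
  assumes "continuous_on UNIV h" and "compact K" and "\<And>y. y \<notin> K \<Longrightarrow> h y = 0"
  shows "h integrable_on UNIV" and "integrable lborel h"
proof -
  have "(\<lambda>y. indicator K y *\<^sub>R h y) = h"
    using assms(3) by (auto simp: indicator_def fun_eq_iff)
  then show "integrable lborel h"
    using borel_integrable_compact [OF assms(2), of h] continuous_on_subset [OF assms(1)] by simp
  then show "h integrable_on UNIV"
    using has_integral_integral_lborel by blast
qed

text \<open>
  This is the symmetry of the convolution. Differentiating the kernel shows that a mollification is
  smooth; moving the derivative to the mollified function shows that derivatives converge.
\<close>

lemma integral_UNIV_reflect_translate:
  fixes h :: "'a::euclidean_space \<Rightarrow> 'b::euclidean_space"
  assumes h: "continuous_on UNIV h" and K: "compact K" "\<And>y. y \<notin> K \<Longrightarrow> h y = 0"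
  shows "integral UNIV (\<lambda>y. h (x - y)) = integral UNIV h"
proof -
  have "lborel = distr lborel borel (\<lambda>y :: 'a. x - y)"
    using lborel_affine [of "- 1" x] by (simp add: density_1)
  then have "(\<integral>y. h y \<partial>lborel) = (\<integral>y. h y \<partial>distr lborel borel (\<lambda>y. x - y))"
    by (rule arg_cong)
  also have "\<dots> = (\<integral>y. h (x - y) \<partial>lborel)"
    using borel_measurable_continuous_onI [OF h] by (intro integral_distr) auto
  finally have "(\<integral>y. h y \<partial>lborel) = (\<integral>y. h (x - y) \<partial>lborel)" .
  moreover have "integrable lborel (\<lambda>y. h (x - y))"
  proof (rule integrable_on_UNIV_if_supported)
    show "continuous_on UNIV (\<lambda>y. h (x - y))"
      by (intro continuous_on_compose2 [OF h] continuous_intros) auto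
    show "compact ((\<lambda>y. x - y) ` K)"
      using K(1) by (intro compact_continuous_image continuous_intros)
    fix y assume "y \<notin> (\<lambda>y. x - y) ` K"
    then have "x - y \<notin> K" by (auto simp: image_iff)
    then show "h (x - y) = 0" by (rule K)
  qed
  ultimately show ?thesis
    using integrable_on_UNIV_if_supported(2) [OF h K] by (simp add: integral_lborel)
qed

lemma uniformly_continuous_if_supported:
  fixes h :: "'a::euclidean_space \<Rightarrow> 'b::real_normed_vector"
  assumes h: "continuous_on UNIV h" and K: "compact K" "\<And>y. y \<notin> K \<Longrightarrow> h y = 0" and "\<delta> > 0"
  shows "\<forall>\<^sub>F \<epsilon> in at_right 0. \<forall>x y. dist x y < \<epsilon> \<longrightarrow> dist (h x) (h y) < \<delta>"
proof -
  obtain M where M: "\<And>x. x \<in> K \<Longrightarrow> norm x \<le> M"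
    using compact_imp_bounded [OF K(1)] by (auto simp: bounded_iff)
  have "uniformly_continuous_on (cball 0 (M + 1)) h"
    using h continuous_on_subset by (intro compact_uniformly_continuous) auto
  then obtain d where d: "d > 0"
    "\<And>x y. x \<in> cball 0 (M + 1) \<Longrightarrow> y \<in> cball 0 (M + 1) \<Longrightarrow> dist x y < d \<Longrightarrow> dist (h x) (h y) < \<delta>"
    using \<open>\<delta> > 0\<close> unfolding uniformly_continuous_on_def by metis
  have "dist (h x) (h y) < \<delta>" if "dist x y < min 1 d" for x y
  proof (cases "x \<in> cball 0 (M + 1) \<and> y \<in> cball 0 (M + 1)")
    case True
    then show ?thesis using d that by simp
  next
    case False
    have "norm x \<le> norm y + 1" "norm y \<le> norm x + 1"
      using that norm_triangle_ineq2 [of x y] norm_triangle_ineq2 [of y x]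
      by (auto simp: dist_norm norm_minus_commute)
    then have "norm x > M" "norm y > M" using False by auto
    then have "x \<notin> K" "y \<notin> K" using M by force+
    then show ?thesis using K(2) \<open>\<delta> > 0\<close> by simp
  qed
  then show ?thesis
    using d(1) unfolding eventually_at_right_field
    by (intro exI [of _ "min 1 d"]) (auto intro: less_trans)
qed

lemma frechet_derivative_eq_0_if_supported:
  assumes "closed K" and "\<And>y. y \<notin> K \<Longrightarrow> f y = 0" and "x \<notin> K"
  shows "frechet_derivative f (at x) = (\<lambda>v. 0)"
proof -
  have "((\<lambda>_. 0) has_derivative (\<lambda>v. 0)) (at x)" by simp
  then have "(f has_derivative (\<lambda>v. 0)) (at x)"
    by (rule has_derivative_transform_within_open [where s = "- K"]) (use assms in auto)
  then show ?thesis by (rule frechet_derivative_at [symmetric])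
qed

lemma mollification_error:
  fixes f :: "'a::euclidean_space \<Rightarrow> 'b::euclidean_space"
  assumes \<rho>: "continuous_on UNIV \<rho>" "\<And>z. 0 \<le> \<rho> z" "\<And>z. \<epsilon> \<le> norm z \<Longrightarrow> \<rho> z = 0" "(\<rho> has_integral 1) UNIV"
    and f: "continuous_on UNIV f" and near: "\<And>z. norm z < \<epsilon> \<Longrightarrow> dist (f (x - z)) (f x) \<le> \<delta>"
  shows "norm (integral UNIV (\<lambda>z. \<rho> z *\<^sub>R f (x - z)) - f x) \<le> \<delta>"
proof -
  have supp: "\<rho> z = 0" if "z \<notin> cball 0 \<epsilon>" for z
    using \<rho>(3) [of z] that by simp
  have int1: "(\<lambda>z. \<rho> z *\<^sub>R f (x - z)) integrable_on UNIV"
    by (rule integrable_on_UNIV_if_supported [OF _ compact_cball [of 0 \<epsilon>]])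
       (auto simp: supp intro!: continuous_intros \<rho>(1) continuous_on_compose2 [OF f])
  have const: "((\<lambda>z. \<rho> z *\<^sub>R f x) has_integral f x) UNIV"
    using has_integral_scaleR_left [OF \<rho>(4), of "f x"] by simp
  have "integral UNIV (\<lambda>z. \<rho> z *\<^sub>R f (x - z)) - f x
      = integral UNIV (\<lambda>z. \<rho> z *\<^sub>R f (x - z) - \<rho> z *\<^sub>R f x)"
    using const by (subst integral_diff [OF int1]) (auto simp: has_integral_iff)
  also have "norm \<dots> \<le> integral UNIV (\<lambda>z. \<rho> z * \<delta>)"
  proof (rule integral_norm_bound_integral)
    show "(\<lambda>z. \<rho> z *\<^sub>R f (x - z) - \<rho> z *\<^sub>R f x) integrable_on UNIV"
      using const by (intro integrable_diff int1) auto
    show "(\<lambda>z. \<rho> z * \<delta>) integrable_on UNIV"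
      using has_integral_mult_left [OF \<rho>(4), of \<delta>] by auto
    fix z
    show "norm (\<rho> z *\<^sub>R f (x - z) - \<rho> z *\<^sub>R f x) \<le> \<rho> z * \<delta>"
    proof (cases "norm z < \<epsilon>")
      case True
      then show ?thesis
        using near [OF True] \<rho>(2) [of z]
        by (auto simp: scaleR_diff_right [symmetric] dist_norm intro: mult_left_mono)
    qed (simp add: \<rho>(3))
  qed
  also have "\<dots> = \<delta>"
    using has_integral_mult_left [OF \<rho>(4), of \<delta>] by (simp add: has_integral_iff)
  finally show ?thesis .
qed

text \<open>
  Approximation in \<open>C\<^sup>1\<close> by convolution with a mollifier. The last property says that values of \<open>g\<close> lie in
  every subspace that contains the values of \<open>f\<close>; for forms it preserves the degree.
\<close>

lemma smooth_approximation:
  fixes f :: "'a::euclidean_space \<Rightarrow> 'b::euclidean_space"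
  assumes f: "Ck_on 1 f UNIV" and K: "compact K" "\<And>y. y \<notin> K \<Longrightarrow> f y = 0"
    and \<Omega>: "open \<Omega>" "K \<subseteq> \<Omega>" and "\<delta> > 0"
  obtains g K' where "\<And>p. Ck_on p g UNIV" and "compact K'" and "K' \<subseteq> \<Omega>" and "\<And>y. y \<notin> K' \<Longrightarrow> g y = 0"
    and "\<And>x. norm (g x - f x) \<le> \<delta>"
    and "\<And>x i. i \<in> Basis \<Longrightarrow>
      norm (frechet_derivative g (at x) i - frechet_derivative f (at x) i) \<le> \<delta>"
    and "\<And>L x. bounded_linear L \<Longrightarrow> (\<And>y. L (f y) = (0 :: real)) \<Longrightarrow> L (g x) = 0"
proof -
  define f' where "f' v x = frechet_derivative f (at x) v" for v x
  have contf: "continuous_on UNIV f"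
    by (rule Ck_on_1_continuous [OF f])
  have contf': "continuous_on UNIV (f' v)" for v
    using f by (simp add: f'_def)
  have f': "f' v y = 0" if "y \<notin> K" for v y
    using frechet_derivative_eq_0_if_supported [OF compact_imp_closed [OF K(1)] K(2) that]
    by (simp add: f'_def)
  have supp: "\<forall>y\<in>- K. f y = 0" and supp': "\<forall>y\<in>- K. f' v y = 0" for v
    using K(2) f' by auto
  obtain e where e: "e > 0" "(\<Union>x\<in>K. ball x e) \<subseteq> \<Omega>"
    using compact_subset_open_imp_ball_epsilon_subset [OF K(1) \<Omega>] by blast
  have "\<forall>\<^sub>F \<epsilon> in at_right 0. \<epsilon> \<in> {0<..<e} \<and> (\<forall>x y. dist x y < \<epsilon> \<longrightarrow> dist (f x) (f y) < \<delta>)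
      \<and> (\<forall>i\<in>Basis. \<forall>x y. dist x y < \<epsilon> \<longrightarrow> dist (f' i x) (f' i y) < \<delta>)"
    by (intro eventually_conj eventually_at_right_real e(1) eventually_ball_finite ballI finite_Basis
        uniformly_continuous_if_supported [OF contf K \<open>\<delta> > 0\<close>]
        uniformly_continuous_if_supported [OF contf' K(1) f' \<open>\<delta> > 0\<close>])
  from eventually_happens' [OF trivial_limit_at_right_real this]
  obtain \<epsilon> where "\<epsilon> \<in> {0<..<e} \<and> (\<forall>x y. dist x y < \<epsilon> \<longrightarrow> dist (f x) (f y) < \<delta>)
      \<and> (\<forall>i\<in>Basis. \<forall>x y. dist x y < \<epsilon> \<longrightarrow> dist (f' i x) (f' i y) < \<delta>)"
    by (elim exE)
  then have \<epsilon>: "0 < \<epsilon>" "\<epsilon> < e" "\<And>x y. dist x y < \<epsilon> \<Longrightarrow> dist (f x) (f y) < \<delta>"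
      "\<And>i x y. i \<in> Basis \<Longrightarrow> dist x y < \<epsilon> \<Longrightarrow> dist (f' i x) (f' i y) < \<delta>"
    by simp_all
  obtain \<rho> :: "'a \<Rightarrow> real" where \<rho>: "\<And>p. Ck_on p \<rho> UNIV" "\<And>z. 0 \<le> \<rho> z" "\<And>z. \<epsilon> \<le> norm z \<Longrightarrow> \<rho> z = 0"
    "(\<rho> has_integral 1) UNIV"
    using smooth_mollifier_exists [where 'a = 'a, OF \<epsilon>(1)] by blast
  have cont\<rho>: "continuous_on UNIV \<rho>"
    using Ck_on_1_continuous \<rho>(1) by blast
  obtain l u where lu: "K \<subseteq> cbox l u"
    using bounded_subset_cbox_symmetric [OF compact_imp_bounded [OF K(1)]] by metis
  obtain l' u' :: 'a where lu': "cball 0 \<epsilon> \<subseteq> cbox l' u'"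
    using bounded_subset_cbox_symmetric [OF bounded_cball, of "0 :: 'a" \<epsilon>] by metis
  define conv where "conv h \<kappa> x = integral (cbox l u) (\<lambda>y. \<kappa> (x - y) *\<^sub>R h y)"
    for h :: "'a \<Rightarrow> 'b" and \<kappa> :: "'a \<Rightarrow> real" and x
  have conv_eq: "conv h \<rho> x = integral UNIV (\<lambda>z. \<rho> z *\<^sub>R h (x - z))"
    if h: "continuous_on UNIV h" "\<forall>y\<in>- K. h y = 0" for h x
  proof -
    have "conv h \<rho> x = integral UNIV (\<lambda>y. \<rho> (x - y) *\<^sub>R h y)"
      unfolding conv_def using h(2) lu
      by (intro integral_UNIV_eq_if_supported [symmetric]) auto
    also have "\<dots> = integral UNIV (\<lambda>y. (\<lambda>z. \<rho> z *\<^sub>R h (x - z)) (x - y))"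
      by simp
    also have "\<dots> = integral UNIV (\<lambda>z. \<rho> z *\<^sub>R h (x - z))"
      by (rule integral_UNIV_reflect_translate [OF _ compact_cball [of 0 \<epsilon>]])
         (auto simp: \<rho>(3) intro!: continuous_intros cont\<rho> continuous_on_compose2 [OF h(1)])
    finally show ?thesis .
  qed
  have conv_near: "norm (conv h \<rho> x - h x) \<le> \<delta>"
    if h: "continuous_on UNIV h" "\<forall>y\<in>- K. h y = 0"
      "\<And>x y. dist x y < \<epsilon> \<Longrightarrow> dist (h x) (h y) < \<delta>" for h x
    unfolding conv_eq [OF h(1,2)]
  proof (rule mollification_error [OF cont\<rho> \<rho>(2-4) h(1)])
    fix z :: 'a assume "norm z < \<epsilon>"
    then show "dist (h (x - z)) (h x) \<le> \<delta>"
      using h(3) [of "x - z" x] by (simp add: dist_norm)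
  qed
  have conv_deriv: "(conv f \<rho> has_derivative (\<lambda>v. conv (f' v) \<rho> x)) (at x)" for x
  proof -
    have "conv f \<rho> = (\<lambda>x. integral (cbox l' u') (\<lambda>z. \<rho> z *\<^sub>R f (x - z)))"
      unfolding conv_eq [OF contf supp, abs_def]
      by (intro ext integral_UNIV_eq_if_supported) (use lu' \<rho>(3) in force)
    moreover have "conv (f' v) \<rho> x = integral (cbox l' u') (\<lambda>z. \<rho> z *\<^sub>R f' v (x - z))" for v
      unfolding conv_eq [OF contf' supp']
      by (intro integral_UNIV_eq_if_supported) (use lu' \<rho>(3) in force)
    ultimately show ?thesis
      using has_derivative_convolution [OF bounded_bilinear.flip [OF bounded_bilinear_scaleR] f cont\<rho>]
      by (simp add: f'_def)
  qed
  have conv_smooth: "Ck_on p (conv f \<kappa>) UNIV" if "\<And>p. Ck_on p \<kappa> UNIV" for p \<kappa>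
    using that
  proof (induction p arbitrary: \<kappa>)
    case 0
    have "(conv f \<kappa> has_derivative (\<lambda>v. conv f (\<lambda>y. frechet_derivative \<kappa> (at y) v) x)) (at x)" for x
      unfolding conv_def [abs_def]
      by (rule has_derivative_convolution [OF bounded_bilinear_scaleR 0 contf])
    then have "conv f \<kappa> differentiable_on UNIV"
      by (auto simp: differentiable_on_def differentiable_def)
    then show ?case using differentiable_imp_continuous_on by auto
  next
    case (Suc p)
    show ?case
    proof (rule Ck_on_Suc_UNIV_I)
      show "(conv f \<kappa> has_derivative (\<lambda>v. conv f (\<lambda>y. frechet_derivative \<kappa> (at y) v) x)) (at x)" for x
        unfolding conv_def [abs_def]
        by (rule has_derivative_convolution [OF bounded_bilinear_scaleR Suc.prems contf])
      have "Ck_on q (\<lambda>y. frechet_derivative \<kappa> (at y) v) UNIV" for q v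
        using Suc.prems [of "Suc q"] by simp
      then show "Ck_on p (conv f (\<lambda>y. frechet_derivative \<kappa> (at y) v)) UNIV" for v
        by (rule Suc.IH)
    qed
  qed
  show thesis
  proof (rule that [of "conv f \<rho>" "{y + z |y z. y \<in> K \<and> z \<in> cball 0 \<epsilon>}"])
    show "Ck_on p (conv f \<rho>) UNIV" for p
      by (rule conv_smooth) (rule \<rho>)
    show "compact {y + z |y z. y \<in> K \<and> z \<in> cball 0 \<epsilon>}"
      by (rule compact_sums) (auto simp: K)
    show "{y + z |y z. y \<in> K \<and> z \<in> cball 0 \<epsilon>} \<subseteq> \<Omega>"
    proof clarify
      fix y z :: 'a assume "y \<in> K" "z \<in> cball 0 \<epsilon>"
      then have "y + z \<in> ball y e" using \<epsilon>(2) by (simp add: dist_norm)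
      then show "y + z \<in> \<Omega>" using e(2) \<open>y \<in> K\<close> by blast
    qed
    show "conv f \<rho> x = 0" if x: "x \<notin> {y + z |y z. y \<in> K \<and> z \<in> cball 0 \<epsilon>}" for x
    proof -
      have "\<rho> z *\<^sub>R f (x - z) = 0" for z
      proof (cases "norm z \<le> \<epsilon>")
        case True
        have "x = (x - z) + z" by simp
        then have "x - z \<notin> K" using x True by (metis (mono_tags, lifting) mem_Collect_eq mem_cball_0)
        then show ?thesis by (simp add: K(2))
      qed (simp add: \<rho>(3))
      then show ?thesis by (simp only: conv_eq [OF contf supp] integral_0)
    qed
    show "norm (conv f \<rho> x - f x) \<le> \<delta>" for x
      by (rule conv_near [OF contf supp \<epsilon>(3)])
    show "norm (frechet_derivative (conv f \<rho>) (at x) i - frechet_derivative f (at x) i) \<le> \<delta>"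
      if "i \<in> Basis" for x i
      using conv_near [OF contf' supp' \<epsilon>(4) [OF that], of x]
      by (simp add: frechet_derivative_at [OF conv_deriv, symmetric]) (simp add: f'_def)
    show "L (conv f \<rho> x) = 0" if L: "bounded_linear L" "\<And>y. L (f y) = (0 :: real)" for L x
    proof -
      have "(\<lambda>y. \<rho> (x - y) *\<^sub>R f y) integrable_on cbox l u"
        by (intro integrable_continuous continuous_intros continuous_on_compose2 [OF cont\<rho>]
            continuous_on_subset [OF contf]) auto
      then have "L (conv f \<rho> x) = integral (cbox l u) (L \<circ> (\<lambda>y. \<rho> (x - y) *\<^sub>R f y))"
        unfolding conv_def using L(1) by (rule integral_linear [symmetric])
      also have "L \<circ> (\<lambda>y. \<rho> (x - y) *\<^sub>R f y) = (\<lambda>y. 0)"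
        using L by (auto simp: linear_cmul [OF bounded_linear.linear])
      finally show ?thesis by simp
    qed
  qed
qed

section \<open>Stokes' formula for continuously differentiable forms\<close>

lemma measurable_on_finite_borel_measure:
  assumes "finite_borel_measure_on \<Omega> M" and "h \<in> borel_measurable (restrict_space borel \<Omega>)"
  shows "h \<in> borel_measurable M"
  using assms measurable_cong_sets [of M "restrict_space borel \<Omega>" borel borel]
  by (auto simp: finite_borel_measure_on_def)

lemma continuous_on_borel_measurable_finite_borel_measure:
  fixes h :: "'a::topological_space \<Rightarrow> 'b::topological_space"
  assumes "finite_borel_measure_on \<Omega> M" and "continuous_on UNIV h"
  shows "h \<in> borel_measurable M"
  by (intro measurable_on_finite_borel_measure [OF assms(1)] measurable_restrict_space1
      borel_measurable_continuous_onI assms(2))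

lemma space_finite_borel_measure_on: "finite_borel_measure_on \<Omega> M \<Longrightarrow> space M = \<Omega>"
  using sets_eq_imp_space_eq [of M "restrict_space borel \<Omega>"]
  by (auto simp: finite_borel_measure_on_def space_restrict_space)

lemma integrable_inner_bounded:
  fixes \<tau> h :: "'a \<Rightarrow> 'b::euclidean_space"
  assumes \<tau>: "integrable M \<tau>" and h: "h \<in> borel_measurable M"
    and C: "\<And>x. x \<in> space M \<Longrightarrow> norm (h x) \<le> C"
  shows "integrable M (\<lambda>x. \<tau> x \<bullet> h x)" and "\<bar>\<integral>x. \<tau> x \<bullet> h x \<partial>M\<bar> \<le> C * (\<integral>x. norm (\<tau> x) \<partial>M)"
proof -
  have int: "integrable M (\<lambda>x. C * norm (\<tau> x))"
    using \<tau> by simp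
  have le: "\<bar>\<tau> x \<bullet> h x\<bar> \<le> C * norm (\<tau> x)" if "x \<in> space M" for x
  proof -
    have "\<bar>\<tau> x \<bullet> h x\<bar> \<le> norm (\<tau> x) * norm (h x)"
      by (rule Cauchy_Schwarz_ineq2)
    also have "\<dots> \<le> norm (\<tau> x) * C"
      using C [OF that] by (rule mult_left_mono) simp
    finally show ?thesis by (simp add: mult.commute)
  qed
  show 1: "integrable M (\<lambda>x. \<tau> x \<bullet> h x)"
  proof (rule Bochner_Integration.integrable_bound [OF int])
    show "AE x in M. norm (\<tau> x \<bullet> h x) \<le> norm (C * norm (\<tau> x))"
      using le by (intro AE_I2) (auto intro: order_trans [OF _ abs_ge_self])
  qed (intro borel_measurable_inner borel_measurable_integrable [OF \<tau>] h)
  have "\<bar>\<integral>x. \<tau> x \<bullet> h x \<partial>M\<bar> \<le> (\<integral>x. \<bar>\<tau> x \<bullet> h x\<bar> \<partial>M)"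
    by (rule integral_abs_bound)
  also have "\<dots> \<le> (\<integral>x. C * norm (\<tau> x) \<partial>M)"
    by (rule integral_mono [OF _ int le]) (use 1 in simp_all)
  finally show "\<bar>\<integral>x. \<tau> x \<bullet> h x \<partial>M\<bar> \<le> C * (\<integral>x. norm (\<tau> x) \<partial>M)"
    by simp
qed

lemma bounded_if_supported:
  assumes "continuous_on UNIV h" and "compact K" and "\<And>y. y \<notin> K \<Longrightarrow> h y = 0"
  shows "\<exists>C. \<forall>x. norm (h x) \<le> C"
proof -
  have "compact (h ` K)"
    using assms(2) by (intro compact_continuous_image continuous_on_subset [OF assms(1)]) auto
  then have "bounded (h ` K)" by (rule compact_imp_bounded)
  then obtain C where "\<And>x. x \<in> K \<Longrightarrow> norm (h x) \<le> C"
    by (auto simp: bounded_iff)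
  then have "norm (h x) \<le> max C 0" for x
    using assms(3) [of x] by (cases "x \<in> K") (auto simp: le_max_iff_disj)
  then show ?thesis by blast
qed

text \<open>
  The forms of a fixed degree take values in a linear subspace, which then contains their derivatives.
\<close>

lemma frechet_derivative_in_grade:
  fixes f :: "'n::finite form"
  assumes "open U" and "x \<in> U" and "\<And>y. y \<in> U \<Longrightarrow> f y \<in> grade h" and "f differentiable (at x)"
  shows "frechet_derivative f (at x) v \<in> grade h"
  unfolding grade_def
proof (clarify)
  fix I :: "'n set" assume I: "card I \<noteq> h"
  have "((\<lambda>y. f y $ I) has_derivative (\<lambda>v. frechet_derivative f (at x) v $ I)) (at x)"
    by (rule bounded_linear.has_derivative [OF bounded_linear_vec_nth])
       (use assms(4) in \<open>simp add: frechet_derivative_works\<close>)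
  moreover have "((\<lambda>y. f y $ I) has_derivative (\<lambda>v. 0)) (at x)"
  proof (rule has_derivative_transform_within_open [OF _ assms(1,2)])
    show "((\<lambda>y. 0 :: real) has_derivative (\<lambda>v. 0)) (at x)" by simp
    show "0 = f y $ I" if "y \<in> U" for y
      using assms(3) [OF that] I by (simp add: grade_def)
  qed
  ultimately have "(\<lambda>v. frechet_derivative f (at x) v $ I) = (\<lambda>v. 0)"
    by (rule has_derivative_unique)
  then show "frechet_derivative f (at x) v $ I = 0"
    by (rule fun_cong)
qed

lemma ext_deriv_in_grade:
  assumes "\<And>y. \<omega> y \<in> grade h" and "Ck_on 1 \<omega> UNIV"
  shows "ext_deriv \<omega> x \<in> grade (Suc h)"
  unfolding ext_deriv_def partial_deriv_def
  using wedge_in_grade [OF frechet_derivative_in_grade [of UNIV x \<omega> h], of "axis _ 1"] assms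
  by (intro subspace_sum [OF subspace_grade]) auto

lemma Ck_on_ext_deriv: "Ck_on (Suc p) \<omega> UNIV \<Longrightarrow> Ck_on p (ext_deriv \<omega>) UNIV"
  unfolding ext_deriv_def [abs_def] partial_deriv_def
  by (intro Ck_on_sum Ck_on_bilinear [OF bounded_bilinear_wedge] Ck_on_const) auto

lemma ext_deriv_eq_0_if_supported:
  assumes "closed K" and "\<And>y. y \<notin> K \<Longrightarrow> \<omega> y = 0" and "x \<notin> K"
  shows "ext_deriv \<omega> x = 0"
  using frechet_derivative_eq_0_if_supported [OF assms]
  by (simp add: ext_deriv_def partial_deriv_def wedge.zero_right)

lemma ext_deriv_close:
  obtains B where "B \<ge> 0" and "\<And>\<omega> \<eta> :: 'n::{finite,linorder} form. \<And>x \<delta>.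
    (\<And>i. norm (partial_deriv i \<omega> x - partial_deriv i \<eta> x) \<le> \<delta>) \<Longrightarrow>
      norm (ext_deriv \<omega> x - ext_deriv \<eta> x) \<le> B * \<delta>"
proof -
  obtain B where B: "0 < B" "\<And>a b :: 'n mvec. norm (wedge a b) \<le> norm a * norm b * B"
    using wedge.pos_bounded by blast
  show thesis
  proof (rule that)
    show "B * CARD('n) \<ge> 0" using B by simp
    fix \<omega> \<eta> :: "'n form" and x \<delta>
    assume d: "\<And>i. norm (partial_deriv i \<omega> x - partial_deriv i \<eta> x) \<le> \<delta>"
    have "norm (ext_deriv \<omega> x - ext_deriv \<eta> x)
        = norm (\<Sum>i\<in>UNIV. wedge (axis {i} 1) (partial_deriv i \<omega> x - partial_deriv i \<eta> x))"
      by (simp add: ext_deriv_def wedge.diff_right sum_subtractf)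
    also have "\<dots> \<le> (\<Sum>i\<in>(UNIV :: 'n set). \<delta> * B)"
    proof (intro order_trans [OF norm_sum] sum_mono)
      fix i :: 'n
      have "norm (wedge (axis {i} 1) (partial_deriv i \<omega> x - partial_deriv i \<eta> x))
          \<le> norm (partial_deriv i \<omega> x - partial_deriv i \<eta> x) * B"
        using B(2) [of "axis {i} 1" "partial_deriv i \<omega> x - partial_deriv i \<eta> x"] by (simp add: norm_axis_1)
      also have "\<dots> \<le> \<delta> * B"
        using d B(1) by (intro mult_right_mono) auto
      finally show "norm (wedge (axis {i} 1) (partial_deriv i \<omega> x - partial_deriv i \<eta> x)) \<le> \<delta> * B" .
    qed
    finally show "norm (ext_deriv \<omega> x - ext_deriv \<eta> x) \<le> B * CARD('n) * \<delta>"
      by (simp add: mult.commute mult.left_commute)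
  qed
qed

text \<open>
  The defining relation between \<open>T\<close> and \<open>boundary T\<close> holds for smooth forms. Both sides, written as
  integrals, are continuous with respect to uniform convergence of the form and of its first derivatives,
  so the approximation by smooth forms extends it.
\<close>

lemma stokes_C1:
  fixes T :: "'n::{finite,linorder} form \<Rightarrow> real" and \<eta> :: "'n form"
  assumes \<Omega>: "open \<Omega>"
    and T: "represented_by (Suc h) \<Omega> T \<tau> \<mu>" and T': "represented_by h \<Omega> (boundary T) \<tau>' \<mu>'"
    and \<eta>: "Ck_on 1 \<eta> UNIV" "\<And>x. \<eta> x \<in> grade h"
    and K: "compact K" "K \<subseteq> \<Omega>" "\<And>x. x \<notin> K \<Longrightarrow> \<eta> x = 0"
  shows "(\<integral>x. \<tau>' x \<bullet> \<eta> x \<partial>\<mu>') = (\<integral>x. \<tau> x \<bullet> ext_deriv \<eta> x \<partial>\<mu>)"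
proof -
  obtain B where B: "B \<ge> 0" "\<And>\<omega> \<eta> :: 'n form. \<And>x \<delta>.
    (\<And>i. norm (partial_deriv i \<omega> x - partial_deriv i \<eta> x) \<le> \<delta>) \<Longrightarrow>
      norm (ext_deriv \<omega> x - ext_deriv \<eta> x) \<le> B * \<delta>"
    by (rule ext_deriv_close) blast
  have \<mu>: "finite_borel_measure_on \<Omega> \<mu>" "finite_borel_measure_on \<Omega> \<mu>'"
    and int: "integrable \<mu> \<tau>" "integrable \<mu>' \<tau>'"
    using T T' by (auto simp: represented_by_def)
  have cont: "continuous_on UNIV \<eta>" "continuous_on UNIV (ext_deriv \<eta>)"
    using Ck_on_1_continuous [OF \<eta>(1)] Ck_on_ext_deriv [of 0 \<eta>] \<eta>(1) by auto
  have inner: "integrable \<mu>0 (\<lambda>x. \<tau>0 x \<bullet> f x)"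
    if *: "finite_borel_measure_on \<Omega> \<mu>0" "integrable \<mu>0 \<tau>0" "continuous_on UNIV f" "compact K0" "\<And>x. x \<notin> K0 \<Longrightarrow> f x = 0"
    for \<mu>0 and \<tau>0 f :: "'n form" and K0
  proof -
    obtain C where "\<And>x. norm (f x) \<le> C"
      using bounded_if_supported [OF *(3-5)] by blast
    then show ?thesis
      using integrable_inner_bounded(1) [OF *(2) continuous_on_borel_measurable_finite_borel_measure [OF *(1,3)]]
      by blast
  qed
  \<comment> \<open>The error bound when the form and its partial derivatives are approximated up to \<open>\<delta>\<close> is \<open>\<delta> * M\<close>.\<close>
  define M where "M = (\<integral>x. norm (\<tau>' x) \<partial>\<mu>') + B * (\<integral>x. norm (\<tau> x) \<partial>\<mu>)"
  have "\<bar>(\<integral>x. \<tau>' x \<bullet> \<eta> x \<partial>\<mu>') - (\<integral>x. \<tau> x \<bullet> ext_deriv \<eta> x \<partial>\<mu>)\<bar> \<le> \<delta> * M" if \<delta>: "\<delta> > 0" for \<delta>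
  proof -
    obtain g K' where g: "\<And>p. Ck_on p g UNIV" and K': "compact K'" "K' \<subseteq> \<Omega>" "\<And>y. y \<notin> K' \<Longrightarrow> g y = 0"
      and near: "\<And>x. norm (g x - \<eta> x) \<le> \<delta>"
      and near': "\<And>x i. i \<in> Basis \<Longrightarrow>
        norm (frechet_derivative g (at x) i - frechet_derivative \<eta> (at x) i) \<le> \<delta>"
      and L: "\<And>L x. bounded_linear L \<Longrightarrow> (\<And>y. L (\<eta> y) = (0 :: real)) \<Longrightarrow> L (g x) = 0"
      by (rule smooth_approximation [OF \<eta>(1) K(1,3) \<Omega> K(2) \<delta>]) blast+
    have grade: "g x \<in> grade h" for x
      using L [OF bounded_linear_vec_nth] \<eta>(2) by (simp add: grade_def)
    have near_d: "norm (ext_deriv g x - ext_deriv \<eta> x) \<le> B * \<delta>" for x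
      by (rule B(2)) (auto simp: partial_deriv_def Basis_vec_def intro!: near')
    have dg: "Ck_on p (ext_deriv g) UNIV" for p
      using Ck_on_ext_deriv g by blast
    have dK': "ext_deriv g x = 0" if "x \<notin> K'" for x
      using ext_deriv_eq_0_if_supported [OF compact_imp_closed [OF K'(1)] K'(3) that] .
    have dK: "ext_deriv \<eta> x = 0" if "x \<notin> K" for x
      using ext_deriv_eq_0_if_supported [OF compact_imp_closed [OF K(1)] K(3) that] .
    have contg: "continuous_on UNIV g" "continuous_on UNIV (ext_deriv g)"
      using g [of 0] dg [of 0] by auto
    have "g \<in> test_forms h \<Omega>" "ext_deriv g \<in> test_forms (Suc h) \<Omega>"
      unfolding test_forms_def forms_supported_def
      using K' g grade dg dK' ext_deriv_in_grade [OF grade g] by blast+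
    then have eq: "(\<integral>x. \<tau>' x \<bullet> g x \<partial>\<mu>') = (\<integral>x. \<tau> x \<bullet> ext_deriv g x \<partial>\<mu>)"
      using T T' unfolding represented_by_def boundary_def by metis
    have "(\<integral>x. \<tau>' x \<bullet> g x \<partial>\<mu>') - (\<integral>x. \<tau>' x \<bullet> \<eta> x \<partial>\<mu>') = (\<integral>x. \<tau>' x \<bullet> (g x - \<eta> x) \<partial>\<mu>')"
      unfolding inner_diff_right
      by (rule Bochner_Integration.integral_diff [symmetric])
         (auto intro: inner [OF \<mu>(2) int(2)] contg cont K' K)
    moreover have "\<bar>\<integral>x. \<tau>' x \<bullet> (g x - \<eta> x) \<partial>\<mu>'\<bar> \<le> \<delta> * (\<integral>x. norm (\<tau>' x) \<partial>\<mu>')"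
      using near by (intro integrable_inner_bounded(2) int
          continuous_on_borel_measurable_finite_borel_measure [OF \<mu>(2)] continuous_intros contg cont)
    moreover have "(\<integral>x. \<tau> x \<bullet> ext_deriv g x \<partial>\<mu>) - (\<integral>x. \<tau> x \<bullet> ext_deriv \<eta> x \<partial>\<mu>)
        = (\<integral>x. \<tau> x \<bullet> (ext_deriv g x - ext_deriv \<eta> x) \<partial>\<mu>)"
      unfolding inner_diff_right
      by (rule Bochner_Integration.integral_diff [symmetric])
         (auto intro: inner [OF \<mu>(1) int(1)] contg cont K'(1) K(1) dK dK')
    moreover have "\<bar>\<integral>x. \<tau> x \<bullet> (ext_deriv g x - ext_deriv \<eta> x) \<partial>\<mu>\<bar> \<le> B * \<delta> * (\<integral>x. norm (\<tau> x) \<partial>\<mu>)"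
      using near_d by (intro integrable_inner_bounded(2) int
          continuous_on_borel_measurable_finite_borel_measure [OF \<mu>(1)] continuous_intros contg cont)
    ultimately show ?thesis
      unfolding M_def eq by (simp add: algebra_simps abs_le_iff)
  qed
  then have "\<bar>(\<integral>x. \<tau>' x \<bullet> \<eta> x \<partial>\<mu>') - (\<integral>x. \<tau> x \<bullet> ext_deriv \<eta> x \<partial>\<mu>)\<bar> \<le> 0 + e" if "e > 0" for e
  proof -
    have M: "M \<ge> 0" using B(1) by (simp add: M_def)
    have "e / (M + 1) * M \<le> e"
      using that M by (simp add: field_simps)
    then show ?thesis
      using \<open>\<And>\<delta>. \<delta> > 0 \<Longrightarrow> _ \<le> \<delta> * M\<close> [of "e / (M + 1)"] that M by simp
  qed
  then have "\<bar>(\<integral>x. \<tau>' x \<bullet> \<eta> x \<partial>\<mu>') - (\<integral>x. \<tau> x \<bullet> ext_deriv \<eta> x \<partial>\<mu>)\<bar> \<le> 0"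
    by (rule field_le_epsilon)
  then show ?thesis by simp
qed

section \<open>Cutoff functions\<close>

text \<open>
  A smooth bump on the ball of radius \<open>r\<close> with values in \<open>[0, 1]\<close>, which is bounded below on the ball of
  half the radius and has a gradient of order \<open>1/r\<close>.
\<close>

definition cutoff :: "'a::real_inner \<Rightarrow> real \<Rightarrow> 'a \<Rightarrow> real"
  where "cutoff x r y = flat_exp 0 (1 - (y - x) \<bullet> (y - x) / r\<^sup>2)"

definition cutoff_gradient :: "'a::real_inner \<Rightarrow> real \<Rightarrow> 'a \<Rightarrow> 'a"
  where "cutoff_gradient x r y =
    (- 2 * flat_exp 2 (1 - (y - x) \<bullet> (y - x) / r\<^sup>2) / r\<^sup>2) *\<^sub>R (y - x)"

lemma continuous_on_flat_exp: "continuous_on A (flat_exp m)"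
  using has_real_derivative_flat_exp
  by (intro continuous_at_imp_continuous_on) (auto intro: DERIV_isCont)

lemma continuous_on_cutoff: "r > 0 \<Longrightarrow> continuous_on A (cutoff x r)"
  unfolding cutoff_def [abs_def]
  by (intro continuous_on_compose2 [OF continuous_on_flat_exp [of UNIV]] continuous_intros) auto

lemma continuous_on_cutoff_gradient: "r > 0 \<Longrightarrow> continuous_on A (cutoff_gradient x r)"
  unfolding cutoff_gradient_def [abs_def]
  by (intro continuous_on_compose2 [OF continuous_on_flat_exp [of UNIV]] continuous_intros) auto

lemma has_derivative_cutoff:
  assumes "r > 0"
  shows "(cutoff x r has_derivative (\<lambda>v. cutoff_gradient x r y \<bullet> v)) (at y)"
proof -
  have "((\<lambda>y. 1 - (y - x) \<bullet> (y - x) / r\<^sup>2) has_derivative (\<lambda>v. - 2 * ((y - x) \<bullet> v) / r\<^sup>2)) (at y)"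
    using assms by (auto intro!: derivative_eq_intros simp: inner_commute field_simps)
  from has_derivative_compose [where g = "flat_exp 0", OF this
      has_real_derivative_flat_exp [of 0 "1 - (y - x) \<bullet> (y - x) / r\<^sup>2", unfolded has_field_derivative_def]]
  have "((\<lambda>y. flat_exp 0 (1 - (y - x) \<bullet> (y - x) / r\<^sup>2)) has_derivative
      (\<lambda>v. flat_exp 2 (1 - (y - x) \<bullet> (y - x) / r\<^sup>2) * (- 2 * ((y - x) \<bullet> v) / r\<^sup>2))) (at y)"
    by (simp add: numeral_2_eq_2)
  then show ?thesis
    unfolding cutoff_def [abs_def]
    by (rule has_derivative_eq_rhs) (simp add: cutoff_gradient_def fun_eq_iff mult_ac)
qed

lemma cutoff_nonneg: "0 \<le> cutoff x r y" and cutoff_le_1: "cutoff x r y \<le> 1"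
  by (auto simp: cutoff_def flat_exp_def)

lemma cutoff_outside_ball:
  assumes "r > 0" and "y \<notin> ball x r"
  shows "cutoff x r y = 0" and "cutoff_gradient x r y = 0"
proof -
  have "r\<^sup>2 \<le> (norm (y - x))\<^sup>2"
    using assms by (intro power_mono) (auto simp: dist_norm norm_minus_commute)
  then have "1 \<le> (y - x) \<bullet> (y - x) / r\<^sup>2"
    using assms(1) by (simp add: power2_norm_eq_inner)
  then show "cutoff x r y = 0" "cutoff_gradient x r y = 0"
    by (simp_all add: cutoff_def cutoff_gradient_def flat_exp_def)
qed

lemma cutoff_half_ball:
  assumes "r > 0" and "y \<in> ball x (r / 2)"
  shows "exp (- 4 / 3) \<le> cutoff x r y"
proof -
  have "(norm (y - x))\<^sup>2 \<le> (r / 2)\<^sup>2"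
    using assms by (intro power_mono) (auto simp: dist_norm norm_minus_commute)
  then have "(y - x) \<bullet> (y - x) / r\<^sup>2 \<le> 1 / 4"
    using assms(1) by (simp add: power2_norm_eq_inner field_simps)
  \<comment> \<open>\<open>t \<mapsto> exp (- 1 / t)\<close> is increasing, and \<open>t = 3 / 4\<close> is its argument on the boundary of the half ball.\<close>
  define t where "t = 1 - (y - x) \<bullet> (y - x) / r\<^sup>2"
  have "t \<ge> 3 / 4"
    using \<open>(y - x) \<bullet> (y - x) / r\<^sup>2 \<le> 1 / 4\<close> by (simp add: t_def)
  moreover from this have "- 4 / 3 \<le> - 1 / t"
    by (simp add: field_simps)
  ultimately show ?thesis
    by (simp add: cutoff_def flat_exp_def flip: t_def)
qed

lemma norm_cutoff_gradient_le:
  assumes "r > 0"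
  shows "norm (cutoff_gradient x r y) \<le> 4 / r"
proof (cases "y \<in> ball x r")
  case True
  have flat: "flat_exp 2 t \<le> 2" for t
  proof (cases "t > 0")
    case True
    have "(1 / t)\<^sup>2 / 2 \<le> exp (1 / t)"
      using exp_lower_Taylor_quadratic [of "1 / t"] True divide_pos_pos [of 1 t] by linarith
    then show ?thesis
      using True by (simp add: flat_exp_def exp_minus field_simps)
  qed (simp add: flat_exp_def)
  let ?t = "1 - (y - x) \<bullet> (y - x) / r\<^sup>2"
  have "norm (cutoff_gradient x r y) = 2 * flat_exp 2 ?t / r\<^sup>2 * norm (y - x)"
    by (simp add: cutoff_gradient_def flat_exp_def)
  also have "\<dots> \<le> 2 * 2 / r\<^sup>2 * r"
    using True assms flat [of ?t]
    by (intro mult_mono divide_right_mono mult_left_mono)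
       (auto simp: dist_norm norm_minus_commute flat_exp_def)
  also have "\<dots> = 4 / r" by (simp add: power2_eq_square)
  finally show ?thesis .
next
  case False
  then show ?thesis using cutoff_outside_ball(2) [OF assms False] assms by simp
qed

lemma continuous_on_cutoff_scaleR:
  fixes f :: "'a::real_inner \<Rightarrow> 'b::real_normed_vector"
  assumes "continuous_on U f" and "open U" and "cball x r \<subseteq> U" and "r > 0"
  shows "continuous_on UNIV (\<lambda>y. cutoff x r y *\<^sub>R f y)"
proof -
  have "continuous_on (U \<union> - cball x r) (\<lambda>y. cutoff x r y *\<^sub>R f y)"
  proof (rule continuous_on_open_Un)
    show "continuous_on U (\<lambda>y. cutoff x r y *\<^sub>R f y)"
      by (intro continuous_on_scaleR continuous_on_cutoff assms)
    have "continuous_on (- cball x r) (\<lambda>y. 0 :: 'b)" by simp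
    then show "continuous_on (- cball x r) (\<lambda>y. cutoff x r y *\<^sub>R f y)"
    proof (rule continuous_on_eq)
      fix y assume "y \<in> - cball x r"
      then have "y \<notin> ball x r" by auto
      then show "0 = cutoff x r y *\<^sub>R f y"
        by (simp add: cutoff_outside_ball(1) [OF \<open>r > 0\<close>])
    qed
  qed (use assms in auto)
  moreover have "U \<union> - cball x r = UNIV" using assms(3) by auto
  ultimately show ?thesis by simp
qed

text \<open>
  The function \<open>f\<close> is arbitrary outside \<open>U\<close>, where the cutoff vanishes; hence \<open>\<eta>\<close> needs no case distinction.
\<close>

lemma cutoff_times_C1:
  assumes f: "Ck_on 1 f U" and U: "open U" "cball x r \<subseteq> U" and "r > 0"
  defines "\<eta> \<equiv> \<lambda>y. cutoff x r y *\<^sub>R f y"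
  shows "Ck_on 1 \<eta> UNIV"
    and "\<And>y. y \<in> U \<Longrightarrow> frechet_derivative \<eta> (at y) v
      = cutoff x r y *\<^sub>R frechet_derivative f (at y) v + (cutoff_gradient x r y \<bullet> v) *\<^sub>R f y"
proof -
  have der: "(\<eta> has_derivative (\<lambda>v. cutoff x r y *\<^sub>R frechet_derivative f (at y) v
      + (cutoff_gradient x r y \<bullet> v) *\<^sub>R f y)) (at y)" if "y \<in> U" for y
    unfolding \<eta>_def
    using has_derivative_scaleR [OF has_derivative_cutoff [OF \<open>r > 0\<close>] Ck_on_1_has_derivative [OF f that]] .
  then show eq: "frechet_derivative \<eta> (at y) v
      = cutoff x r y *\<^sub>R frechet_derivative f (at y) v + (cutoff_gradient x r y \<bullet> v) *\<^sub>R f y"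
    if "y \<in> U" for y v
    using frechet_derivative_at [OF der [OF that]] by metis
  have off: "\<eta> y = 0" if "y \<notin> cball x r" for y
    using cutoff_outside_ball(1) [OF \<open>r > 0\<close>, of y x] that by (simp add: \<eta>_def)
  have der0: "(\<eta> has_derivative (\<lambda>v. 0)) (at y)" if "y \<notin> cball x r" for y
  proof -
    have "((\<lambda>_. 0) has_derivative (\<lambda>v. 0)) (at y)" by simp
    then show ?thesis
      by (rule has_derivative_transform_within_open [where s = "- cball x r"])
         (use that off in auto)
  qed
  have "\<eta> differentiable (at y)" for y
    using der [of y] der0 [of y] U(2) unfolding differentiable_def by blast
  moreover have "continuous_on UNIV (\<lambda>y. frechet_derivative \<eta> (at y) v)" for v
  proof -
    have "continuous_on (U \<union> - cball x r) (\<lambda>y. frechet_derivative \<eta> (at y) v)"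
    proof (rule continuous_on_open_Un)
      have "continuous_on U (\<lambda>y. cutoff x r y *\<^sub>R frechet_derivative f (at y) v
          + (cutoff_gradient x r y \<bullet> v) *\<^sub>R f y)"
        using f \<open>r > 0\<close> Ck_on_1_continuous [OF f]
        by (intro continuous_intros continuous_on_cutoff continuous_on_cutoff_gradient) auto
      then show "continuous_on U (\<lambda>y. frechet_derivative \<eta> (at y) v)"
        by (rule continuous_on_eq) (simp add: eq)
      have "continuous_on (- cball x r) (\<lambda>y. 0 :: 'b)" by simp
      then show "continuous_on (- cball x r) (\<lambda>y. frechet_derivative \<eta> (at y) v)"
        by (rule continuous_on_eq)
           (use frechet_derivative_at [OF der0] in \<open>auto simp: fun_eq_iff\<close>)
    qed (use U in auto)
    moreover have "U \<union> - cball x r = UNIV" using U(2) by auto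
    ultimately show ?thesis by simp
  qed
  ultimately show "Ck_on 1 \<eta> UNIV" by simp
qed

section \<open>Total variation and blow-up\<close>

lemma measure_total_variation:
  fixes \<tau> :: "'a \<Rightarrow> 'b::euclidean_space"
  assumes "integrable M \<tau>" and "A \<in> sets M"
  shows "measure (total_variation \<tau> M) A = (\<integral>y. indicator A y * norm (\<tau> y) \<partial>M)"
proof -
  have [measurable]: "\<tau> \<in> borel_measurable M" and int: "integrable M (\<lambda>y. indicator A y * norm (\<tau> y))"
    using assms integrable_mult_indicator [OF assms(2) Bochner_Integration.integrable_norm [OF assms(1)]] by auto
  have "emeasure (total_variation \<tau> M) A = (\<integral>\<^sup>+y. ennreal (indicator A y * norm (\<tau> y)) \<partial>M)"
    unfolding total_variation_def using assms(2)
    by (subst emeasure_density) (auto intro!: nn_integral_cong simp: indicator_def)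
  also have "\<dots> = ennreal (\<integral>y. indicator A y * norm (\<tau> y) \<partial>M)"
    by (rule nn_integral_eq_integral [OF int]) auto
  finally show ?thesis by (simp add: measure_def)
qed

lemma total_variation_bound:
  fixes \<tau> F :: "'a \<Rightarrow> 'b::euclidean_space"
  assumes \<tau>: "integrable M \<tau>" and F: "F \<in> borel_measurable M" and A: "A \<in> sets M"
    and le: "\<And>y. y \<in> space M \<Longrightarrow> \<bar>\<tau> y \<bullet> F y\<bar> \<le> C * (indicator A y * norm (\<tau> y))"
  shows "\<bar>\<integral>y. \<tau> y \<bullet> F y \<partial>M\<bar> \<le> C * measure (total_variation \<tau> M) A"
proof -
  have int: "integrable M (\<lambda>y. C * (indicator A y * norm (\<tau> y)))"
    using integrable_mult_indicator [OF A Bochner_Integration.integrable_norm [OF \<tau>]] by auto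
  have "integrable M (\<lambda>y. \<tau> y \<bullet> F y)"
  proof (rule Bochner_Integration.integrable_bound [OF int])
    show "AE y in M. norm (\<tau> y \<bullet> F y) \<le> norm (C * (indicator A y * norm (\<tau> y)))"
      using le by (intro AE_I2) (auto intro: order_trans [OF _ abs_ge_self])
  qed (intro borel_measurable_inner borel_measurable_integrable [OF \<tau>] F)
  then have "\<bar>\<integral>y. \<tau> y \<bullet> F y \<partial>M\<bar> \<le> (\<integral>y. C * (indicator A y * norm (\<tau> y)) \<partial>M)"
    by (intro order_trans [OF integral_abs_bound] integral_mono int le) auto
  then show ?thesis
    by (simp add: measure_total_variation [OF \<tau> A])
qed

text \<open>
  For a unit vector \<open>e\<close>, the square of the left-hand side is \<open>2 |t| (|t| - t \<bullet> e)\<close>. The inequality between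
  the arithmetic and the geometric mean makes it linear, so that it can be integrated: if \<open>t \<bullet> e\<close> agrees
  with \<open>|t|\<close> on average, then \<open>t\<close> is close to \<open>|t| e\<close> on average.
\<close>

lemma norm_minus_norm_scaleR_le:
  fixes t e :: "'a::real_inner"
  assumes "norm e = 1" and "\<delta> > 0"
  shows "norm (t - norm t *\<^sub>R e) \<le> \<delta> * norm t + (norm t - t \<bullet> e) / (2 * \<delta>)"
proof (rule power2_le_imp_le)
  have e: "e \<bullet> e = 1" using assms(1) by (simp add: norm_eq_1)
  have b: "0 \<le> norm t - t \<bullet> e"
    using norm_cauchy_schwarz [of t e] assms(1) by simp
  have "(norm (t - norm t *\<^sub>R e))\<^sup>2 = 2 * norm t * (norm t - t \<bullet> e)"
    by (simp add: power2_norm_eq_inner inner_diff_left inner_diff_right e inner_commute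
      algebra_simps flip: power2_eq_square)
  also have "\<dots> = 4 * (\<delta> * norm t) * ((norm t - t \<bullet> e) / (2 * \<delta>))"
    using assms(2) by simp
  also have "\<dots> \<le> (\<delta> * norm t + (norm t - t \<bullet> e) / (2 * \<delta>))\<^sup>2"
  proof -
    have "4 * p * q \<le> (p + q)\<^sup>2" for p q :: real
      using zero_le_power2 [of "p - q"] by (simp add: power2_eq_square algebra_simps)
    then show ?thesis .
  qed
  finally show "(norm (t - norm t *\<^sub>R e))\<^sup>2 \<le> (\<delta> * norm t + (norm t - t \<bullet> e) / (2 * \<delta>))\<^sup>2" .
  show "0 \<le> \<delta> * norm t + (norm t - t \<bullet> e) / (2 * \<delta>)"
    using b assms(2) by simp
qed

lemma density_bounds_imp_bigo:
  fixes m :: "real \<Rightarrow> real" and s :: real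
  defines "q \<equiv> \<lambda>r. ereal (m r / (2 * r) powr s)"
  assumes pos: "0 < Liminf (at_right 0) q" and fin: "Limsup (at_right 0) q < \<infinity>"
  shows "m \<in> O[at_right 0](\<lambda>r. r powr s)" and "(\<lambda>r. r powr s) \<in> O[at_right 0](m)"
proof -
  obtain c where c: "0 < ereal c" "ereal c < Liminf (at_right 0) q"
    using ereal_dense2 [OF pos] by blast
  have lower: "\<forall>\<^sub>F r in at_right 0. ereal c < q r"
    using less_LiminfD [OF c(2)] .
  obtain C where C: "Limsup (at_right 0) q < ereal C"
    using fin less_PInf_Ex_of_nat by (metis ereal_dense2)
  have upper: "\<forall>\<^sub>F r in at_right 0. q r < ereal C"
    using Limsup_lessD [OF C] .
  have pow: "(2 * r) powr s = 2 powr s * r powr s" if "r > 0" for r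
    using that by (simp add: powr_mult)
  show "m \<in> O[at_right 0](\<lambda>r. r powr s)"
  proof (rule bigoI)
    show "\<forall>\<^sub>F r in at_right 0. norm (m r) \<le> (C * 2 powr s) * norm (r powr s)"
      using lower upper eventually_at_right_less
    proof eventually_elim
      case (elim r)
      then have "c < m r / (2 powr s * r powr s)" "m r / (2 powr s * r powr s) < C"
        by (simp_all add: q_def pow)
      then show ?case
        using c(1) elim(3) by (auto simp: field_simps abs_if intro: less_imp_le)
          (smt (verit) mult_pos_pos powr_gt_zero)
    qed
  qed
  show "(\<lambda>r. r powr s) \<in> O[at_right 0](m)"
  proof (rule bigoI)
    show "\<forall>\<^sub>F r in at_right 0. norm (r powr s) \<le> (1 / (c * 2 powr s)) * norm (m r)"
      using lower eventually_at_right_less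
    proof eventually_elim
      case (elim r)
      then have "c < m r / (2 powr s * r powr s)"
        by (simp add: q_def pow)
      then have "c * 2 powr s * r powr s < m r"
        using elim(2) by (simp add: field_simps)
      then have "r powr s \<le> m r / (c * 2 powr s)"
        using c(1) by (simp add: field_simps)
      also have "\<dots> \<le> \<bar>m r\<bar> / (c * 2 powr s)"
        using c(1) by (intro divide_right_mono) auto
      finally show ?case by simp
    qed
  qed
qed

lemma eventually_ball_subset:
  fixes x :: "'a::metric_space"
  assumes "open U" and "x \<in> U"
  shows "\<forall>\<^sub>F r in at_right (0 :: real). r > 0 \<and> cball x r \<subseteq> U"
proof -
  obtain R where R: "R > 0" "cball x R \<subseteq> U"
    using assms open_contains_cball by blast
  show ?thesis
    using eventually_at_right_real [OF R(1)]
    by eventually_elim (use R(2) subset_cball in fastforce)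
qed

text \<open>
  The assumptions do not make \<open>x\<close> a Lebesgue point of \<open>\<tau>\<close> in the strong sense that the averages of
  \<open>|\<tau> - \<tau>(x)|\<close> tend to \<open>0\<close>, as \<open>|\<tau>|\<close> may oscillate. They do force the direction of \<open>\<tau>\<close> to converge: with
  \<open>e = \<tau>(x) / |\<tau>(x)|\<close>, the averages of \<open>|\<tau> - |\<tau>| e|\<close> tend to \<open>0\<close>. So \<open>\<tau>\<close> may be replaced by \<open>|\<tau>| e\<close> and
  \<open>f\<close> by \<open>f(x)\<close>, and the integral of \<open>cutoff * |\<tau>|\<close> is not \<open>o(r\<^sup>s)\<close>.
\<close>

lemma tangent_average_eq_0:
  fixes \<tau> f :: "'n::finite form" and x :: "'n euc"
  assumes \<mu>: "finite_borel_measure_on \<Omega> \<mu>" and \<tau>: "integrable \<mu> \<tau>"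
    and U: "open U" "x \<in> U" "U \<subseteq> \<Omega>" and f: "continuous_on U f"
    and pos: "\<And>r. r > 0 \<Longrightarrow> measure \<mu> (ball x r \<inter> \<Omega>) > 0"
    and avg: "((\<lambda>r. (LINT y:ball x r \<inter> \<Omega>|\<mu>. \<tau> y) /\<^sub>R measure \<mu> (ball x r \<inter> \<Omega>)) \<longlongrightarrow> \<tau> x) (at_right 0)"
    and avg_norm: "((\<lambda>r. (LINT y:ball x r \<inter> \<Omega>|\<mu>. norm (\<tau> y)) / measure \<mu> (ball x r \<inter> \<Omega>)) \<longlongrightarrow> norm (\<tau> x)) (at_right 0)"
    and nz: "\<tau> x \<noteq> 0"
    and dens: "(\<lambda>r. measure \<mu> (ball x r \<inter> \<Omega>)) \<in> O[at_right 0](\<lambda>r. r powr s)"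
      "(\<lambda>r. r powr s) \<in> O[at_right 0](\<lambda>r. measure \<mu> (ball x r \<inter> \<Omega>))"
    and small: "(\<lambda>r. \<integral>y. cutoff x r y * (\<tau> y \<bullet> f y) \<partial>\<mu>) \<in> o[at_right 0](\<lambda>r. r powr s)"
  shows "\<tau> x \<bullet> f x = 0"
proof -
  define m where "m r = measure \<mu> (ball x r \<inter> \<Omega>)" for r
  define V where "V r = measure (total_variation \<tau> \<mu>) (ball x r \<inter> \<Omega>)" for r
  define A where "A r = (\<integral>y. cutoff x r y * norm (\<tau> y) \<partial>\<mu>)" for r
  define e where "e = \<tau> x /\<^sub>R norm (\<tau> x)"
  \<comment> \<open>The average defect of \<open>\<tau>\<close> from pointing in the direction \<open>e\<close>; its integrand is nonnegative.\<close>
  define D where "D r = (\<integral>y. indicator (ball x r \<inter> \<Omega>) y * (norm (\<tau> y) - \<tau> y \<bullet> e) \<partial>\<mu>)" for r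
  have e: "norm e = 1" using nz by (simp add: e_def)
  have space: "space \<mu> = \<Omega>" using \<mu> by (rule space_finite_borel_measure_on)
  have B: "ball x r \<inter> \<Omega> \<in> sets \<mu>" for r
    using \<mu> by (auto simp: finite_borel_measure_on_def sets_restrict_space)
  have cutoff_meas [measurable]: "cutoff x r \<in> borel_measurable \<mu>" if "r > 0" for r
    by (intro continuous_on_borel_measurable_finite_borel_measure [OF \<mu>] continuous_on_cutoff that)
  have [measurable]: "\<tau> \<in> borel_measurable \<mu>" using \<tau> by auto
  have V: "V r = (\<integral>y. indicator (ball x r \<inter> \<Omega>) y * norm (\<tau> y) \<partial>\<mu>)" for r
    unfolding V_def by (rule measure_total_variation [OF \<tau> B])
  have V_nonneg: "V r \<ge> 0" for r by (simp add: V_def)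
  have int_ind: "integrable \<mu> (\<lambda>y. indicator (ball x r \<inter> \<Omega>) y * norm (\<tau> y))"
    "integrable \<mu> (\<lambda>y. indicator (ball x r \<inter> \<Omega>) y *\<^sub>R \<tau> y)" for r
    using integrable_mult_indicator [OF B Bochner_Integration.integrable_norm [OF \<tau>]]
      integrable_mult_indicator [OF B \<tau>] by auto
  have int_e: "integrable \<mu> (\<lambda>y. indicator (ball x r \<inter> \<Omega>) y * (\<tau> y \<bullet> e))"
    "(\<integral>y. indicator (ball x r \<inter> \<Omega>) y * (\<tau> y \<bullet> e) \<partial>\<mu>) = (LINT y:ball x r \<inter> \<Omega>|\<mu>. \<tau> y) \<bullet> e" for r
    using integrable_inner_left [of e, OF int_ind(2) [of r]] integral_inner_left [of e, OF int_ind(2) [of r]]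
    by (simp_all add: set_lebesgue_integral_def)
  have int_cut: "integrable \<mu> (\<lambda>y. cutoff x r y * norm (\<tau> y))" if "r > 0" for r
  proof (rule Bochner_Integration.integrable_bound [OF \<tau>])
    show "AE y in \<mu>. norm (cutoff x r y * norm (\<tau> y)) \<le> norm (\<tau> y)"
      using cutoff_nonneg [of x r] cutoff_le_1 [of x r]
      by (intro AE_I2) (simp add: abs_mult mult_left_le_one_le)
  qed (use that in measurable)

  have D_eq: "D r = V r - (LINT y:ball x r \<inter> \<Omega>|\<mu>. \<tau> y) \<bullet> e" for r
  proof -
    have "D r = (\<integral>y. indicator (ball x r \<inter> \<Omega>) y * norm (\<tau> y)
        - indicator (ball x r \<inter> \<Omega>) y * (\<tau> y \<bullet> e) \<partial>\<mu>)"
      unfolding D_def by (simp add: algebra_simps)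
    also have "\<dots> = V r - (LINT y:ball x r \<inter> \<Omega>|\<mu>. \<tau> y) \<bullet> e"
      unfolding V int_e(2) [symmetric]
      by (rule Bochner_Integration.integral_diff [OF int_ind(1) int_e(1)])
    finally show ?thesis .
  qed
  have "((\<lambda>r. V r / m r) \<longlongrightarrow> norm (\<tau> x)) (at_right 0)"
    using avg_norm by (simp add: V m_def set_lebesgue_integral_def)
  moreover have m_nz: "\<forall>\<^sub>F r in at_right 0. m r \<noteq> 0"
    using eventually_at_right_less
  proof eventually_elim
    case (elim r)
    then show ?case using pos [of r] by (simp add: m_def)
  qed
  ultimately have Vm: "V \<in> O[at_right 0](m)" and "V \<in> \<Omega>[at_right 0](m)"
    using bigomegaI_tendsto [of "norm (\<tau> x)" V m "at_right 0"] nz by (auto intro: bigoI_tendsto)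
  then have mV: "m \<in> O[at_right 0](V)"
    by (simp only: bigomega_iff_bigo)
  have Vs: "V \<in> O[at_right 0](\<lambda>r. r powr s)"
    using landau_o.big_trans [OF Vm] dens(1) by (simp add: m_def [abs_def])
  have sV: "(\<lambda>r. r powr s) \<in> O[at_right 0](V)"
    using landau_o.big_trans [OF _ mV] dens(2) by (simp add: m_def [abs_def])
  have Dm: "D \<in> o[at_right 0](m)"
  proof (rule smalloI_tendsto [OF _ m_nz])
    have "((\<lambda>r. V r / m r - ((LINT y:ball x r \<inter> \<Omega>|\<mu>. \<tau> y) /\<^sub>R m r) \<bullet> e)
        \<longlongrightarrow> norm (\<tau> x) - \<tau> x \<bullet> e) (at_right 0)"
      using avg \<open>((\<lambda>r. V r / m r) \<longlongrightarrow> norm (\<tau> x)) (at_right 0)\<close>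
      by (intro tendsto_intros) (auto simp: m_def)
    moreover have "\<tau> x \<bullet> e = norm (\<tau> x)"
      using nz by (simp add: e_def dot_square_norm power2_eq_square)
    ultimately show "((\<lambda>r. D r / m r) \<longlongrightarrow> 0) (at_right 0)"
      by (simp add: D_eq divide_inverse algebra_simps)
  qed
  have DV: "D \<in> o[at_right 0](V)"
    by (rule landau_o.small_big_trans [OF Dm mV])

  \<comment> \<open>\<open>X1\<close> and \<open>X2\<close> are the costs of replacing \<open>\<tau>\<close> by \<open>norm \<tau> *\<^sub>R e\<close> and \<open>f\<close> by \<open>f x\<close>.\<close>
  define X1 where "X1 r = (\<integral>y. cutoff x r y * (\<tau> y \<bullet> f x) \<partial>\<mu>) - (e \<bullet> f x) * A r" for r
  define X2 where "X2 r = (\<integral>y. cutoff x r y * (\<tau> y \<bullet> f y) \<partial>\<mu>) - (\<integral>y. cutoff x r y * (\<tau> y \<bullet> f x) \<partial>\<mu>)" for r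
  have X1_le: "\<bar>X1 r\<bar> \<le> norm (f x) * (\<delta> * V r + D r / (2 * \<delta>))" if "r > 0" "\<delta> > 0" for r \<delta>
  proof -
    let ?g = "\<lambda>y. cutoff x r y * (\<tau> y \<bullet> f x) - (e \<bullet> f x) * (cutoff x r y * norm (\<tau> y))"
    let ?h = "\<lambda>y. norm (f x) * (\<delta> * (indicator (ball x r \<inter> \<Omega>) y * norm (\<tau> y))
        + (indicator (ball x r \<inter> \<Omega>) y * norm (\<tau> y) - indicator (ball x r \<inter> \<Omega>) y * (\<tau> y \<bullet> e)) / (2 * \<delta>))"
    have int1: "integrable \<mu> (\<lambda>y. cutoff x r y * (\<tau> y \<bullet> f x))"
    proof (rule Bochner_Integration.integrable_bound [OF integrable_inner_left [OF \<tau>, of "f x"]])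
      show "AE y in \<mu>. norm (cutoff x r y * (\<tau> y \<bullet> f x)) \<le> norm (\<tau> y \<bullet> f x)"
        using cutoff_nonneg [of x r] cutoff_le_1 [of x r]
        by (intro AE_I2) (simp add: abs_mult mult_left_le_one_le)
    qed (use that in measurable)
    have int: "integrable \<mu> ?g" "integrable \<mu> ?h"
      using int1 int_cut [OF that(1)] int_ind(1) [of r] int_e(1) [of r] by auto
    have "X1 r = (\<integral>y. ?g y \<partial>\<mu>)"
      unfolding X1_def A_def using int1 int_cut [OF that(1)] by simp
    also have "\<bar>\<dots>\<bar> \<le> (\<integral>y. ?h y \<partial>\<mu>)"
    proof (intro order_trans [OF integral_abs_bound] integral_mono)
      fix y assume "y \<in> space \<mu>"
      show "\<bar>?g y\<bar> \<le> ?h y"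
      proof (cases "y \<in> ball x r")
        case True
        have "?g y = cutoff x r y * ((\<tau> y - norm (\<tau> y) *\<^sub>R e) \<bullet> f x)"
          by (simp add: algebra_simps inner_diff_left)
        also have "\<bar>\<dots>\<bar> \<le> \<bar>(\<tau> y - norm (\<tau> y) *\<^sub>R e) \<bullet> f x\<bar>"
          using cutoff_nonneg [of x r y] cutoff_le_1 [of x r y]
          by (simp add: abs_mult mult_left_le_one_le)
        also have "\<dots> \<le> norm (\<tau> y - norm (\<tau> y) *\<^sub>R e) * norm (f x)"
          by (rule Cauchy_Schwarz_ineq2)
        also have "\<dots> \<le> (\<delta> * norm (\<tau> y) + (norm (\<tau> y) - \<tau> y \<bullet> e) / (2 * \<delta>)) * norm (f x)"
          by (intro mult_right_mono norm_minus_norm_scaleR_le e that) simp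
        finally show ?thesis
          using True \<open>y \<in> space \<mu>\<close> by (simp add: space mult.commute)
      next
        case False
        then show ?thesis
          using cutoff_outside_ball(1) [OF that(1) False] by simp
      qed
    qed (use int in auto)
    also have "(\<integral>y. ?h y \<partial>\<mu>) = norm (f x) * (\<delta> * V r + D r / (2 * \<delta>))"
      unfolding D_eq V int_e(2) [symmetric] using int_ind(1) [of r] int_e(1) [of r] by simp
    finally show ?thesis .
  qed
  have X1: "X1 \<in> o[at_right 0](V)"
  proof (rule landau_o.smallI)
    fix c :: real assume "c > 0"
    define K where "K = norm (f x) + 1"
    have K: "K > 0" "norm (f x) \<le> K" by (auto simp: K_def add_nonneg_pos)
    \<comment> \<open>Once \<open>D r \<le> 2 \<delta>\<^sup>2 V r\<close>, the bound for \<open>X1 r\<close> is at most \<open>2 \<delta> K V r = c V r\<close>.\<close>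
    define \<delta> where "\<delta> = c / (2 * K)"
    have \<delta>: "\<delta> > 0" using \<open>c > 0\<close> K by (simp add: \<delta>_def)
    have "\<forall>\<^sub>F r in at_right 0. norm (D r) \<le> 2 * \<delta>\<^sup>2 * norm (V r)"
      using \<delta> by (intro landau_o.smallD [OF DV]) simp
    then show "\<forall>\<^sub>F r in at_right 0. norm (X1 r) \<le> c * norm (V r)"
      using eventually_at_right_less
    proof eventually_elim
      case (elim r)
      then have "D r \<le> 2 * \<delta>\<^sup>2 * V r"
        using V_nonneg [of r] by simp
      then have "D r / (2 * \<delta>) \<le> \<delta> * V r"
        using \<delta> by (simp add: field_simps power2_eq_square)
      then have "norm (f x) * (\<delta> * V r + D r / (2 * \<delta>)) \<le> norm (f x) * (2 * \<delta> * V r)"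
        by (intro mult_left_mono) auto
      also have "\<dots> \<le> K * (2 * \<delta> * V r)"
        using K \<delta> V_nonneg [of r] by (intro mult_right_mono) auto
      also have "\<dots> = c * V r" using K by (simp add: \<delta>_def)
      finally show ?case
        using X1_le [OF elim(2) \<delta>] V_nonneg [of r] by simp
    qed
  qed
  have X2: "X2 \<in> o[at_right 0](V)"
  proof (rule landau_o.smallI)
    fix c :: real assume "c > 0"
    have "continuous (at x within U) f"
      using f U(2) by (simp add: continuous_on_eq_continuous_within)
    then obtain d where d: "d > 0" "\<And>y. y \<in> U \<Longrightarrow> dist y x < d \<Longrightarrow> dist (f y) (f x) < c"
      using \<open>c > 0\<close> unfolding continuous_within_eps_delta by blast
    show "\<forall>\<^sub>F r in at_right 0. norm (X2 r) \<le> c * norm (V r)"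
      using eventually_ball_subset [OF U(1,2)] eventually_at_right_real [OF d(1)]
    proof eventually_elim
      case (elim r)
      then have r: "r > 0" "cball x r \<subseteq> U" "r < d" by auto
      let ?F = "\<lambda>y. cutoff x r y *\<^sub>R f y" and ?F' = "\<lambda>y. cutoff x r y *\<^sub>R f x"
      have cont: "continuous_on UNIV ?F" "continuous_on UNIV ?F'"
        by (intro continuous_on_cutoff_scaleR [OF f U(1) r(2,1)])
           (intro continuous_intros continuous_on_cutoff r)
      have supp: "?F y = 0" "?F' y = 0" if "y \<notin> cball x r" for y
      proof -
        have "y \<notin> ball x r" using that by auto
        then show "?F y = 0" "?F' y = 0"
          by (simp_all add: cutoff_outside_ball(1) [OF r(1)])
      qed
      have meas: "?F \<in> borel_measurable \<mu>" "?F' \<in> borel_measurable \<mu>"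
        by (intro continuous_on_borel_measurable_finite_borel_measure [OF \<mu>] cont)+
      obtain C where "\<And>y. norm (?F y) \<le> C"
        using bounded_if_supported [OF cont(1) compact_cball supp(1)] by blast
      then have int1: "integrable \<mu> (\<lambda>y. \<tau> y \<bullet> ?F y)"
        using integrable_inner_bounded(1) [OF \<tau> meas(1)] by blast
      obtain C where "\<And>y. norm (?F' y) \<le> C"
        using bounded_if_supported [OF cont(2) compact_cball supp(2)] by blast
      then have int2: "integrable \<mu> (\<lambda>y. \<tau> y \<bullet> ?F' y)"
        using integrable_inner_bounded(1) [OF \<tau> meas(2)] by blast
      have "X2 r = (\<integral>y. \<tau> y \<bullet> ?F y \<partial>\<mu>) - (\<integral>y. \<tau> y \<bullet> ?F' y \<partial>\<mu>)"
        by (simp add: X2_def)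
      also have "\<dots> = (\<integral>y. \<tau> y \<bullet> (?F y - ?F' y) \<partial>\<mu>)"
        unfolding inner_diff_right
        by (rule Bochner_Integration.integral_diff [OF int1 int2, symmetric])
      also have "\<bar>\<dots>\<bar> \<le> c * V r"
        unfolding V_def
      proof (rule total_variation_bound [OF \<tau> _ B])
        show "(\<lambda>y. ?F y - ?F' y) \<in> borel_measurable \<mu>"
          using meas by (rule borel_measurable_diff)
        fix y assume "y \<in> space \<mu>"
        show "\<bar>\<tau> y \<bullet> (?F y - ?F' y)\<bar> \<le> c * (indicator (ball x r \<inter> \<Omega>) y * norm (\<tau> y))"
        proof (cases "y \<in> ball x r")
          case True
          then have "y \<in> U" using r(2) by auto
          then have "norm (f y - f x) \<le> c"
            using d(2) [of y] True r(3) by (simp add: dist_commute flip: dist_norm)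
          have "\<bar>\<tau> y \<bullet> (?F y - ?F' y)\<bar> \<le> norm (\<tau> y) * norm (cutoff x r y *\<^sub>R (f y - f x))"
            unfolding scaleR_diff_right by (rule Cauchy_Schwarz_ineq2)
          also have "\<dots> \<le> norm (\<tau> y) * (1 * c)"
            unfolding norm_scaleR using cutoff_nonneg [of x r y] cutoff_le_1 [of x r y] \<open>norm (f y - f x) \<le> c\<close>
            by (intro mult_left_mono mult_mono) auto
          finally show ?thesis
            using True \<open>y \<in> space \<mu>\<close> by (simp add: space mult.commute)
        next
          case False
          then show ?thesis
            using cutoff_outside_ball(1) [OF r(1) False] by simp
        qed
      qed
      finally show ?case using V_nonneg [of r] by simp
    qed
  qed

  have "(\<lambda>r. (\<integral>y. cutoff x r y * (\<tau> y \<bullet> f y) \<partial>\<mu>) - X2 r - X1 r) \<in> o[at_right 0](\<lambda>r. r powr s)"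
    by (intro sum_in_smallo small landau_o.small_big_trans [OF X1 Vs] landau_o.small_big_trans [OF X2 Vs])
  then have eA: "(\<lambda>r. (e \<bullet> f x) * A r) \<in> o[at_right 0](\<lambda>r. r powr s)"
    by (simp add: X1_def X2_def)
  \<comment> \<open>The cutoff is bounded below only on the half ball, whose measure is comparable to that of the ball.\<close>
  have sA: "(\<lambda>r. r powr s) \<in> O[at_right 0](A)"
  proof -
    have half: "filterlim (\<lambda>r. r / 2) (at_right 0) (at_right (0 :: real))"
      unfolding filterlim_at
      by (auto intro!: tendsto_eq_intros eventually_at_right_less [THEN eventually_mono])
    have "(\<lambda>r. (r / 2) powr s) \<in> O[at_right 0](\<lambda>r. V (r / 2))"
      by (rule landau_o.big.compose [OF sV half])
    moreover have "(\<lambda>r. r powr s) \<in> O[at_right 0](\<lambda>r. (r / 2) powr s)"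
    proof (rule bigoI)
      show "\<forall>\<^sub>F r in at_right 0. norm (r powr s) \<le> 2 powr s * norm ((r / 2) powr s)"
        using eventually_at_right_less
        by eventually_elim (simp add: powr_divide)
    qed
    moreover have "(\<lambda>r. V (r / 2)) \<in> O[at_right 0](A)"
    proof (rule bigoI)
      show "\<forall>\<^sub>F r in at_right 0. norm (V (r / 2)) \<le> exp (4 / 3) * norm (A r)"
        using eventually_at_right_less
      proof eventually_elim
        case (elim r)
        have "exp (- 4 / 3) * V (r / 2)
            = (\<integral>y. exp (- 4 / 3) * (indicator (ball x (r / 2) \<inter> \<Omega>) y * norm (\<tau> y)) \<partial>\<mu>)"
          by (simp add: V)
        also have "\<dots> \<le> A r"
          unfolding A_def
        proof (rule integral_mono)
          show "integrable \<mu> (\<lambda>y. exp (- 4 / 3) * (indicator (ball x (r / 2) \<inter> \<Omega>) y * norm (\<tau> y)))"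
            using int_ind(1) [of "r / 2"] by simp
          show "integrable \<mu> (\<lambda>y. cutoff x r y * norm (\<tau> y))"
            by (rule int_cut [OF elim])
          fix y
          show "exp (- 4 / 3) * (indicator (ball x (r / 2) \<inter> \<Omega>) y * norm (\<tau> y)) \<le> cutoff x r y * norm (\<tau> y)"
            using cutoff_half_ball [OF elim, of y x] cutoff_nonneg [of x r y]
            by (cases "y \<in> ball x (r / 2) \<inter> \<Omega>") (auto intro: mult_right_mono)
        qed
        finally have "V (r / 2) \<le> exp (4 / 3) * A r"
          by (simp add: exp_minus field_simps)
        then show ?case
          using V_nonneg [of "r / 2"] by (smt (verit) exp_gt_zero mult_left_mono norm_ge_zero real_norm_def)
      qed
    qed
    ultimately show ?thesis
      using landau_o.big_trans by blast
  qed
  have "e \<bullet> f x = 0"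
  proof (rule ccontr)
    assume "e \<bullet> f x \<noteq> 0"
    then have "A \<in> o[at_right 0](\<lambda>r. r powr s)"
      using eA by simp
    then have "(\<lambda>r. r powr s) \<in> o[at_right 0](\<lambda>r. r powr s)"
      by (rule landau_o.big_small_trans [OF sA])
    then have "\<forall>\<^sub>F r in at_right (0 :: real). r powr s = 0"
      by (simp only: landau_o.small_refl_iff)
    then have "\<forall>\<^sub>F r in at_right (0 :: real). False"
      using eventually_at_right_less by eventually_elim simp
    then show False by simp
  qed
  then show ?thesis
    using nz by (simp add: e_def)
qed

section \<open>Tangency and the localised Stokes formula\<close>

lemma superdensity_set_imp_smallo:
  fixes x :: "'a::metric_space"
  assumes "x \<in> superdensity_set \<nu> 1 E"
  shows "(\<lambda>r. measure \<nu> (ball x r \<inter> space \<nu> - E) / r)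
    \<in> o[at_right 0](\<lambda>r. measure \<nu> (ball x r \<inter> space \<nu>))"
proof -
  obtain g where g: "g \<in> o[at_right 0](\<lambda>r :: real. r powr 1)"
    "\<forall>\<^sub>F r in at_right 0. measure \<nu> (ball x r \<inter> space \<nu> - E) = measure \<nu> (ball x r \<inter> space \<nu>) * g r"
    using assms unfolding superdensity_set_def by blast
  show ?thesis
  proof (rule landau_o.smallI)
    fix c :: real assume "c > 0"
    from landau_o.smallD [OF g(1) this] g(2) eventually_at_right_less
    show "\<forall>\<^sub>F r in at_right 0. norm (measure \<nu> (ball x r \<inter> space \<nu> - E) / r)
        \<le> c * norm (measure \<nu> (ball x r \<inter> space \<nu>))"
    proof eventually_elim
      case (elim r)
      then have "\<bar>g r\<bar> / r \<le> c" by (simp add: field_simps)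
      then have "measure \<nu> (ball x r \<inter> space \<nu>) * (\<bar>g r\<bar> / r) \<le> measure \<nu> (ball x r \<inter> space \<nu>) * c"
        by (rule mult_left_mono) simp
      then show ?case
        using elim by (simp add: abs_mult mult.commute)
    qed
  qed
qed

lemma tangency_set_iff:
  fixes \<tau> :: "'n::{finite,linorder} form"
  assumes \<omega>: "defining_forms p k D U \<omega>" and y: "y \<in> U" "y \<in> \<Omega>" and \<tau>: "\<tau> y \<in> grade h" "h \<noteq> 0"
  shows "y \<in> tangency_set h \<Omega> \<tau> D \<longleftrightarrow> (\<forall>j<CARD('n) - k. contract (to_vec (\<omega> j y)) (\<tau> y) = 0)"
proof -
  have "D y = (\<Inter>j<CARD('n) - k. {v. of_vec v \<bullet> \<omega> j y = 0})"
    using \<omega> y(1) unfolding defining_forms_def by blast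
  then have "mvec_span h (\<tau> y) \<subseteq> D y
      \<longleftrightarrow> (\<forall>j<CARD('n) - k. \<forall>v\<in>mvec_span h (\<tau> y). to_vec (\<omega> j y) \<bullet> v = 0)"
    by (auto simp: of_vec_inner inner_commute)
  then show ?thesis
    using y(2) by (simp add: tangency_set_def orthogonal_mvec_span_iff [OF \<tau>(2,1)])
qed

text \<open>
  Without measurability the assumptions on the measure of the complement of the tangency set would be void,
  since \<open>measure\<close> is \<open>0\<close> on nonmeasurable sets. Near a point, the tangency set is the common zero set of
  finitely many Borel functions.
\<close>

lemma tangency_set_measurable:
  fixes \<tau> :: "'n::{finite,linorder} form"
  assumes \<omega>: "defining_forms 1 k D U \<omega>" and \<mu>: "finite_borel_measure_on \<Omega> \<mu>"
    and \<tau>: "\<tau> \<in> borel_measurable \<mu>" "\<And>y. y \<in> \<Omega> \<Longrightarrow> \<tau> y \<in> grade h" and "h \<noteq> 0"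
    and B: "open B" "B \<subseteq> U"
  shows "B \<inter> \<Omega> - tangency_set h \<Omega> \<tau> D \<in> sets \<mu>"
proof -
  define a where "a j y = indicator B y *\<^sub>R to_vec (\<omega> j y)" for j y
  have space: "space \<mu> = \<Omega>"
    using \<mu> by (rule space_finite_borel_measure_on)
  have "linear (to_vec :: 'n mvec \<Rightarrow> _)"
    by (rule linearI) (simp_all add: to_vec_def vec_eq_iff)
  have a: "a j \<in> borel_measurable \<mu>" if "j < CARD('n) - k" for j
  proof -
    have "continuous_on B (\<omega> j)"
      using \<omega> that B(2) Ck_on_1_continuous continuous_on_subset unfolding defining_forms_def by blast
    then have "continuous_on B (\<lambda>y. to_vec (\<omega> j y))"
      by (rule continuous_on_compose2 [OF linear_continuous_on [OF linear_conv_bounded_linear [THEN iffD1, OF \<open>linear to_vec\<close>]]]) auto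
    then have "a j \<in> borel_measurable borel"
      unfolding a_def [abs_def] using B(1) by (intro borel_measurable_continuous_on_indicator) auto
    then show ?thesis
      by (intro measurable_on_finite_borel_measure [OF \<mu>] measurable_restrict_space1)
  qed
  have "(\<lambda>y. contract (a j y) (\<tau> y)) \<in> borel_measurable \<mu>" if "j < CARD('n) - k" for j
    by (rule borel_measurable_continuous_Pair [OF a [OF that] \<tau>(1)])
       (intro contract.continuous_on continuous_intros)
  then have "{y \<in> space \<mu>. \<exists>j\<in>{..<CARD('n) - k}. contract (a j y) (\<tau> y) \<noteq> 0} \<in> sets \<mu>"
    by measurable
  also have "{y \<in> space \<mu>. \<exists>j\<in>{..<CARD('n) - k}. contract (a j y) (\<tau> y) \<noteq> 0}
      = B \<inter> \<Omega> - tangency_set h \<Omega> \<tau> D"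
  proof -
    have "y \<in> tangency_set h \<Omega> \<tau> D \<longleftrightarrow> (\<forall>j<CARD('n) - k. contract (a j y) (\<tau> y) = 0)"
      if "y \<in> B" "y \<in> \<Omega>" for y
      using tangency_set_iff [where \<tau> = \<tau>, OF \<omega> _ that(2) \<tau>(2) [OF that(2)] \<open>h \<noteq> 0\<close>] that(1) B(2)
      by (auto simp: a_def)
    moreover have "contract (a j y) (\<tau> y) = 0" if "y \<notin> B" for j y
      using that by (simp add: a_def contract.zero_left)
    ultimately show ?thesis
      unfolding space by blast
  qed
  finally show ?thesis .
qed

lemma cutoff_integral_bound:
  fixes \<tau> f :: "'n::finite form"
  assumes \<mu>: "finite_borel_measure_on \<Omega> \<mu>" and \<tau>: "integrable \<mu> \<tau>"
    and U: "open U" "cball x r \<subseteq> U" and "r > 0" and f: "continuous_on U f"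
    and C: "\<And>y. y \<in> ball x r \<Longrightarrow> norm (f y) \<le> C"
    and E: "ball x r \<inter> \<Omega> - E \<in> sets \<mu>" "\<And>y. y \<in> U \<inter> E \<Longrightarrow> \<tau> y \<bullet> f y = 0"
  shows "\<bar>\<integral>y. cutoff x r y * (\<tau> y \<bullet> f y) \<partial>\<mu>\<bar> \<le> C * measure (total_variation \<tau> \<mu>) (ball x r \<inter> \<Omega> - E)"
proof -
  have "\<bar>\<integral>y. \<tau> y \<bullet> (cutoff x r y *\<^sub>R f y) \<partial>\<mu>\<bar> \<le> C * measure (total_variation \<tau> \<mu>) (ball x r \<inter> \<Omega> - E)"
  proof (rule total_variation_bound [OF \<tau> _ E(1)])
    show "(\<lambda>y. cutoff x r y *\<^sub>R f y) \<in> borel_measurable \<mu>"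
      by (intro continuous_on_borel_measurable_finite_borel_measure [OF \<mu>]
          continuous_on_cutoff_scaleR [OF f U \<open>r > 0\<close>])
    fix y assume "y \<in> space \<mu>"
    then have "y \<in> \<Omega>" using space_finite_borel_measure_on [OF \<mu>] by simp
    show "\<bar>\<tau> y \<bullet> (cutoff x r y *\<^sub>R f y)\<bar> \<le> C * (indicator (ball x r \<inter> \<Omega> - E) y * norm (\<tau> y))"
    proof (cases "y \<in> ball x r \<inter> \<Omega> - E")
      case True
      have "\<bar>\<tau> y \<bullet> (cutoff x r y *\<^sub>R f y)\<bar> \<le> norm (\<tau> y) * (cutoff x r y * norm (f y))"
        using Cauchy_Schwarz_ineq2 [of "\<tau> y" "cutoff x r y *\<^sub>R f y"] cutoff_nonneg [of x r y] by simp
      also have "\<dots> \<le> norm (\<tau> y) * (1 * C)"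
        using True cutoff_le_1 [of x r y] C [of y] by (intro mult_left_mono mult_mono) auto
      finally show ?thesis using True by (simp add: mult.commute)
    next
      case False
      then have "y \<notin> ball x r \<or> y \<in> U \<inter> E"
        using \<open>y \<in> \<Omega>\<close> U(2) ball_subset_cball [of x r] by blast
      then have "\<tau> y \<bullet> (cutoff x r y *\<^sub>R f y) = 0"
        using cutoff_outside_ball(1) [OF \<open>r > 0\<close>, of y x] E(2) by auto
      then show ?thesis using False by simp
    qed
  qed
  then show ?thesis by simp
qed

lemma bounded_near:
  fixes f :: "'a::heine_borel \<Rightarrow> 'b::real_normed_vector"
  assumes "open U" and "x \<in> U" and "continuous_on U f"
  obtains R C where "R > 0" and "C \<ge> 0" and "\<And>y. y \<in> cball x R \<Longrightarrow> norm (f y) \<le> C"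
proof -
  obtain R where R: "R > 0" "cball x R \<subseteq> U"
    using assms open_contains_cball by blast
  have "bounded (f ` cball x R)"
    by (intro compact_imp_bounded compact_continuous_image continuous_on_subset [OF assms(3) R(2)]) simp
  then obtain C where "\<forall>y\<in>cball x R. norm (f y) \<le> C"
    by (auto simp: bounded_iff)
  then have C: "norm (f y) \<le> C" if "y \<in> cball x R" for y
    using that by blast
  moreover have "C \<ge> 0"
    using C [of x] R(1) norm_ge_zero [of "f x"] by (simp del: norm_ge_zero)
  ultimately show thesis using R(1) that by blast
qed

text \<open>
  For tangent multivectors \<open>t\<close>, this makes every test form with a factor \<open>\<omega>\<^sub>j\<close> invisible.
\<close>

lemma inner_wedge_tangent_eq_0:
  "contract a t = 0 \<Longrightarrow> t \<bullet> wedge (of_vec a) w = 0"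
  by (simp add: contract_adjoint [symmetric])

lemma smallo_if_eventually_le:
  fixes f g h :: "real \<Rightarrow> real"
  assumes "g \<in> o[F](h)" and "\<forall>\<^sub>F r in F. \<bar>f r\<bar> \<le> g r"
  shows "f \<in> o[F](h)"
proof (rule landau_o.big_small_trans [OF _ assms(1)])
  show "f \<in> O[F](g)"
    by (rule bigoI [where c = 1]) (use assms(2) in \<open>auto elim!: eventually_mono\<close>)
qed

lemma tangent_cutoff_integral_smallo:
  fixes \<tau> f :: "'n::finite form" and x :: "'n euc"
  assumes \<mu>: "finite_borel_measure_on \<Omega> \<mu>" and \<tau>: "integrable \<mu> \<tau>"
    and U: "open U" "x \<in> U" and f: "continuous_on U f"
    and E: "\<And>r. ball x r \<subseteq> U \<Longrightarrow> ball x r \<inter> \<Omega> - E \<in> sets \<mu>" "\<And>y. y \<in> U \<inter> E \<Longrightarrow> \<tau> y \<bullet> f y = 0"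
    and small: "(\<lambda>r. measure (total_variation \<tau> \<mu>) (ball x r \<inter> \<Omega> - E)) \<in> o[at_right 0](h)"
  shows "(\<lambda>r. \<integral>y. cutoff x r y * (\<tau> y \<bullet> f y) \<partial>\<mu>) \<in> o[at_right 0](h)"
proof -
  obtain R C where R: "R > 0" "C \<ge> 0" and C: "\<And>y. y \<in> cball x R \<Longrightarrow> norm (f y) \<le> C"
    by (rule bounded_near [OF U f]) blast
  show ?thesis
  proof (rule smallo_if_eventually_le)
    show "(\<lambda>r. C * measure (total_variation \<tau> \<mu>) (ball x r \<inter> \<Omega> - E)) \<in> o[at_right 0](h)"
      using small by simp
    show "\<forall>\<^sub>F r in at_right 0. \<bar>\<integral>y. cutoff x r y * (\<tau> y \<bullet> f y) \<partial>\<mu>\<bar>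
        \<le> C * measure (total_variation \<tau> \<mu>) (ball x r \<inter> \<Omega> - E)"
      using eventually_ball_subset [OF U] eventually_at_right_real [OF R(1)]
    proof eventually_elim
      case (elim r)
      then have r: "r > 0" "cball x r \<subseteq> U" "r \<le> R" by auto
      then have "ball x r \<subseteq> U" using ball_subset_cball by blast
      show ?case
        by (rule cutoff_integral_bound [OF \<mu> \<tau> U(1) r(2,1) f])
           (use r C E \<open>ball x r \<subseteq> U\<close> in auto)
    qed
  qed
qed

lemma wedge_const_C1:
  assumes \<omega>: "Ck_on 1 \<omega> U"
  shows "Ck_on 1 (\<lambda>y. wedge (\<omega> y) \<beta>) U"
    and "\<And>y v. y \<in> U \<Longrightarrow> frechet_derivative (\<lambda>y. wedge (\<omega> y) \<beta>) (at y) v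
      = wedge (frechet_derivative \<omega> (at y) v) \<beta>"
proof -
  have der: "((\<lambda>y. wedge (\<omega> y) \<beta>) has_derivative (\<lambda>v. wedge (frechet_derivative \<omega> (at y) v) \<beta>)) (at y)"
    if "y \<in> U" for y
    by (rule bounded_linear.has_derivative [OF wedge.bounded_linear_left Ck_on_1_has_derivative [OF \<omega> that]])
  then show eq: "frechet_derivative (\<lambda>y. wedge (\<omega> y) \<beta>) (at y) v
      = wedge (frechet_derivative \<omega> (at y) v) \<beta>" if "y \<in> U" for y v
    using frechet_derivative_at [OF der [OF that]] by metis
  have "continuous_on U (\<lambda>y. frechet_derivative (\<lambda>y. wedge (\<omega> y) \<beta>) (at y) v)" for v
  proof (rule continuous_on_eq)
    show "continuous_on U (\<lambda>y. wedge (frechet_derivative \<omega> (at y) v) \<beta>)"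
      using \<omega> by (intro wedge.continuous_on continuous_intros) auto
  qed (simp add: eq)
  moreover have "(\<lambda>y. wedge (\<omega> y) \<beta>) differentiable (at y)" if "y \<in> U" for y
    using der [OF that] by (auto simp: differentiable_def)
  ultimately show "Ck_on 1 (\<lambda>y. wedge (\<omega> y) \<beta>) U"
    by simp
qed

text \<open>
  Testing with \<open>cutoff * (\<omega> \<and> \<beta>)\<close>. Here \<open>G \<beta>\<close> is the form \<open>d\<omega> \<and> \<beta>\<close>; in this shape it appears directly
  when the test form is differentiated, and associativity of \<open>wedge\<close> is avoided. The remaining term
  contains the factor \<open>\<omega>\<close>, so its pairing with \<open>\<tau>\<close> vanishes on the tangency set. Off this set the gradient of
  the cutoff costs a factor \<open>1/r\<close>.
\<close>

lemma localized_stokes: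
  fixes T :: "'n::{finite,linorder} form \<Rightarrow> real" and \<omega> :: "'n form" and x :: "'n euc"
  defines "G \<equiv> \<lambda>\<beta> y. \<Sum>i\<in>UNIV. wedge (axis {i} 1) (wedge (partial_deriv i \<omega> y) \<beta>)"
  assumes \<Omega>: "open \<Omega>"
    and T: "represented_by (Suc (Suc q)) \<Omega> T \<tau> \<mu>" and T': "represented_by (Suc q) \<Omega> (boundary T) \<tau>' \<mu>'"
    and U: "open U" "x \<in> U" "U \<subseteq> \<Omega>"
    and \<omega>: "Ck_on 1 \<omega> U" "\<And>y. y \<in> U \<Longrightarrow> \<omega> y \<in> grade 1" and \<beta>: "\<beta> \<in> grade q"
    and E: "\<And>r. ball x r \<subseteq> U \<Longrightarrow> ball x r \<inter> \<Omega> - E \<in> sets \<mu>"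
      "\<And>y. y \<in> U \<inter> E \<Longrightarrow> contract (to_vec (\<omega> y)) (\<tau> y) = 0"
    and E': "\<And>r. ball x r \<subseteq> U \<Longrightarrow> ball x r \<inter> \<Omega> - E' \<in> sets \<mu>'"
      "\<And>y. y \<in> U \<inter> E' \<Longrightarrow> contract (to_vec (\<omega> y)) (\<tau>' y) = 0"
    and small: "(\<lambda>r. measure (total_variation \<tau> \<mu>) (ball x r \<inter> \<Omega> - E) / r) \<in> o[at_right 0](h)"
    and small': "(\<lambda>r. measure (total_variation \<tau>' \<mu>') (ball x r \<inter> \<Omega> - E')) \<in> o[at_right 0](h)"
  shows "(\<lambda>r. \<integral>y. cutoff x r y * (\<tau> y \<bullet> G \<beta> y) \<partial>\<mu>) \<in> o[at_right 0](h)"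
    and "continuous_on U (G \<beta>)"
proof -
  define f where "f y = wedge (\<omega> y) \<beta>" for y
  have \<mu>: "finite_borel_measure_on \<Omega> \<mu>" "finite_borel_measure_on \<Omega> \<mu>'"
    and int: "integrable \<mu> \<tau>" "integrable \<mu>' \<tau>'"
    using T T' by (auto simp: represented_by_def)
  have \<omega>_eq: "\<omega> y = of_vec (to_vec (\<omega> y))" if "y \<in> U" for y
    using of_vec_to_vec [OF \<omega>(2) [OF that]] by simp
  have f: "Ck_on 1 f U" "\<And>y v. y \<in> U \<Longrightarrow> frechet_derivative f (at y) v = wedge (frechet_derivative \<omega> (at y) v) \<beta>"
    unfolding f_def [abs_def] using wedge_const_C1 [OF \<omega>(1)] by blast+
  have contf: "continuous_on U f" by (rule Ck_on_1_continuous [OF f(1)])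
  show contG: "continuous_on U (G \<beta>)"
    unfolding G_def partial_deriv_def using \<omega>(1)
    by (intro continuous_on_sum wedge.continuous_on continuous_intros) auto
  obtain B where B: "0 < B" "\<And>a b :: 'n mvec. norm (wedge a b) \<le> norm a * norm b * B"
    using wedge.pos_bounded by blast
  obtain R C where R: "R > 0" "C \<ge> 0" and C: "\<And>y. y \<in> cball x R \<Longrightarrow> norm (f y) \<le> C"
    by (rule bounded_near [OF U(1,2) contf]) blast
  let ?v = "\<lambda>r. measure (total_variation \<tau> \<mu>) (ball x r \<inter> \<Omega> - E)"
  let ?v' = "\<lambda>r. measure (total_variation \<tau>' \<mu>') (ball x r \<inter> \<Omega> - E')"
  show "(\<lambda>r. \<integral>y. cutoff x r y * (\<tau> y \<bullet> G \<beta> y) \<partial>\<mu>) \<in> o[at_right 0](h)"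
  proof (rule smallo_if_eventually_le)
    show "(\<lambda>r. C * ?v' r + (4 * B * C) * (?v r / r)) \<in> o[at_right 0](h)"
      by (intro sum_in_smallo) (use small small' in \<open>simp_all only: cmult_in_smallo_iff simp_thms\<close>)
    show "\<forall>\<^sub>F r in at_right 0. \<bar>\<integral>y. cutoff x r y * (\<tau> y \<bullet> G \<beta> y) \<partial>\<mu>\<bar> \<le> C * ?v' r + (4 * B * C) * (?v r / r)"
      using eventually_ball_subset [OF U(1,2)] eventually_at_right_real [OF R(1)]
    proof eventually_elim
      case (elim r)
      then have r: "r > 0" "cball x r \<subseteq> U" "r \<le> R" by auto
      then have ball: "ball x r \<subseteq> U" using ball_subset_cball by blast
      have Cr: "norm (f y) \<le> C" if "y \<in> ball x r" for y
        using C that r(3) by auto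
      define \<eta> where "\<eta> y = cutoff x r y *\<^sub>R f y" for y
      note \<eta> = cutoff_times_C1 [OF f(1) U(1) r(2,1), folded \<eta>_def]
      have off: "cutoff x r y = 0" "cutoff_gradient x r y = 0" if "y \<notin> cball x r" for y
        using cutoff_outside_ball [OF r(1), of y x] that by auto
      have \<eta>_off: "\<eta> y = 0" if "y \<notin> cball x r" for y
        using off [OF that] by (simp add: \<eta>_def)
      have \<eta>_grade: "\<eta> y \<in> grade (Suc q)" for y
      proof (cases "y \<in> U")
        case True
        have "f y \<in> grade (Suc q)"
          unfolding f_def by (subst \<omega>_eq [OF True]) (rule wedge_in_grade [OF \<beta>])
        then show ?thesis
          unfolding \<eta>_def by (rule subspace_scale [OF subspace_grade])
      next
        case False
        then show ?thesis
          using \<eta>_off [of y] r(2) subspace_0 [OF subspace_grade, of "Suc q"] by (metis subsetD)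
      qed
      have d\<eta>: "ext_deriv \<eta> y = cutoff x r y *\<^sub>R G \<beta> y + wedge (of_vec (cutoff_gradient x r y)) (f y)" for y
      proof (cases "y \<in> U")
        case True
        have "ext_deriv \<eta> y = (\<Sum>i\<in>UNIV. cutoff x r y *\<^sub>R wedge (axis {i} 1) (wedge (partial_deriv i \<omega> y) \<beta>)
            + cutoff_gradient x r y $ i *\<^sub>R wedge (axis {i} 1) (f y))"
          unfolding ext_deriv_def partial_deriv_def
          by (intro sum.cong refl)
             (simp add: \<eta>(2) [OF True, folded \<eta>_def] f(2) [OF True] wedge.add_right wedge.scaleR_right inner_axis)
        then show ?thesis
          by (simp add: G_def wedge_of_vec_expansion sum.distrib scaleR_sum_right)
      next
        case False
        then have "y \<notin> cball x r" using r(2) by auto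
        then show ?thesis
          using off [of y] ext_deriv_eq_0_if_supported [of "cball x r" \<eta> y] \<eta>_off
          by (simp add: wedge.zero_left linear_0 [OF linear_of_vec])
      qed
      have stokes: "(\<integral>y. \<tau>' y \<bullet> \<eta> y \<partial>\<mu>') = (\<integral>y. \<tau> y \<bullet> ext_deriv \<eta> y \<partial>\<mu>)"
      proof (rule stokes_C1 [OF \<Omega> T T' _ \<eta>_grade compact_cball _ \<eta>_off])
        show "Ck_on 1 \<eta> UNIV" using \<eta>(1) by (simp add: \<eta>_def [abs_def])
        show "cball x r \<subseteq> \<Omega>" using r(2) U(3) by blast
      qed
      have lhs: "\<bar>\<integral>y. \<tau>' y \<bullet> \<eta> y \<partial>\<mu>'\<bar> \<le> C * ?v' r"
      proof -
        have "\<tau>' y \<bullet> f y = 0" if "y \<in> U \<inter> E'" for y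
          unfolding f_def using that \<omega>_eq [of y] inner_wedge_tangent_eq_0 [OF E'(2) [OF that]] by simp
        from cutoff_integral_bound [OF \<mu>(2) int(2) U(1) r(2,1) contf Cr E'(1) [OF ball] this]
        show ?thesis by (simp add: \<eta>_def)
      qed
      let ?H = "\<lambda>y. wedge (of_vec (cutoff_gradient x r y)) (f y)"
      have cont: "continuous_on UNIV (\<lambda>y. cutoff x r y *\<^sub>R G \<beta> y)"
        by (rule continuous_on_cutoff_scaleR [OF contG U(1) r(2,1)])
      have "continuous_on UNIV (ext_deriv \<eta>)"
        using Ck_on_ext_deriv [of 0 \<eta>] \<eta>(1) by (simp add: \<eta>_def [abs_def])
      from continuous_on_diff [OF this cont]
      have contH: "continuous_on UNIV ?H" by (simp add: d\<eta>)
      note meas = continuous_on_borel_measurable_finite_borel_measure [OF \<mu>(1) cont]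
        continuous_on_borel_measurable_finite_borel_measure [OF \<mu>(1) contH]
      have supp: "cutoff x r y *\<^sub>R G \<beta> y = 0" "?H y = 0" if "y \<notin> cball x r" for y
        using off [OF that] by (simp_all add: wedge.zero_left linear_0 [OF linear_of_vec])
      obtain K where "\<And>y. norm (cutoff x r y *\<^sub>R G \<beta> y) \<le> K"
        using bounded_if_supported [OF cont compact_cball supp(1)] by blast
      then have int1: "integrable \<mu> (\<lambda>y. \<tau> y \<bullet> (cutoff x r y *\<^sub>R G \<beta> y))"
        using integrable_inner_bounded(1) [OF int(1) meas(1)] by blast
      obtain K where "\<And>y. norm (?H y) \<le> K"
        using bounded_if_supported [OF contH compact_cball supp(2)] by blast
      then have int2: "integrable \<mu> (\<lambda>y. \<tau> y \<bullet> ?H y)"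
        using integrable_inner_bounded(1) [OF int(1) meas(2)] by blast
      have H: "\<bar>\<integral>y. \<tau> y \<bullet> ?H y \<partial>\<mu>\<bar> \<le> (4 / r * C * B) * ?v r"
      proof (rule total_variation_bound [OF int(1) meas(2) E(1) [OF ball]])
        fix y assume "y \<in> space \<mu>"
        then have "y \<in> \<Omega>" using space_finite_borel_measure_on [OF \<mu>(1)] by simp
        show "\<bar>\<tau> y \<bullet> ?H y\<bar> \<le> 4 / r * C * B * (indicator (ball x r \<inter> \<Omega> - E) y * norm (\<tau> y))"
        proof (cases "y \<in> ball x r \<inter> \<Omega> - E")
          case True
          have "norm (?H y) \<le> norm (cutoff_gradient x r y) * norm (f y) * B"
            using B(2) [of "of_vec (cutoff_gradient x r y)" "f y"] by (simp add: norm_of_vec)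
          also have "\<dots> \<le> 4 / r * C * B"
            using norm_cutoff_gradient_le [OF r(1), of x y] Cr [of y] True B(1) r(1)
            by (intro mult_right_mono mult_mono) auto
          finally have "norm (\<tau> y) * norm (?H y) \<le> norm (\<tau> y) * (4 / r * C * B)"
            by (rule mult_left_mono) simp
          then show ?thesis
            using Cauchy_Schwarz_ineq2 [of "\<tau> y" "?H y"] True by (simp add: mult.commute)
        next
          case False
          then consider "y \<notin> ball x r" | "y \<in> U \<inter> E"
            using \<open>y \<in> \<Omega>\<close> ball by blast
          then have "\<tau> y \<bullet> ?H y = 0"
          proof cases
            case 1
            then show ?thesis
              by (simp add: cutoff_outside_ball(2) [OF r(1)] wedge.zero_left linear_0 [OF linear_of_vec])
          next
            case 2
            then have "?H y = - wedge (of_vec (to_vec (\<omega> y))) (wedge (of_vec (cutoff_gradient x r y)) \<beta>)"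
              unfolding f_def using \<omega>_eq [of y] wedge_anticommute by (metis IntD1)
            then show ?thesis
              using inner_wedge_tangent_eq_0 [OF E(2) [OF 2]] by simp
          qed
          then show ?thesis using False by simp
        qed
      qed
      have "(\<integral>y. \<tau> y \<bullet> ext_deriv \<eta> y \<partial>\<mu>)
          = (\<integral>y. \<tau> y \<bullet> (cutoff x r y *\<^sub>R G \<beta> y) \<partial>\<mu>) + (\<integral>y. \<tau> y \<bullet> ?H y \<partial>\<mu>)"
        unfolding d\<eta> inner_add_right by (rule Bochner_Integration.integral_add [OF int1 int2])
      then show ?case
        using stokes lhs H by (simp add: abs_le_iff algebra_simps)
    qed
  qed
qed

section \<open>Tangent normal currents and involutivity\<close>

theorem corollary4p1:
  fixes \<Omega> N \<Upsilon> :: "'n::{finite,linorder} euc set"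
    and k :: nat
    and T :: "'n form \<Rightarrow> real"
    and \<tau> \<tau>' :: "'n euc \<Rightarrow> 'n mvec"
    and \<mu> \<mu>' :: "'n euc measure"
    and D :: "'n euc \<Rightarrow> 'n euc set"
  assumes "CARD('n) \<ge> 2" and "1 \<le> k" and "k \<le> CARD('n)"
    and "open \<Omega>"
    and "normal_current k \<Omega> T"
    and "represented_by k \<Omega> T \<tau> \<mu>"
    and "represented_by (k - 1) \<Omega> (boundary T) \<tau>' \<mu>'"
    and "Cp_distribution 1 k \<Omega> D"
    and "\<Upsilon> = {x\<in>\<Omega>. \<tau> x \<noteq> 0 \<and>
      x \<in> superdensity_set (total_variation \<tau> \<mu>) 1 (tangency_set k \<Omega> \<tau> D) \<and>
      (\<exists>s\<ge>0.
        lower_density s \<mu> x = upper_density s \<mu> x \<and>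
        0 < lower_density s \<mu> x \<and> lower_density s \<mu> x < \<infinity> \<and>
        (\<lambda>r. measure (total_variation \<tau>' \<mu>')
            (ball x r \<inter> \<Omega> - tangency_set (k - 1) \<Omega> \<tau>' D)) \<in> o[at_right 0](\<lambda>r. r powr s))}"
    and "N \<in> null_sets (completion \<mu>)"
    and "\<And>x r. x \<in> \<Omega> - N \<Longrightarrow> r > 0 \<Longrightarrow> measure \<mu> (ball x r \<inter> \<Omega>) > 0"
    and "\<And>x. x \<in> \<Omega> - N \<Longrightarrow>
      ((\<lambda>r. (LINT y:ball x r \<inter> \<Omega>|\<mu>. \<tau> y) /\<^sub>R measure \<mu> (ball x r \<inter> \<Omega>)) \<longlongrightarrow> \<tau> x) (at_right 0)"
    and "\<And>x. x \<in> \<Omega> - N \<Longrightarrow>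
      ((\<lambda>r. (LINT y:ball x r \<inter> \<Omega>|\<mu>. norm (\<tau> y)) / measure \<mu> (ball x r \<inter> \<Omega>)) \<longlongrightarrow> norm (\<tau> x)) (at_right 0)"
    and "x \<in> \<Upsilon> - N"
  shows "simple_mvec k (\<tau> x) \<and> mvec_span k (\<tau> x) = D x \<and> involutive_at k \<Omega> D x"
proof -
  have k0: "k \<noteq> 0" using \<open>1 \<le> k\<close> by auto
  have \<mu>: "finite_borel_measure_on \<Omega> \<mu>" "finite_borel_measure_on \<Omega> \<mu>'"
    and int: "integrable \<mu> \<tau>" "integrable \<mu>' \<tau>'"
    and grade: "\<And>y. y \<in> \<Omega> \<Longrightarrow> \<tau> y \<in> grade k" "\<And>y. y \<in> \<Omega> \<Longrightarrow> \<tau>' y \<in> grade (k - 1)"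
    using \<open>represented_by k \<Omega> T \<tau> \<mu>\<close> \<open>represented_by (k - 1) \<Omega> (boundary T) \<tau>' \<mu>'\<close>
    by (auto simp: represented_by_def)
  have space: "space (total_variation \<tau> \<mu>) = \<Omega>"
    using space_finite_borel_measure_on [OF \<mu>(1)] by (simp add: total_variation_def)
  have meas: "\<tau> \<in> borel_measurable \<mu>" "\<tau>' \<in> borel_measurable \<mu>'"
    using int by auto
  define E where "E = tangency_set k \<Omega> \<tau> D"
  define E' where "E' = tangency_set (k - 1) \<Omega> \<tau>' D"
  define V where "V r = measure (total_variation \<tau> \<mu>) (ball x r \<inter> \<Omega>)" for r
  have x: "x \<in> \<Omega>" "\<tau> x \<noteq> 0" "x \<in> \<Omega> - N"
    and super: "x \<in> superdensity_set (total_variation \<tau> \<mu>) 1 E"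
    using assms(9,14) by (auto simp: E_def)
  obtain s where s: "lower_density s \<mu> x = upper_density s \<mu> x"
    "0 < lower_density s \<mu> x" "lower_density s \<mu> x < \<infinity>"
    "(\<lambda>r. measure (total_variation \<tau>' \<mu>') (ball x r \<inter> \<Omega> - E')) \<in> o[at_right 0](\<lambda>r. r powr s)"
    using assms(9,14) by (auto simp: E'_def)
  have dens: "(\<lambda>r. measure \<mu> (ball x r \<inter> \<Omega>)) \<in> O[at_right 0](\<lambda>r. r powr s)"
    "(\<lambda>r. r powr s) \<in> O[at_right 0](\<lambda>r. measure \<mu> (ball x r \<inter> \<Omega>))"
    using density_bounds_imp_bigo [of "\<lambda>r. measure \<mu> (ball x r \<inter> \<Omega>)" s] s
    by (simp_all add: lower_density_def upper_density_def space_finite_borel_measure_on [OF \<mu>(1)])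
  note avg = assms(12) [OF x(3)] assms(13) [OF x(3)]
  have V_bigo: "V \<in> O[at_right 0](\<lambda>r. r powr s)"
  proof -
    have "V r = (LINT y:ball x r \<inter> \<Omega>|\<mu>. norm (\<tau> y))" for r
    proof -
      have "ball x r \<inter> \<Omega> \<in> sets \<mu>"
        using \<mu>(1) by (auto simp: finite_borel_measure_on_def sets_restrict_space)
      then show ?thesis
        unfolding V_def by (simp add: measure_total_variation [OF int(1)] set_lebesgue_integral_def)
    qed
    then have "((\<lambda>r. V r / measure \<mu> (ball x r \<inter> \<Omega>)) \<longlongrightarrow> norm (\<tau> x)) (at_right 0)"
      using avg(2) by simp
    moreover have "\<forall>\<^sub>F r in at_right 0. measure \<mu> (ball x r \<inter> \<Omega>) \<noteq> 0"
      using eventually_at_right_less [of 0]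
      by eventually_elim (use assms(11) [OF x(3)] in \<open>simp add: less_imp_neq [symmetric]\<close>)
    ultimately have "V \<in> O[at_right 0](\<lambda>r. measure \<mu> (ball x r \<inter> \<Omega>))"
      by (rule bigoI_tendsto)
    then show ?thesis
      using dens(1) by (rule landau_o.big_trans)
  qed
  have small: "(\<lambda>r. measure (total_variation \<tau> \<mu>) (ball x r \<inter> \<Omega> - E) / r) \<in> o[at_right 0](\<lambda>r. r powr s)"
    using superdensity_set_imp_smallo [OF super] V_bigo
    unfolding space V_def [abs_def] by (rule landau_o.small_big_trans)
  have small1: "(\<lambda>r. measure (total_variation \<tau> \<mu>) (ball x r \<inter> \<Omega> - E)) \<in> o[at_right 0](\<lambda>r. r powr s)"
  proof (rule smallo_if_eventually_le [OF small])
    show "\<forall>\<^sub>F r in at_right 0. \<bar>measure (total_variation \<tau> \<mu>) (ball x r \<inter> \<Omega> - E)\<bar>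
        \<le> measure (total_variation \<tau> \<mu>) (ball x r \<inter> \<Omega> - E) / r"
      using eventually_at_right_real [of 0 1, simplified]
    proof eventually_elim
      case (elim r)
      then have "measure (total_variation \<tau> \<mu>) (ball x r \<inter> \<Omega> - E) * r
          \<le> measure (total_variation \<tau> \<mu>) (ball x r \<inter> \<Omega> - E) * 1"
        by (intro mult_left_mono) auto
      then show ?case using elim by (simp add: field_simps)
    qed
  qed

  obtain U \<omega> where U: "x \<in> U" "U \<subseteq> \<Omega>" and \<omega>: "defining_forms 1 k D U \<omega>"
    using \<open>Cp_distribution 1 k \<Omega> D\<close> x(1) unfolding Cp_distribution_def by blast
  have D: "subspace (D x)" "dim (D x) = k"
    using \<open>Cp_distribution 1 k \<Omega> D\<close> x(1) by (auto simp: Cp_distribution_def distribution_on_def)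
  have "open U" and \<omega>_C1: "\<And>j. j < CARD('n) - k \<Longrightarrow> Ck_on 1 (\<omega> j) U"
    and \<omega>_grade: "\<And>j y. j < CARD('n) - k \<Longrightarrow> y \<in> U \<Longrightarrow> \<omega> j y \<in> grade 1"
    using \<omega> unfolding defining_forms_def by blast+
  have E_meas: "ball x r \<inter> \<Omega> - E \<in> sets \<mu>" if "ball x r \<subseteq> U" for r
    unfolding E_def by (rule tangency_set_measurable [OF \<omega> \<mu>(1) meas(1) grade(1) k0 open_ball that])
  have E_tangent: "contract (to_vec (\<omega> j y)) (\<tau> y) = 0" if "j < CARD('n) - k" "y \<in> U \<inter> E" for j y
    using tangency_set_iff [OF \<omega>, of y \<Omega> \<tau> k] that U(2) grade(1) k0 unfolding E_def by blast
  note tangent_average_eq_0 = tangent_average_eq_0 [OF \<mu>(1) int(1) \<open>open U\<close> U _ assms(11) [OF x(3)] avg x(2) dens]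

  have "contract (to_vec (\<omega> j x)) (\<tau> x) = 0" if j: "j < CARD('n) - k" for j
  proof -
    \<comment> \<open>With this choice, orthogonality of \<open>\<tau> x\<close> to \<open>wedge (\<omega> j x) \<beta>\<close> says that \<open>\<beta> \<bullet> \<beta> = 0\<close>.\<close>
    define \<beta> where "\<beta> = contract (to_vec (\<omega> j x)) (\<tau> x)"
    have cont: "continuous_on U (\<lambda>y. wedge (\<omega> j y) \<beta>)"
      by (intro Ck_on_1_continuous wedge_const_C1 \<omega>_C1 j)
    have \<omega>_eq: "\<omega> j y = of_vec (to_vec (\<omega> j y))" if "y \<in> U" for y
      using of_vec_to_vec [OF \<omega>_grade [OF j that]] by simp
    have tangent: "\<tau> y \<bullet> wedge (\<omega> j y) \<beta> = 0" if "y \<in> U \<inter> E" for y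
      using that \<omega>_eq [of y] inner_wedge_tangent_eq_0 [OF E_tangent [OF j that]] by simp
    have "\<tau> x \<bullet> wedge (\<omega> j x) \<beta> = 0"
      by (rule tangent_average_eq_0 [OF cont])
         (auto intro: tangent_cutoff_integral_smallo [OF \<mu>(1) int(1) \<open>open U\<close> U(1) cont E_meas tangent small1])
    then have "\<beta> \<bullet> \<beta> = 0"
      using \<omega>_eq [OF U(1)] by (metis \<beta>_def contract_adjoint)
    then show ?thesis by (simp add: \<beta>_def)
  qed
  then have "x \<in> tangency_set k \<Omega> \<tau> D"
    using tangency_set_iff [where \<tau> = \<tau>, OF \<omega> U(1) x(1) grade(1) [OF x(1)] k0] by simp
  then have subset: "mvec_span k (\<tau> x) \<subseteq> D x"
    by (simp add: tangency_set_def)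
  then have span: "mvec_span k (\<tau> x) = D x"
    by (intro mvec_span_eq_if_subset [OF k0 grade(1) [OF x(1)] x(2) D])
  have carried: "carried_by (D x) (\<tau> x)"
    using carried_by_mvec_span [OF k0 grade(1) [OF x(1)]] span by simp
  have simple: "simple_mvec k (\<tau> x)"
    using simple_if_carried_by [OF D(1) _ carried] grade(1) [OF x(1)] D(2) k0 by simp
  have wedge0: "wedge (of_vec u) (\<tau> x) = 0" if "u \<in> D x" for u
    using wedge_eq_0_if_carried_by [OF D(1) _ carried that] grade(1) [OF x(1)] D(2) by simp

  have "wedge (of_vec u) (of_vec v) \<bullet> ext_deriv (\<omega> j) x = 0"
    if j: "j < CARD('n) - k" and uv: "u \<in> D x" "v \<in> D x" for j u v
  proof (cases "k = 1")
    \<comment> \<open>There are no forms \<open>\<beta>\<close> of degree \<open>k - 2\<close> to test with, but a two-vector carried by a line vanishes.\<close>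
    case True
    have "axis {} 1 \<in> grade 0"
      using axis_in_grade [of "{}"] by simp
    then have "wedge (of_vec u) (wedge (of_vec v) (axis {} 1)) \<in> grade 2"
      using wedge_in_grade by (metis numeral_2_eq_2)
    moreover have "carried_by (D x) (wedge (of_vec u) (wedge (of_vec v) (axis {} 1)))"
      by (intro carried_by_wedge uv) (simp add: carried_by_def)
    ultimately have "wedge (of_vec u) (of_vec v) = 0"
      using carried_by_low_dim_eq_0 [OF D(1)] D(2) True by (simp add: wedge_one)
    then show ?thesis by simp
  next
    case False
    then obtain q where k: "k = Suc (Suc q)"
      using k0 by (metis One_nat_def not0_implies_Suc)
    \<comment> \<open>With this choice, pairing \<open>\<tau> x\<close> with \<open>d\<omega> \<and> \<beta>\<close> evaluates \<open>d\<omega>\<close> on \<open>u \<and> v\<close>.\<close>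
    define \<beta> where "\<beta> = contract v (contract u (\<tau> x))"
    have \<beta>: "\<beta> \<in> grade q"
      unfolding \<beta>_def using grade(1) [OF x(1)] k by (intro contract_in_grade) simp
    have E'_meas: "ball x r \<inter> \<Omega> - E' \<in> sets \<mu>'" if "ball x r \<subseteq> U" for r
      unfolding E'_def
      by (rule tangency_set_measurable [OF \<omega> \<mu>(2) meas(2) grade(2) _ open_ball that]) (simp_all add: k)
    have E'_tangent: "contract (to_vec (\<omega> j y)) (\<tau>' y) = 0" if "y \<in> U \<inter> E'" for y
      using tangency_set_iff [OF \<omega>, of y \<Omega> \<tau>' "k - 1"] that U(2) grade(2) k j unfolding E'_def by auto
    let ?G = "\<lambda>y. \<Sum>i\<in>UNIV. wedge (axis {i} 1) (wedge (partial_deriv i (\<omega> j) y) \<beta>)"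
    have T: "represented_by (Suc (Suc q)) \<Omega> T \<tau> \<mu>" "represented_by (Suc q) \<Omega> (boundary T) \<tau>' \<mu>'"
      using assms(6,7) k by simp_all
    note stokes = localized_stokes [OF \<open>open \<Omega>\<close> T \<open>open U\<close> U \<omega>_C1 [OF j] \<omega>_grade [OF j] \<beta> E_meas E_tangent [OF j]
        E'_meas E'_tangent small s(4)]
    have "\<tau> x \<bullet> ?G x = 0"
    proof (rule tangent_average_eq_0)
      show "continuous_on U ?G"
        by (rule stokes(2))
      show "(\<lambda>r. \<integral>y. cutoff x r y * (\<tau> y \<bullet> ?G y) \<partial>\<mu>) \<in> o[at_right 0](\<lambda>r. r powr s)"
        by (rule stokes(1))
    qed
    moreover have "\<tau> x \<bullet> wedge (axis {i} 1) (wedge (partial_deriv i (\<omega> j) x) \<beta>)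
        = (\<tau> x \<bullet> \<tau> x) * (wedge (of_vec u) (of_vec v) \<bullet> wedge (axis {i} 1) (partial_deriv i (\<omega> j) x))" for i
    proof -
      have "partial_deriv i (\<omega> j) x \<in> grade 1"
        unfolding partial_deriv_def using \<omega>_C1 [OF j] U(1)
        by (intro frechet_derivative_in_grade [OF \<open>open U\<close> U(1)] \<omega>_grade [OF j]) auto
      from of_vec_to_vec [OF this] show ?thesis
        using inner_wedge_wedge_contract_contract [OF wedge0 [OF uv(1)] wedge0 [OF uv(2)],
            of "axis i 1" "to_vec (partial_deriv i (\<omega> j) x)"]
        by (simp add: \<beta>_def)
    qed
    ultimately have "(\<tau> x \<bullet> \<tau> x) * (wedge (of_vec u) (of_vec v) \<bullet> ext_deriv (\<omega> j) x) = 0"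
      by (simp add: ext_deriv_def inner_sum_right sum_distrib_left)
    then show ?thesis using x(2) by simp
  qed
  then have "involutive_at k \<Omega> D x"
    unfolding involutive_at_def using U \<omega> by blast
  then show ?thesis
    using simple span by blast
qed

end
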